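(* Let $n\ge2$ and $j,\ell\ge1$. For $m\ge1$, call $$\gamma_t=y_{2m-3}(k)\,e_1+(e_2,\ldots,e_n)\,\eta_{2m-3}(k)$$ the $(2m-1)$-th Airy curve flow on $\mathcal{M}_n$, where $(e_1,\ldots,e_n)(\cdot,t)$ is a parallel frame along $\gamma(\cdot,t)$ and $k(\cdot,t)$ is the corresponding vector of principal curvatures. Then: (1) The $(2j-1)$-th and the $(2\ell-1)$-th Airy curve flows commute. (2) If $\gamma(x,t)$ is a solution of the $(2j-1)$-th Airy curve flow in $\mathcal{M}_n$, then $\hat F_{2\ell-1}(\gamma(\cdot,t))$ is constant in $t$, where $\hat F_{2\ell-1}(\gamma)=-\frac{1}{2\ell-1}\oint y_{2\ell-1}(k)\,dx$ and $k$ is the principal curvature vector of $\gamma$ with respect to any parallel frame.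
   Context: Parallel frames. For $\gamma$ parametrized by arc-length $x$, a parallel frame is a smooth $SO(n)$-valued map $g=(e_1,\ldots,e_n)$ with $e_1=\gamma_x$ and $g^{-1}g_x=\begin{pmatrix}0&-k^t\\ k&0\end{pmatrix}$; $k=(k_1,\ldots,k_{n-1})^t$ is the vector of principal curvatures with respect to $g$. Another parallel frame is $g\,\mathrm{diag}(1,c)$ with constant $c\in SO(n-1)$ and has principal curvatures $c^{-1}k$; the right-hand side of the Airy curve flow and $\hat F_{2\ell-1}$ do not depend on the choice of parallel frame. $\mathcal{M}_n$ is the space of smooth $\gamma:S^1\to\mathbb{R}^n$ with $\|\gamma_x\|\equiv1$ (with trivial normal holonomy, so that parallel frames are periodic). The coefficients $Q_i$. Write $(n+1)\times(n+1)$ matrices in blocks of sizes $1,1,n-1$. Let $a=e_{21}-e_{12}\in so(n+1)$ ($e_{ij}$ elementary matrices) and $u=\Psi(k)=\begin{pmatrix}0&0&0\\ 0&0&-k^t\\ 0&k&0\end{pmatrix}$. There is a unique formal series $Q(u,\lambda)=a\lambda+\sum_{i\ge0}Q_i(u)\lambda^{-i}$ with $$Q_{2i-1}=\begin{pmatrix}0&-y_{2i-1}&-\eta_{2i-1}^t\\ y_{2i-1}&0&0\\ \eta_{2i-1}&0&0\end{pmatrix},\qquad Q_{2i}=\begin{pmatrix}0&0&0\\ 0&0&-z_{2i}^t\\ 0&z_{2i}&\xi_{2i}\end{pmatrix}$$ ($y$ scalar, $\eta,z\in\mathbb{R}^{n-1}$, $\xi\in so(n-1)$) such that $[\partial_x+a\lambda+u,Q(u,\lambda)]=0$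 and $Q(u,\lambda)$ is conjugate to $a\lambda$; all entries are differential polynomials in $k$. Set $Q_{-1}=a$ (so $y_{-1}=1$, $\eta_{-1}=0$). For example $y_1=-\frac12\|k\|^2$, $\eta_1=-k_x$, $y_3=k^tk_{xx}-\frac12\|k_x\|^2+\frac38\|k\|^4$. *)

theory Defs
  imports "HOL-Analysis.Analysis" "HOL-Computational_Algebra.Formal_Laurent_Series"
begin

text \<open>
  Conventions. The type variable \<open>'m\<close> indexes \<open>n - 1\<close> coordinates, so \<open>'m option\<close> indexes
  the \<open>n\<close> coordinates (\<open>None\<close> is the first one) and \<open>'m option option\<close> indexes \<open>n + 1\<close>
  coordinates in blocks of sizes \<open>1, 1, n - 1\<close>, namely \<open>None\<close>, \<open>Some None\<close>,
  \<open>Some (Some i)\<close>. As \<open>'m\<close> is an arbitrary finite type, \<open>n = CARD('m) + 1\<close> is an arbitrary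
  natural number with \<open>n \<ge> 2\<close>. The circle is the real line modulo \<open>L\<close>, with \<open>L > 0\<close> the
  length of the curves; a closed curve is an \<open>L\<close>-periodic function on the real line.
\<close>


section \<open>Smooth maps\<close>

primrec Ck_on :: "nat \<Rightarrow> ('a::real_normed_vector \<Rightarrow> 'b::real_normed_vector) \<Rightarrow> 'a set \<Rightarrow> bool" where
  "Ck_on 0 f S \<longleftrightarrow> continuous_on S f"
| "Ck_on (Suc k) f S \<longleftrightarrow>
     (\<forall>x\<in>S. f differentiable (at x)) \<and> (\<forall>v. Ck_on k (\<lambda>x. frechet_derivative f (at x) v) S)"

text \<open>Only used for open \<open>S\<close> in a Euclidean space.\<close>

definition smooth_on :: "('a::real_normed_vector \<Rightarrow> 'b::real_normed_vector) \<Rightarrow> 'a set \<Rightarrow> bool" where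
  "smooth_on f S \<longleftrightarrow> (\<forall>k. Ck_on k f S)"


section \<open>The formal series \<open>Q(u, \<lambda>)\<close>\<close>

definition odd_block :: "real \<Rightarrow> real^'m \<Rightarrow> real^('m::finite option option)^('m option option)" where
  "odd_block y \<eta> = (\<chi> r c. case (r, c) of
       (None, Some None) \<Rightarrow> - y
     | (None, Some (Some i)) \<Rightarrow> - \<eta> $ i
     | (Some None, None) \<Rightarrow> y
     | (Some (Some i), None) \<Rightarrow> \<eta> $ i
     | _ \<Rightarrow> 0)"

definition even_block :: "real^'m \<Rightarrow> real^'m^'m \<Rightarrow> real^('m::finite option option)^('m option option)" where
  "even_block z \<xi> = (\<chi> r c. case (r, c) of
       (Some None, Some (Some i)) \<Rightarrow> - z $ i
     | (Some (Some i), Some None) \<Rightarrow> z $ i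
     | (Some (Some i), Some (Some j)) \<Rightarrow> \<xi> $ i $ j
     | _ \<Rightarrow> 0)"

definition a_mat :: "real^('m::finite option option)^('m option option)" where
  "a_mat = (\<chi> r c. case (r, c) of
       (Some None, None) \<Rightarrow> 1
     | (None, Some None) \<Rightarrow> - 1
     | _ \<Rightarrow> 0)"

definition Psi :: "real^'m \<Rightarrow> real^('m::finite option option)^('m option option)" where
  "Psi v = even_block v 0"

text \<open>
  A formal series in \<open>\<lambda>\<close> with finitely many positive powers is a formal Laurent series in the
  variable \<open>X = 1/\<lambda>\<close>; thus \<open>\<lambda>\<close> is \<open>fls_X_inv\<close>, and the coefficient of \<open>\<lambda>\<close> to the power \<open>-i\<close>
  is \<open>fls_nth _ i\<close>. A series with matrix coefficients is a matrix of such Laurent series.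
\<close>

definition coeff_mat :: "(real fls)^'N^'N \<Rightarrow> int \<Rightarrow> real^'N^'N" where
  "coeff_mat A i = map_matrix (\<lambda>f. fls_nth f i) A"

definition a_lambda :: "(real fls)^('m::finite option option)^('m option option)" where
  "a_lambda = map_matrix (\<lambda>c. fls_const c * fls_X_inv) a_mat"

definition lax_mat :: "real^'m \<Rightarrow> (real fls)^('m::finite option option)^('m option option)" where
  "lax_mat v = a_lambda + map_matrix fls_const (Psi v)"

text \<open>
  The derivative clause is the coefficient of \<open>\<lambda>\<close> to the power \<open>-i\<close> in
  \<open>[\<partial>\<^sub>x + a\<lambda> + u, Q] = Q\<^sub>x + [a\<lambda> + u, Q] = 0\<close>. In the last clause \<open>**\<close> and \<open>matrix_inv\<close>
  are taken over the field of Laurent series.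
\<close>

definition is_Q_series ::
  "(real \<Rightarrow> real^'m) \<Rightarrow> (real \<Rightarrow> (real fls)^('m::finite option option)^('m option option)) \<Rightarrow> bool" where
  "is_Q_series k Q \<longleftrightarrow> (\<forall>x.
     (\<forall>i < -1. coeff_mat (Q x) i = 0) \<and>
     coeff_mat (Q x) (-1) = a_mat \<and>
     (\<forall>i \<ge> 0. odd i \<longrightarrow> (\<exists>y \<eta>. coeff_mat (Q x) i = odd_block y \<eta>)) \<and>
     (\<forall>i \<ge> 0. even i \<longrightarrow> (\<exists>z \<xi>. transpose \<xi> = - \<xi> \<and> coeff_mat (Q x) i = even_block z \<xi>)) \<and>
     (\<forall>i. ((\<lambda>x'. coeff_mat (Q x') i) has_vector_derivative
             - coeff_mat (lax_mat (k x) ** Q x - Q x ** lax_mat (k x)) i) (at x)) \<and>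
     (\<exists>P :: (real fls)^('m option option)^('m option option).
        invertible P \<and> Q x = P ** a_lambda ** matrix_inv P))"

text \<open>
  For smooth \<open>k\<close> there is exactly one such series: the recursion determines \<open>Q\<^sub>i\<close> up to a term
  commuting with \<open>a\<close>, and that term is determined by conjugacy to \<open>a\<lambda>\<close>.
\<close>

definition Q_series ::
  "(real \<Rightarrow> real^'m) \<Rightarrow> real \<Rightarrow> (real fls)^('m::finite option option)^('m option option)" where
  "Q_series k = (THE Q. is_Q_series k Q)"

definition y_coeff :: "int \<Rightarrow> (real \<Rightarrow> real^'m::finite) \<Rightarrow> real \<Rightarrow> real" where
  "y_coeff i k x = coeff_mat (Q_series k x) i $ Some None $ None"

definition eta_coeff :: "int \<Rightarrow> (real \<Rightarrow> real^'m::finite) \<Rightarrow> real \<Rightarrow> real^'m" where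
  "eta_coeff i k x = (\<chi> p. coeff_mat (Q_series k x) i $ Some (Some p) $ None)"


section \<open>Curves and parallel frames\<close>

definition unit_speed_curve :: "(real \<Rightarrow> real^('m::finite option)) \<Rightarrow> bool" where
  "unit_speed_curve \<gamma> \<longleftrightarrow> smooth_on \<gamma> UNIV \<and> (\<forall>x. norm (vector_derivative \<gamma> (at x)) = 1)"

definition curvature_mat :: "real^'m \<Rightarrow> real^('m::finite option)^('m option)" where
  "curvature_mat v = (\<chi> r c. case (r, c) of
       (None, Some i) \<Rightarrow> - v $ i
     | (Some i, None) \<Rightarrow> v $ i
     | _ \<Rightarrow> 0)"

text \<open>
  \<open>g\<close> is a parallel frame along \<open>\<gamma>\<close> and \<open>k\<close> its vector of principal curvatures; \<open>e\<^sub>1\<close> is the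
  column \<open>None\<close> of \<open>g\<close>. The frame lives on the real line: it is not required to be periodic.
\<close>

definition parallel_frame ::
  "(real \<Rightarrow> real^('m::finite option)) \<Rightarrow> (real \<Rightarrow> real^('m option)^('m option)) \<Rightarrow> (real \<Rightarrow> real^'m) \<Rightarrow> bool" where
  "parallel_frame \<gamma> g k \<longleftrightarrow> smooth_on g UNIV \<and> (\<forall>x.
     rotation_matrix (g x) \<and>
     column None (g x) = vector_derivative \<gamma> (at x) \<and>
     matrix_inv (g x) ** vector_derivative g (at x) = curvature_mat (k x))"

text \<open>Trivial normal holonomy is expressed by the existence of a periodic parallel frame.\<close>

definition curve_space :: "real \<Rightarrow> (real \<Rightarrow> real^('m::finite option)) set" where
  "curve_space L = {\<gamma>. unit_speed_curve \<gamma> \<and> (\<forall>x. \<gamma> (x + L) = \<gamma> x) \<and>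
     (\<exists>g k. parallel_frame \<gamma> g k \<and> (\<forall>x. g (x + L) = g x))}"


section \<open>Airy curve flows and the functionals\<close>

definition airy_rhs ::
  "nat \<Rightarrow> (real \<Rightarrow> real^('m::finite option)^('m option)) \<Rightarrow> (real \<Rightarrow> real^'m) \<Rightarrow> real \<Rightarrow> real^('m option)" where
  "airy_rhs m g k x =
     y_coeff (2 * int m - 3) k x *\<^sub>R column None (g x)
     + (\<Sum>p\<in>UNIV. (eta_coeff (2 * int m - 3) k x $ p) *\<^sub>R column (Some p) (g x))"

text \<open>
  The descriptions in \<open>airy_field\<close> and \<open>F_hat\<close> are proper because the described values do not
  depend on the parallel frame. Since parallel frames always exist on the real line,
  \<open>airy_field\<close> is meaningful for every unit speed curve, closed or not.
\<close>

definition airy_field ::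
  "nat \<Rightarrow> (real \<Rightarrow> real^('m::finite option)) \<Rightarrow> real \<Rightarrow> real^('m option)" where
  "airy_field m \<gamma> = (THE v. \<exists>g k. parallel_frame \<gamma> g k \<and> v = airy_rhs m g k)"

definition airy_solution ::
  "real \<Rightarrow> nat \<Rightarrow> real set \<Rightarrow> (real \<Rightarrow> real \<Rightarrow> real^('m::finite option)) \<Rightarrow> bool" where
  "airy_solution L m T \<gamma> \<longleftrightarrow>
     smooth_on (\<lambda>(t, x). \<gamma> t x) (T \<times> UNIV) \<and>
     (\<forall>t\<in>T. \<gamma> t \<in> curve_space L \<and>
        (\<forall>x. ((\<lambda>s. \<gamma> s x) has_vector_derivative airy_field m (\<gamma> t) x) (at t)))"

definition F_hat :: "real \<Rightarrow> nat \<Rightarrow> (real \<Rightarrow> real^('m::finite option)) \<Rightarrow> real" where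
  "F_hat L m \<gamma> = (THE c. \<exists>g k. parallel_frame \<gamma> g k \<and>
     c = - (1 / (2 * real m - 1)) * integral {0..L} (y_coeff (2 * int m - 1) k))"


section \<open>Commuting flows\<close>

text \<open>
  \<open>\<alpha>\<close> is a smooth one-parameter family of unit speed curves through \<open>\<gamma>\<close> with velocity \<open>V\<close> at
  \<open>\<gamma>\<close>. The curves of the family are not required to lie in \<open>curve_space L\<close>.
\<close>

definition variation ::
  "(real \<Rightarrow> real^('m::finite option)) \<Rightarrow> (real \<Rightarrow> real^('m option)) \<Rightarrow> (real \<Rightarrow> real \<Rightarrow> real^('m option)) \<Rightarrow> bool" where
  "variation \<gamma> V \<alpha> \<longleftrightarrow> \<alpha> 0 = \<gamma> \<and>
     (\<exists>\<epsilon>>0. smooth_on (\<lambda>(s, x). \<alpha> s x) ({-\<epsilon><..<\<epsilon>} \<times> UNIV) \<and> (\<forall>s\<in>{-\<epsilon><..<\<epsilon>}. unit_speed_curve (\<alpha> s))) \<and>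
     (\<forall>x. ((\<lambda>s. \<alpha> s x) has_vector_derivative V x) (at 0))"

text \<open>
  \<open>W\<close> is the directional derivative at \<open>\<gamma>\<close>, in direction \<open>V\<close>, of the vector field \<open>F\<close> on unit
  speed curves: it is the derivative of \<open>F\<close> along every variation with velocity \<open>V\<close> (in
  particular along those inside \<open>curve_space L\<close>), and \<open>V\<close> is the velocity of some variation.
\<close>

definition has_field_derivative_along ::
  "((real \<Rightarrow> real^('m::finite option)) \<Rightarrow> real \<Rightarrow> real^('m option)) \<Rightarrow> (real \<Rightarrow> real^('m option)) \<Rightarrow>
   (real \<Rightarrow> real^('m option)) \<Rightarrow> (real \<Rightarrow> real^('m option)) \<Rightarrow> bool" where
  "has_field_derivative_along F \<gamma> V W \<longleftrightarrow> (\<exists>\<alpha>. variation \<gamma> V \<alpha>) \<and>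
     (\<forall>\<alpha>. variation \<gamma> V \<alpha> \<longrightarrow> (\<forall>x. ((\<lambda>s. F (\<alpha> s) x) has_vector_derivative W x) (at 0)))"

text \<open>
  The flows of two vector fields commute when the Lie bracket
  \<open>[F, G](\<gamma>) = DG(\<gamma>)(F(\<gamma>)) - DF(\<gamma>)(G(\<gamma>))\<close> exists and vanishes at every curve.
\<close>

definition flows_commute ::
  "(real \<Rightarrow> real^('m::finite option)) set \<Rightarrow> ((real \<Rightarrow> real^('m option)) \<Rightarrow> real \<Rightarrow> real^('m option)) \<Rightarrow>
   ((real \<Rightarrow> real^('m option)) \<Rightarrow> real \<Rightarrow> real^('m option)) \<Rightarrow> bool" where
  "flows_commute M F G \<longleftrightarrow> (\<forall>\<gamma>\<in>M. \<exists>W W'.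
     has_field_derivative_along G \<gamma> (F \<gamma>) W \<and> has_field_derivative_along F \<gamma> (G \<gamma>) W' \<and>
     (\<forall>x. W x - W' x = 0))"

end

theory Submission
  imports Defs
begin

text \<open>
  Conjugating the Lax operator by \<open>diag(1, g)\<close>, with \<open>g\<close> a parallel frame, removes the curvature:
  \<open>\<partial>\<^sub>x + a\<lambda> + u\<close> becomes \<open>\<partial>\<^sub>x + \<lambda>S\<close> where \<open>S\<close> is the embedding of the unit tangent in
  \<open>so(n + 1)\<close>. The conjugated series \<open>\<lambda>M\<close>, \<open>M = \<Sum> M\<^sub>i \<lambda>\<^sup>-\<^sup>i\<close>, depends on the curve alone; it is the only
  solution of \<open>M\<^sub>x = [M, \<lambda>S]\<close>, \<open>M\<^sub>0 = S\<close>, \<open>M\<^sup>3 = - M\<close>, and the \<open>(2m - 1)\<close>-th Airy flow is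
  \<open>S\<^sub>t = (M\<^sub>p)\<^sub>x\<close> with \<open>p = 2m - 2\<close>. Along it \<open>M\<^sub>t = [M, N]\<close>, where \<open>N\<close> is the part of \<open>\<lambda>\<^sup>p\<^sup>+\<^sup>1 M\<close> with positive
  powers of \<open>\<lambda>\<close>, because the difference of both sides solves the linearized equations, which have
  no nonzero solution. Commutation of the flows is then an identity between coefficients of
  commutators, and \<open>tr(MS)\<^sub>t\<close> is the \<open>x\<close>-derivative of \<open>tr(M N\<^sub>\<lambda>)\<close>, which gives the conserved integrals.
\<close>


section \<open>Smooth maps of one and two variables\<close>

text \<open>Conjugacy to a\<lambda> is hard to differentiate and to compare order by order. Since a
  has the eigenvalues 0 and +-i, for series with leading coefficient a it is equivalent to the
  polynomial identity \<open>M\<^sup>3 = - M\<close>, by \<open>conjugate_imp_cube\<close> and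
  \<open>cube_imp_conjugate\<close>. The two equations complement each other: the Lax equation
  determines a coefficient up to a term commuting with S, and the linearized cubic equation is
  injective on such terms. Symmetry, periodicity and time evolution of M all follow from the
  resulting uniqueness.

  The obstacle that shapes the proof is the choice of frame. Parallel frames are determined only up
  to a constant rotation at each time, so differentiating k in time would require a smooth choice of
  frames. M sees the tangent alone; frames are used at one time only, to identify the fields and the
  functionals. A symmetry under \<lambda> \<mapsto> - \<lambda> makes the even coefficients of M
  embedded vectors, and these are the velocities of the flows.\<close>

lemma has_derivative_frechet:
  "f differentiable (at x) \<Longrightarrow> (f has_derivative frechet_derivative f (at x)) (at x)"
  by (simp add: frechet_derivative_works)

lemma Ck_on_cong:
  fixes f :: "'a::real_normed_vector \<Rightarrow> 'b::real_normed_vector"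
  assumes "open S" "\<And>x. x \<in> S \<Longrightarrow> f x = g x" "Ck_on k f S"
  shows "Ck_on k g S"
  using assms(2,3)
proof (induction k arbitrary: f g)
  case 0
  then show ?case by (auto cong: continuous_on_cong)
next
  case (Suc k)
  have g: "(g has_derivative frechet_derivative f (at x)) (at x)" if "x \<in> S" for x
  proof -
    have "(f has_derivative frechet_derivative f (at x)) (at x)"
      using Suc.prems(2) that by (auto intro: has_derivative_frechet)
    then show ?thesis
      by (rule has_derivative_transform_within_open[OF _ \<open>open S\<close> that]) (use Suc.prems in auto)
  qed
  have eq: "frechet_derivative f (at x) = frechet_derivative g (at x)" if "x \<in> S" for x
    using frechet_derivative_at[OF g[OF that]] .
  have "Ck_on k (\<lambda>x. frechet_derivative g (at x) v) S" for v
    by (rule Suc.IH[of "\<lambda>x. frechet_derivative f (at x) v"]) (use Suc.prems eq in auto)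
  then show ?case
    using g by (auto intro: differentiableI)
qed

text \<open>An induction on k can then use an explicit formula for the derivative in place of
  \<open>frechet_derivative f (at x)\<close>; on an open set the two are interchangeable by
  \<open>Ck_on_cong\<close>.\<close>

lemma Ck_onI:
  assumes "\<And>x. x \<in> S \<Longrightarrow> (f has_derivative f' x) (at x)"
    and "\<And>v. Ck_on k (\<lambda>x. f' x v) S" and "open S"
  shows "Ck_on (Suc k) f S"
proof -
  have "f' x = frechet_derivative f (at x)" if "x \<in> S" for x
    using frechet_derivative_at[OF assms(1)[OF that]] .
  then have "Ck_on k (\<lambda>x. frechet_derivative f (at x) v) S" for v
    by (intro Ck_on_cong[OF assms(3) _ assms(2)]) auto
  then show ?thesis
    using assms(1) by (auto intro: differentiableI)
qed

lemma Ck_on_SucD: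
  "Ck_on (Suc k) f S \<Longrightarrow> Ck_on k f S"
proof (induction k arbitrary: f)
  case 0
  then show ?case
    by (simp add: continuous_at_imp_continuous_on differentiable_imp_continuous_within)
next
  case (Suc k)
  have "\<forall>x\<in>S. f differentiable (at x)"
    using Suc.prems by simp
  moreover have "Ck_on (Suc k) (\<lambda>x. frechet_derivative f (at x) v) S" for v
    using Suc.prems unfolding Ck_on.simps(2)[of "Suc k"] by blast
  ultimately show ?case
    unfolding Ck_on.simps(2)[of k f] using Suc.IH by blast
qed

lemma Ck_on_linear:
  assumes "open S" "bounded_linear h" "Ck_on k f S"
  shows "Ck_on k (\<lambda>x. h (f x)) S"
  using assms(3)
proof (induction k arbitrary: f)
  case 0
  then show ?case
    by (simp add: bounded_linear.continuous_on[OF assms(2)])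
next
  case (Suc k)
  show ?case
    by (rule Ck_onI[where f'="\<lambda>x v. h (frechet_derivative f (at x) v)"])
      (use Suc assms in \<open>simp_all add: bounded_linear.has_derivative has_derivative_frechet\<close>)
qed

lemma Ck_on_const:
  assumes "open S" shows "Ck_on k (\<lambda>x. c) S"
proof (induction k arbitrary: c)
  case (Suc k)
  show ?case by (rule Ck_onI[where f'="\<lambda>x v. 0"]) (use Suc assms in auto)
qed auto

lemma Ck_on_bounded_linear:
  assumes "open S" "bounded_linear h" shows "Ck_on k h S"
proof (cases k)
  case 0
  then show ?thesis using assms by (auto intro!: linear_continuous_on)
next
  case (Suc n)
  then show ?thesis
    using assms Ck_onI[of S h "\<lambda>x v. h v" n] Ck_on_const bounded_linear_imp_has_derivative by blast
qed

lemma Ck_on_add: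
  assumes "open S" "Ck_on k f S" "Ck_on k g S"
  shows "Ck_on k (\<lambda>x. f x + g x) S"
  using assms(2,3)
proof (induction k arbitrary: f g)
  case 0
  then show ?case by (auto intro!: continuous_intros)
next
  case (Suc k)
  show ?case
    by (rule Ck_onI[where f'="\<lambda>x v. frechet_derivative f (at x) v + frechet_derivative g (at x) v"])
      (use Suc assms in \<open>auto intro!: derivative_intros has_derivative_frechet\<close>)
qed

lemma Ck_on_bilinear:
  assumes "open S" "bounded_bilinear h" "Ck_on k f S" "Ck_on k g S"
  shows "Ck_on k (\<lambda>x. h (f x) (g x)) S"
  using assms(3,4)
proof (induction k arbitrary: f g)
  case 0
  then show ?case
    by (simp add: bounded_bilinear.continuous_on[OF assms(2)])
next
  case (Suc k)
  have f: "Ck_on k f S" and g: "Ck_on k g S"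
    using Suc.prems by (blast dest: Ck_on_SucD)+
  show ?case
    by (rule Ck_onI[where f'="\<lambda>x v. h (f x) (frechet_derivative g (at x) v) + h (frechet_derivative f (at x) v) (g x)"])
      (use Suc assms f g in \<open>simp_all add: Ck_on_add bounded_bilinear.FDERIV[OF assms(2)] has_derivative_frechet\<close>)
qed

text \<open>The induction closes because a directional derivative of f is composed with the same
  affine map. This case covers slices of families and families that are constant in the
  parameter.\<close>

lemma Ck_on_compose_affine:
  assumes "open S" "open S'" "bounded_linear h" "\<And>x. x \<in> S' \<Longrightarrow> c + h x \<in> S" "Ck_on k f S"
  shows "Ck_on k (\<lambda>x. f (c + h x)) S'"
  using assms(5)
proof (induction k arbitrary: f)
  case 0
  have "continuous_on S' (\<lambda>x. c + h x)"
    by (intro continuous_intros linear_continuous_on assms)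
  then show ?case using 0
    by (auto intro!: continuous_on_compose2[of S f] simp: assms)
next
  case (Suc k)
  have "((\<lambda>x. f (c + h x)) has_derivative (\<lambda>v. frechet_derivative f (at (c + h x)) (h v))) (at x)"
    if "x \<in> S'" for x
  proof -
    have 1: "((\<lambda>x. c + h x) has_derivative h) (at x)"
      using bounded_linear_imp_has_derivative[OF assms(3)] by (auto intro!: derivative_eq_intros)
    have "(f has_derivative frechet_derivative f (at (c + h x))) (at (c + h x))"
      using Suc.prems assms that by (auto intro: has_derivative_frechet)
    from has_derivative_compose[OF 1 this] show ?thesis .
  qed
  moreover have "Ck_on k (\<lambda>x. frechet_derivative f (at (c + h x)) (h v)) S'" for v
    using Suc.IH[of "\<lambda>x. frechet_derivative f (at x) (h v)"] Suc.prems by auto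
  ultimately show ?case by (rule Ck_onI[OF _ _ assms(2)])
qed

text \<open>The exponent must vary in the induction, since each differentiation lowers it by one.
  The exponent - 1/2 normalizes vectors in \<open>variation_exists\<close>.\<close>

lemma Ck_on_powr:
  fixes f :: "'a::real_normed_vector \<Rightarrow> real"
  assumes S: "open S" and "\<And>x. x \<in> S \<Longrightarrow> 0 < f x" "Ck_on k f S"
  shows "Ck_on k (\<lambda>x. f x powr a) S"
  using assms(2,3)
proof (induction k arbitrary: a)
  case 0
  then have "continuous_on S f" by simp
  moreover have "\<forall>x\<in>S. f x \<noteq> 0" using 0 by fastforce
  ultimately show ?case by (simp add: continuous_on_powr)
next
  case (Suc k)
  have f: "Ck_on k f S" using Suc.prems(2) by (rule Ck_on_SucD)
  have "((\<lambda>x. f x powr a) has_derivative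
      (\<lambda>v. (a * f x powr (a - 1)) * frechet_derivative f (at x) v)) (at x)" if x: "x \<in> S" for x
  proof -
    have 1: "(f has_derivative frechet_derivative f (at x)) (at x)"
      using Suc.prems(2) x by (simp add: has_derivative_frechet)
    have "((\<lambda>y. y powr a) has_derivative (\<lambda>v. (a * f x powr (a - 1)) * v)) (at (f x))"
      using has_real_derivative_powr[OF Suc.prems(1)[OF x], of a] unfolding has_field_derivative_def .
    from has_derivative_compose[OF 1 this] show ?thesis .
  qed
  moreover have "Ck_on k (\<lambda>x. (a * f x powr (a - 1)) * frechet_derivative f (at x) v) S" for v
  proof -
    have "Ck_on k (\<lambda>x. frechet_derivative f (at x) v) S" using Suc.prems(2) by simp
    moreover have "Ck_on k (\<lambda>x. f x powr (a - 1)) S" using Suc.IH[OF Suc.prems(1) f] .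
    ultimately show ?thesis
      by (intro Ck_on_bilinear[OF S bounded_bilinear_mult] Ck_on_const[OF S])
  qed
  ultimately show ?case by (rule Ck_onI[OF _ _ S])
qed

lemma smooth_on_cong:
  assumes "open S" "\<And>x. x \<in> S \<Longrightarrow> f x = g x" "smooth_on f S"
  shows "smooth_on g S"
  unfolding smooth_on_def
proof
  fix k
  show "Ck_on k g S"
    using assms by (intro Ck_on_cong[of S f g]) (auto simp: smooth_on_def)
qed

lemma smooth_on_linear:
  "open S \<Longrightarrow> bounded_linear h \<Longrightarrow> smooth_on f S \<Longrightarrow> smooth_on (\<lambda>x. h (f x)) S"
  by (simp add: smooth_on_def Ck_on_linear)

lemma smooth_on_const: "open S \<Longrightarrow> smooth_on (\<lambda>x. c) S"
  by (simp add: smooth_on_def Ck_on_const)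

lemma smooth_on_bounded_linear: "open S \<Longrightarrow> bounded_linear h \<Longrightarrow> smooth_on h S"
  by (simp add: smooth_on_def Ck_on_bounded_linear)

lemma smooth_on_add:
  "open S \<Longrightarrow> smooth_on f S \<Longrightarrow> smooth_on g S \<Longrightarrow> smooth_on (\<lambda>x. f x + g x) S"
  by (simp add: smooth_on_def Ck_on_add)

lemma smooth_on_minus:
  "open S \<Longrightarrow> smooth_on f S \<Longrightarrow> smooth_on (\<lambda>x. - f x) S"
  by (rule smooth_on_linear[OF _ bounded_linear_minus[OF bounded_linear_ident]])

lemma smooth_on_diff:
  "open S \<Longrightarrow> smooth_on f S \<Longrightarrow> smooth_on g S \<Longrightarrow> smooth_on (\<lambda>x. f x - g x) S"
  using smooth_on_add[of S f "\<lambda>x. - g x"] smooth_on_minus[of S g] by simp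

lemma smooth_on_sum:
  "open S \<Longrightarrow> (\<And>i. i \<in> I \<Longrightarrow> smooth_on (f i) S) \<Longrightarrow> smooth_on (\<lambda>x. \<Sum>i\<in>I. f i x) S"
  by (induction I rule: infinite_finite_induct) (auto intro!: smooth_on_const smooth_on_add)

lemma smooth_on_bilinear:
  "bounded_bilinear h \<Longrightarrow> open S \<Longrightarrow> smooth_on f S \<Longrightarrow> smooth_on g S \<Longrightarrow> smooth_on (\<lambda>x. h (f x) (g x)) S"
  by (simp add: smooth_on_def Ck_on_bilinear)

lemmas smooth_on_mult = smooth_on_bilinear[OF bounded_bilinear_mult]
lemmas smooth_on_scaleR = smooth_on_bilinear[OF bounded_bilinear_scaleR]
lemmas smooth_on_inner = smooth_on_bilinear[OF bounded_bilinear_inner]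

lemma smooth_on_powr:
  fixes f :: "'a::real_normed_vector \<Rightarrow> real"
  shows "open S \<Longrightarrow> (\<And>x. x \<in> S \<Longrightarrow> 0 < f x) \<Longrightarrow> smooth_on f S \<Longrightarrow> smooth_on (\<lambda>x. f x powr a) S"
  by (simp add: smooth_on_def Ck_on_powr)

lemma smooth_on_compose_affine:
  "open S \<Longrightarrow> open S' \<Longrightarrow> bounded_linear h \<Longrightarrow> (\<And>x. x \<in> S' \<Longrightarrow> c + h x \<in> S) \<Longrightarrow> smooth_on f S
    \<Longrightarrow> smooth_on (\<lambda>x. f (c + h x)) S'"
  by (simp add: smooth_on_def Ck_on_compose_affine)

lemma smooth_on_imp_has_derivative:
  assumes "smooth_on f S" "x \<in> S"
  shows "(f has_derivative frechet_derivative f (at x)) (at x)"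
proof -
  have "Ck_on (Suc 0) f S" using assms(1) unfolding smooth_on_def by blast
  then show ?thesis using assms(2) by (auto intro: has_derivative_frechet)
qed

lemma smooth_on_derivative:
  assumes "smooth_on f S"
  shows "smooth_on (\<lambda>x. frechet_derivative f (at x) v) S"
  unfolding smooth_on_def
proof
  fix k
  have "Ck_on (Suc k) f S" using assms unfolding smooth_on_def by blast
  then show "Ck_on k (\<lambda>x. frechet_derivative f (at x) v) S" by auto
qed

lemma smooth_on_imp_continuous_on: "smooth_on f S \<Longrightarrow> continuous_on S f"
  unfolding smooth_on_def by (metis Ck_on.simps(1))

lemma smooth_on_real_has_vector_derivative:
  fixes f :: "real \<Rightarrow> 'a::real_normed_vector"
  assumes "smooth_on f S" "x \<in> S"
  shows "(f has_vector_derivative vector_derivative f (at x)) (at x)"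
  using smooth_on_imp_has_derivative[OF assms] differentiableI vector_derivative_works by blast

lemma frechet_derivative_real:
  fixes f :: "real \<Rightarrow> 'a::real_normed_vector"
  assumes "(f has_vector_derivative f') (at x)"
  shows "frechet_derivative f (at x) v = v *\<^sub>R f'"
  using frechet_derivative_at[OF assms[unfolded has_vector_derivative_def]] by metis

lemma smooth_on_vector_derivative:
  fixes f :: "real \<Rightarrow> 'a::real_normed_vector"
  assumes "open S" "smooth_on f S"
  shows "smooth_on (\<lambda>x. vector_derivative f (at x)) S"
  by (rule smooth_on_cong[OF assms(1) _ smooth_on_derivative[OF assms(2), of 1]])
    (use frechet_derivative_real smooth_on_real_has_vector_derivative assms in fastforce)

section \<open>Partial derivatives of maps on a strip of times and positions\<close>

definition partial_t :: "(real \<times> real \<Rightarrow> 'a::real_normed_vector) \<Rightarrow> real \<times> real \<Rightarrow> 'a" where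
  "partial_t f p = frechet_derivative f (at p) (1, 0)"

definition partial_x :: "(real \<times> real \<Rightarrow> 'a::real_normed_vector) \<Rightarrow> real \<times> real \<Rightarrow> 'a" where
  "partial_x f p = frechet_derivative f (at p) (0, 1)"

lemma smooth_on_partial_t: "smooth_on f S \<Longrightarrow> smooth_on (partial_t f) S"
  and smooth_on_partial_x: "smooth_on f S \<Longrightarrow> smooth_on (partial_x f) S"
  unfolding partial_t_def[abs_def] partial_x_def[abs_def] by (auto intro: smooth_on_derivative)

lemma has_vector_derivative_partial_t:
  assumes "smooth_on f S" "(t, x) \<in> S"
  shows "((\<lambda>s. f (s, x)) has_vector_derivative partial_t f (t, x)) (at t)"
proof -
  have 1: "(f has_derivative frechet_derivative f (at (t, x))) (at (t, x))"
    using assms by (rule smooth_on_imp_has_derivative)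
  have "((\<lambda>s. (s, x)) has_derivative (\<lambda>s. (s, 0))) (at t)"
    by (auto intro!: derivative_eq_intros)
  from has_derivative_compose[OF this 1]
  have 2: "((\<lambda>s. f (s, x)) has_derivative (\<lambda>s. frechet_derivative f (at (t, x)) (s, 0))) (at t)" .
  have "frechet_derivative f (at (t, x)) (s, 0) = s *\<^sub>R partial_t f (t, x)" for s
    unfolding partial_t_def
    using linear_scale[OF has_derivative_linear[OF 1], of s "(1,0)"] by simp
  then show ?thesis using 2 by (simp add: has_vector_derivative_def)
qed

lemma has_vector_derivative_partial_x:
  assumes "smooth_on f S" "(t, x) \<in> S"
  shows "((\<lambda>x. f (t, x)) has_vector_derivative partial_x f (t, x)) (at x)"
proof -
  have 1: "(f has_derivative frechet_derivative f (at (t, x))) (at (t, x))"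
    using assms by (rule smooth_on_imp_has_derivative)
  have "((\<lambda>x. (t, x)) has_derivative (\<lambda>s. (0, s))) (at x)"
    by (auto intro!: derivative_eq_intros)
  from has_derivative_compose[OF this 1]
  have 2: "((\<lambda>x. f (t, x)) has_derivative (\<lambda>s. frechet_derivative f (at (t, x)) (0, s))) (at x)" .
  have "frechet_derivative f (at (t, x)) (0, s) = s *\<^sub>R partial_x f (t, x)" for s
    unfolding partial_x_def
    using linear_scale[OF has_derivative_linear[OF 1], of s "(0,1)"] by simp
  then show ?thesis using 2 by (simp add: has_vector_derivative_def)
qed

lemma smooth_on_slice:
  fixes f :: "real \<times> real \<Rightarrow> 'a::real_normed_vector"
  assumes "open I" "smooth_on f (I \<times> UNIV)" "t \<in> I"
  shows "smooth_on (\<lambda>x. f (t, x)) UNIV"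
proof -
  have "bounded_linear (Pair 0 :: real \<Rightarrow> real \<times> real)"
    by (intro bounded_linear_Pair bounded_linear_zero bounded_linear_ident)
  then show ?thesis
    using smooth_on_compose_affine[of "I \<times> UNIV" UNIV "Pair 0" "(t, 0)" f] assms
    by (simp add: open_Times)
qed

lemma smooth_on_constant_family:
  assumes "open I" "smooth_on f UNIV"
  shows "smooth_on (\<lambda>p. f (snd p)) (I \<times> UNIV)"
  using smooth_on_compose_affine[of UNIV "I \<times> UNIV" snd "0" f] assms
  by (auto intro: open_Times bounded_linear_snd)

lemma vector_derivative_partial_x:
  assumes "smooth_on f S" "(t, x) \<in> S"
  shows "vector_derivative (\<lambda>x. f (t, x)) (at x) = partial_x f (t, x)"
  using has_vector_derivative_partial_x[OF assms] by (rule vector_derivative_at)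

text \<open>Integrating the x-derivative writes f (s, z) - f (s, c) as an integral. Leibniz' rule
  differentiates this in s, and differentiating the result in z at x gives the claim. The base point
  c = x - 1 keeps x in the interior of the interval of integration.\<close>

lemma partial_t_partial_x_commute:
  fixes f :: "real \<times> real \<Rightarrow> 'a::banach"
  assumes I: "open I" and f: "smooth_on f (I \<times> UNIV)" and t: "t \<in> I"
  shows "partial_t (partial_x f) (t, x) = partial_x (partial_t f) (t, x)"
proof -
  obtain e where e: "e > 0" "ball t e \<subseteq> I" using I t openE by blast
  let ?U = "ball t e" and ?c = "x - 1"
  have fx: "smooth_on (partial_x f) (I \<times> UNIV)" and ft: "smooth_on (partial_t f) (I \<times> UNIV)"
    and fxt: "smooth_on (partial_t (partial_x f)) (I \<times> UNIV)"
    using f smooth_on_partial_t smooth_on_partial_x by blast+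
  have int: "((\<lambda>x. partial_x f (s, x)) has_integral f (s, z) - f (s, ?c)) {?c..z}" if "?c \<le> z" "s \<in> ?U" for s z
    using that e
    by (intro fundamental_theorem_of_calculus has_vector_derivative_at_within[OF has_vector_derivative_partial_x[OF f]]) auto
  have eq: "partial_t f (t, z) - partial_t f (t, ?c) = integral {?c..z} (\<lambda>x. partial_t (partial_x f) (t, x))" if z: "?c \<le> z" for z
  proof -
    have cont: "continuous_on (?U \<times> cbox ?c z) (\<lambda>(s, x). partial_t (partial_x f) (s, x))"
      unfolding case_prod_unfold prod.collapse
      by (rule continuous_on_subset[OF smooth_on_imp_continuous_on[OF fxt]]) (use e in auto)
    have "((\<lambda>s. integral (cbox ?c z) (\<lambda>x. partial_x f (s, x))) has_vector_derivative
        integral (cbox ?c z) (\<lambda>x. partial_t (partial_x f) (t, x))) (at t within ?U)"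
      by (rule leibniz_rule_vector_derivative[where fx="\<lambda>s x. partial_t (partial_x f) (s, x)"])
        (use int e z cont in \<open>auto intro!: has_vector_derivative_at_within[OF has_vector_derivative_partial_t[OF fx]] simp: cbox_interval\<close>)
    then have 1: "((\<lambda>s. integral (cbox ?c z) (\<lambda>x. partial_x f (s, x))) has_vector_derivative
        integral (cbox ?c z) (\<lambda>x. partial_t (partial_x f) (t, x))) (at t)"
      using e by (subst (asm) at_within_open) auto
    have 2: "((\<lambda>s. integral (cbox ?c z) (\<lambda>x. partial_x f (s, x))) has_vector_derivative
        partial_t f (t, z) - partial_t f (t, ?c)) (at t)"
    proof (rule has_vector_derivative_transform_within_open)
      show "((\<lambda>s. f (s, z) - f (s, ?c)) has_vector_derivative partial_t f (t, z) - partial_t f (t, ?c)) (at t)"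
        by (intro derivative_intros has_vector_derivative_partial_t[OF f]) (use t in auto)
      show "f (s, z) - f (s, ?c) = integral (cbox ?c z) (\<lambda>x. partial_x f (s, x))" if "s \<in> ?U" for s
        using int[OF z that] by (simp add: cbox_interval integral_unique)
    qed (use e in auto)
    show ?thesis using vector_derivative_unique_at[OF 1 2] by (simp add: cbox_interval)
  qed
  have cont: "continuous_on {?c..x+1} (\<lambda>x. partial_t (partial_x f) (t, x))"
    using continuous_on_subset[OF smooth_on_imp_continuous_on[OF smooth_on_slice[OF I fxt t]]] by auto
  have "((\<lambda>z. integral {?c..z} (\<lambda>x. partial_t (partial_x f) (t, x))) has_vector_derivative partial_t (partial_x f) (t, x)) (at x within {?c..x+1})"
    by (rule integral_has_vector_derivative[OF cont]) auto
  then have "((\<lambda>z. integral {?c..z} (\<lambda>x. partial_t (partial_x f) (t, x))) has_vector_derivative partial_t (partial_x f) (t, x)) (at x)"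
    by (subst (asm) at_within_interior) (auto simp: interior_atLeastAtMost_real)
  then have 1: "((\<lambda>z. partial_t f (t, z) - partial_t f (t, ?c)) has_vector_derivative partial_t (partial_x f) (t, x)) (at x)"
    by (rule has_vector_derivative_transform_within_open[where S="{?c<..}"]) (auto simp: eq)
  have 2: "((\<lambda>z. partial_t f (t, z) - partial_t f (t, ?c)) has_vector_derivative partial_x (partial_t f) (t, x)) (at x)"
    using has_vector_derivative_partial_x[OF ft, of t x] t by (auto intro!: derivative_eq_intros)
  show ?thesis using vector_derivative_unique_at[OF 1 2] .
qed

section \<open>Formal solutions of the Lax equation\<close>

definition comm :: "'a::ring \<Rightarrow> 'a \<Rightarrow> 'a" where
  "comm a b = a * b - b * a"

text \<open>The linearization at \<open>s\<close> of \<open>a \<mapsto> a\<^sup>3 + a\<close>.\<close>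

definition cubic_lin :: "'a::ring \<Rightarrow> 'a \<Rightarrow> 'a" where
  "cubic_lin s a = s * s * a + s * a * s + a * s * s + a"

lemma cube_assoc:
  fixes s :: "'a::ring"
  assumes "s * s * s = - s"
  shows "s * (s * s) = - s" "s * (s * (s * a)) = - (s * a)"
proof -
  show "s * (s * s) = - s" using assms by (simp add: mult.assoc)
  have "s * (s * (s * a)) = s * s * s * a" by (simp add: mult.assoc)
  then show "s * (s * (s * a)) = - (s * a)" using assms by simp
qed

text \<open>Let L and R be left and right multiplication by s. Then \<open>comm _ s\<close> is R - L
  and \<open>cubic_lin s\<close> is \<open>L\<^sup>2 + L R + R\<^sup>2 + 1\<close>. Their product is
  \<open>R\<^sup>3 - L\<^sup>3 + R - L\<close>, which vanishes as \<open>L\<^sup>3 = - L\<close> and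
  \<open>R\<^sup>3 = - R\<close>.\<close>

lemma comm_cubic_lin:
  fixes s :: "'a::ring"
  assumes "s * s * s = - s"
  shows "comm (cubic_lin s a) s = 0" "cubic_lin s (comm a s) = 0"
  using cube_assoc[OF assms] by (simp_all add: comm_def cubic_lin_def algebra_simps)

text \<open>If d commutes with s, then \<open>cubic_lin s d\<close> is
  \<open>(3 s\<^sup>2 + 1) d\<close>. The eigenvalues of \<open>s\<^sup>2\<close> are 0 and - 1, so
  the factor takes the values 1 and - 2 and is invertible.\<close>

lemma comm_cubic_lin_eq_0:
  fixes s :: "'a::real_algebra_1"
  assumes s: "s * s * s = - s" and "comm d s = 0" "cubic_lin s d = 0"
  shows "d = 0"
proof -
  have ds: "d * s = s * d" using assms(2) by (simp add: comm_def)
  have dss: "d * (s * s) = s * (s * d)" using ds by (metis mult.assoc)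
  have eq: "s * (s * d) + s * (s * d) + s * (s * d) + d = 0"
    using assms(3) ds dss by (simp add: cubic_lin_def mult.assoc)
  have "s * (s * (s * d) + s * (s * d) + s * (s * d) + d) = - (2 *\<^sub>R (s * d))"
    using cube_assoc[OF s] by (simp add: algebra_simps scaleR_2)
  with eq have "s * d = 0" by simp
  with eq show "d = 0" by simp
qed

text \<open>By \<open>comm_cubic_lin\<close> each of the two maps kills the image of the other, so
  their images meet inside the common kernel, which is 0.\<close>

lemma comm_cubic_lin_split:
  fixes s :: "'a::real_algebra_1"
  assumes s: "s * s * s = - s" and "cubic_lin s u = comm w s"
  shows "cubic_lin s u = 0"
proof (rule comm_cubic_lin_eq_0[OF s])
  show "comm (cubic_lin s u) s = 0" using comm_cubic_lin(1)[OF s] .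
  show "cubic_lin s (cubic_lin s u) = 0" unfolding assms(2) using comm_cubic_lin(2)[OF s] .
qed

lemma scaleR_numeral:
  fixes x :: "'a::real_vector"
  shows "3 *\<^sub>R x = x + x + x" "4 *\<^sub>R x = x + x + x + x" "5 *\<^sub>R x = x + x + x + x + x"
    "6 *\<^sub>R x = x + x + x + x + x + x"
  using scaleR_left_distrib[of 2 1 x] scaleR_left_distrib[of 3 1 x] scaleR_left_distrib[of 4 1 x]
    scaleR_left_distrib[of 5 1 x]
  by (simp_all add: scaleR_2)

text \<open>
  On the kernel of \<open>cubic_lin s\<close> the eigenvalues of \<open>a \<mapsto> comm a s\<close> are \<open>\<plusminus>\<i>\<close> and \<open>\<plusminus>2\<i>\<close>, and
  \<open>- (5/4) d - (1/4) d\<^sup>3 = 1/d\<close> for these values of \<open>d\<close>.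
\<close>

definition comm_inv :: "'a::real_algebra_1 \<Rightarrow> 'a \<Rightarrow> 'a" where
  "comm_inv s u = - (1/4) *\<^sub>R (5 *\<^sub>R comm u s + comm (comm (comm u s) s) s)"

lemma comm_comm_inv:
  fixes s :: "'a::real_algebra_1"
  assumes s: "s * s * s = - s" and u: "cubic_lin s u = 0"
  shows "comm (comm_inv s u) s = u"
proof -
  \<comment> \<open>With d = \<open>comm _ s\<close> the left side is
    \<open>(d\<^sup>2 + 1) (d\<^sup>2 + 4)\<close> applied to u. It vanishes for d = +-i and d =
    +-2i. For d = 0 it is 4, while \<open>cubic_lin s\<close> is \<open>3 s\<^sup>2 + 1\<close>; the
    factor \<open>4 + 6 s\<^sup>2\<close> compensates.\<close>
  have "comm (comm (comm (comm u s) s) s) s + 5 *\<^sub>R comm (comm u s) s + 4 *\<^sub>R u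
      = 4 *\<^sub>R cubic_lin s u + 6 *\<^sub>R (s * s * cubic_lin s u)"
    using cube_assoc[OF s]
    by (simp add: comm_def cubic_lin_def scaleR_numeral algebra_simps)
  then have "comm (comm (comm (comm u s) s) s) s + 5 *\<^sub>R comm (comm u s) s = - (4 *\<^sub>R u)"
    unfolding u by (simp add: eq_neg_iff_add_eq_0)
  moreover have "comm (comm_inv s u) s =
      - (1/4) *\<^sub>R (comm (comm (comm (comm u s) s) s) s + 5 *\<^sub>R comm (comm u s) s)"
    by (simp add: comm_inv_def comm_def algebra_simps)
  ultimately show ?thesis by simp
qed

text \<open>The term \<open>comm_inv s u\<close> meets the commutator condition and is killed by
  \<open>cubic_lin s\<close>. The terms in w commute with s and supply the value - w: on the
  commutant \<open>cubic_lin s\<close> is \<open>3 s\<^sup>2 + 1\<close>, with inverse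
  \<open>1 + (3/2) s\<^sup>2\<close> because \<open>s\<^sup>4 = - s\<^sup>2\<close>.\<close>

definition lax_next :: "'a::real_algebra_1 \<Rightarrow> 'a \<Rightarrow> 'a \<Rightarrow> 'a" where
  "lax_next s u w = comm_inv s u - w - (3/2) *\<^sub>R (s * s * w)"

lemma lax_next:
  fixes s :: "'a::real_algebra_1"
  assumes s: "s * s * s = - s" and u: "cubic_lin s u = 0" and w: "comm w s = 0"
  shows "comm (lax_next s u w) s = u" "cubic_lin s (lax_next s u w) = - w"
proof -
  have ws: "w * s = s * w" using w by (simp add: comm_def)
  have wss: "w * (s * s) = s * (s * w)" using ws by (metis mult.assoc)
  have "comm (s * s * w) s = 0"
    using ws by (simp add: comm_def mult.assoc)
  moreover have "comm (lax_next s u w) s = comm (comm_inv s u) s - comm w s - (3/2) *\<^sub>R comm (s * s * w) s"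
    by (simp add: lax_next_def comm_def algebra_simps)
  ultimately show "comm (lax_next s u w) s = u"
    using comm_comm_inv[OF s u] w by simp
  have 1: "cubic_lin s (comm_inv s u) = 0"
  proof -
    have "comm_inv s u = comm (- (1/4) *\<^sub>R (5 *\<^sub>R u + comm (comm u s) s)) s"
      by (simp add: comm_inv_def comm_def algebra_simps)
    then show ?thesis using comm_cubic_lin(2)[OF s] by metis
  qed
  have "cubic_lin s (s * s * w) = - (2 *\<^sub>R (s * s * w))"
    using cube_assoc[OF s] ws wss
    by (simp add: cubic_lin_def distrib_left distrib_right mult.assoc scaleR_2)
  moreover have "cubic_lin s w = 3 *\<^sub>R (s * s * w) + w"
    using ws wss by (simp add: cubic_lin_def mult.assoc scaleR_numeral)
  moreover have "cubic_lin s (lax_next s u w) =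
      cubic_lin s (comm_inv s u) - cubic_lin s w - (3/2) *\<^sub>R cubic_lin s (s * s * w)"
    by (simp add: lax_next_def cubic_lin_def algebra_simps)
  ultimately show "cubic_lin s (lax_next s u w) = - w"
    using 1 by simp
qed

section \<open>Coefficientwise derivatives and lowest coefficients of power series\<close>

definition has_coeff_derivative :: "(real \<Rightarrow> 'a::real_normed_vector fps) \<Rightarrow> 'a fps \<Rightarrow> real \<Rightarrow> bool" where
  "has_coeff_derivative F F' x \<longleftrightarrow>
     (\<forall>n. ((\<lambda>x. fps_nth (F x) n) has_vector_derivative fps_nth F' n) (at x))"

lemma has_coeff_derivative_add:
  "has_coeff_derivative F F' x \<Longrightarrow> has_coeff_derivative G G' x \<Longrightarrow>
    has_coeff_derivative (\<lambda>x. F x + G x) (F' + G') x"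
  by (simp add: has_coeff_derivative_def has_vector_derivative_add)

lemma has_coeff_derivative_diff:
  "has_coeff_derivative F F' x \<Longrightarrow> has_coeff_derivative G G' x \<Longrightarrow>
    has_coeff_derivative (\<lambda>x. F x - G x) (F' - G') x"
  by (simp add: has_coeff_derivative_def has_vector_derivative_diff)

lemma has_coeff_derivative_const: "has_coeff_derivative (\<lambda>x. F) 0 x"
  by (simp add: has_coeff_derivative_def)

lemma has_coeff_derivative_mult:
  fixes F :: "real \<Rightarrow> 'a::real_normed_algebra fps"
  assumes "has_coeff_derivative F F' x" "has_coeff_derivative G G' x"
  shows "has_coeff_derivative (\<lambda>x. F x * G x) (F' * G x + F x * G') x"
  unfolding has_coeff_derivative_def
proof
  fix n
  have "((\<lambda>x. \<Sum>i=0..n. fps_nth (F x) i * fps_nth (G x) (n - i)) has_vector_derivative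
      (\<Sum>i=0..n. fps_nth (F x) i * fps_nth G' (n - i) + fps_nth F' i * fps_nth (G x) (n - i))) (at x)"
    using assms unfolding has_coeff_derivative_def
    by (intro has_vector_derivative_sum has_vector_derivative_mult) auto
  then show "((\<lambda>x. fps_nth (F x * G x) n) has_vector_derivative fps_nth (F' * G x + F x * G') n) (at x)"
    by (simp add: fps_mult_nth sum.distrib add.commute)
qed

lemma has_coeff_derivative_cmult:
  fixes F :: "real \<Rightarrow> 'a::real_normed_algebra fps"
  assumes "has_coeff_derivative F F' x"
  shows "has_coeff_derivative (\<lambda>x. c * F x) (c * F') x"
  using has_coeff_derivative_mult[OF has_coeff_derivative_const assms, of c] by simp

lemma has_coeff_derivative_comm:
  fixes F :: "real \<Rightarrow> 'a::real_normed_algebra fps"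
  assumes "has_coeff_derivative F F' x" "has_coeff_derivative G G' x"
  shows "has_coeff_derivative (\<lambda>x. comm (F x) (G x)) (comm F' (G x) + comm (F x) G') x"
proof -
  have "has_coeff_derivative (\<lambda>x. F x * G x - G x * F x) (F' * G x + F x * G' - (G' * F x + G x * F')) x"
    by (intro has_coeff_derivative_diff has_coeff_derivative_mult assms)
  then show ?thesis by (simp add: comm_def[abs_def] algebra_simps)
qed

lemma has_coeff_derivative_unique:
  "has_coeff_derivative F F' x \<Longrightarrow> has_coeff_derivative F F'' x \<Longrightarrow> F' = F''"
  unfolding has_coeff_derivative_def fps_eq_iff by (blast intro: vector_derivative_unique_at)

lemma has_coeff_derivative_transform:
  assumes "has_coeff_derivative F F' x" "open U" "x \<in> U" "\<And>y. y \<in> U \<Longrightarrow> F y = G y"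
  shows "has_coeff_derivative G F' x"
  using assms unfolding has_coeff_derivative_def
  by (auto intro: has_vector_derivative_transform_within_open)

lemma fps_mult_nth_low:
  fixes F :: "'a::semiring_0 fps"
  assumes "\<And>i. i < n \<Longrightarrow> fps_nth F i = 0"
  shows "fps_nth (F * G) n = fps_nth F n * fps_nth G 0"
    and "fps_nth (G * F) n = fps_nth G 0 * fps_nth F n"
    and "m < n \<Longrightarrow> fps_nth (F * G) m = 0" and "m < n \<Longrightarrow> fps_nth (G * F) m = 0"
proof -
  have "fps_nth (F * G) n = (\<Sum>i\<in>{n}. fps_nth F i * fps_nth G (n - i))"
    unfolding fps_mult_nth using assms by (intro sum.mono_neutral_right) auto
  then show "fps_nth (F * G) n = fps_nth F n * fps_nth G 0" by simp
  have "fps_nth (G * F) n = (\<Sum>i\<in>{0}. fps_nth G i * fps_nth F (n - i))"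
    unfolding fps_mult_nth using assms by (intro sum.mono_neutral_right) auto
  then show "fps_nth (G * F) n = fps_nth G 0 * fps_nth F n" by simp
  show "m < n \<Longrightarrow> fps_nth (F * G) m = 0" "m < n \<Longrightarrow> fps_nth (G * F) m = 0"
    unfolding fps_mult_nth using assms by (auto intro!: sum.neutral)
qed

lemma fps_X_assoc:
  fixes F :: "'a::semiring_1 fps"
  shows "F * (fps_X * G) = fps_X * (F * G)" "F * (fps_X ^ n * G) = fps_X ^ n * (F * G)"
  by (metis fps_mult_fps_X_commute mult.assoc) (metis fps_mult_fps_X_power_commute mult.assoc)

text \<open>Let n be the lowest degree in which D may be nonzero. The factor \<open>fps_X\<close>
  puts the derivative of a vanishing coefficient into degree n, so
  \<open>comm_cubic_lin_eq_0\<close> applies to coefficient n. The outer factors are kept general,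
  with only their constant terms prescribed, to cover both a linearization at M and the telescoped
  difference of two cubes, where the factors are M and N.\<close>

lemma lax_linear_zero:
  fixes D D' B P P' Q Q' :: "real \<Rightarrow> 'a::real_normed_algebra_1 fps"
  assumes s: "\<And>x. s x * s x * s x = - s x"
    and D: "\<And>x. has_coeff_derivative D (D' x) x"
    and lax: "\<And>x. fps_X * D' x = comm (D x) (B x)"
    and B: "\<And>x. fps_nth (B x) 0 = s x"
    and cubic: "\<And>x. Q x * D x + P x * D x * P' x + D x * Q' x = - D x"
    and P: "\<And>x. fps_nth (P x) 0 = s x" "\<And>x. fps_nth (P' x) 0 = s x"
    and Q: "\<And>x. fps_nth (Q x) 0 = s x * s x" "\<And>x. fps_nth (Q' x) 0 = s x * s x"
  shows "D x = 0"
proof -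
  have "fps_nth (D x) n = 0" for n x
  proof (induction n arbitrary: x rule: less_induct)
    case (less n)
    have low: "\<And>i. i < n \<Longrightarrow> fps_nth (D x) i = 0" for x using less .
    show ?case
    proof (rule comm_cubic_lin_eq_0[OF s])
      have "fps_nth (fps_X * D' x) n = 0"
      proof (cases n)
        case (Suc m)
        have "((\<lambda>x. fps_nth (D x) m) has_vector_derivative fps_nth (D' x) m) (at x)"
          using D unfolding has_coeff_derivative_def by blast
        moreover have "(\<lambda>x. fps_nth (D x) m) = (\<lambda>x. 0)" using low Suc by auto
        ultimately have "fps_nth (D' x) m = 0"
          using vector_derivative_unique_at has_vector_derivative_const by metis
        then show ?thesis using Suc by simp
      qed simp
      then show "comm (fps_nth (D x) n) (s x) = 0"
        unfolding lax using fps_mult_nth_low(1,2)[OF low] by (simp add: comm_def B)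
      have "fps_nth (Q x * D x + P x * D x * P' x + D x * Q' x) n =
          s x * s x * fps_nth (D x) n + s x * fps_nth (D x) n * s x + fps_nth (D x) n * (s x * s x)"
      proof -
        have "\<And>i. i < n \<Longrightarrow> fps_nth (P x * D x) i = 0"
          using fps_mult_nth_low(4)[OF low] by blast
        from fps_mult_nth_low(1)[OF this, of n] show ?thesis
          using fps_mult_nth_low(1,2)[OF low] by (simp add: P Q)
      qed
      then show "cubic_lin (s x) (fps_nth (D x) n) = 0"
        unfolding cubic by (simp add: cubic_lin_def mult.assoc eq_neg_iff_add_eq_0[symmetric])
    qed
  qed
  then show ?thesis by (simp add: fps_eq_iff)
qed

lemma lax_unique:
  fixes M M' N N' :: "real \<Rightarrow> 'a::real_normed_algebra_1 fps"
  assumes s: "\<And>x. s x * s x * s x = - s x"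
    and M: "\<And>x. has_coeff_derivative M (M' x) x" "\<And>x. fps_X * M' x = comm (M x) (B x)"
      "\<And>x. M x * M x * M x = - M x" "\<And>x. fps_nth (M x) 0 = s x"
    and N: "\<And>x. has_coeff_derivative N (N' x) x" "\<And>x. fps_X * N' x = comm (N x) (B x)"
      "\<And>x. N x * N x * N x = - N x" "\<And>x. fps_nth (N x) 0 = s x"
    and B: "\<And>x. fps_nth (B x) 0 = s x"
  shows "M x = N x"
proof -
  have "M x - N x = 0"
  proof (rule lax_linear_zero[where s=s and D="\<lambda>x. M x - N x" and D'="\<lambda>x. M' x - N' x" and B=B
        and Q="\<lambda>x. N x * N x" and P=N and P'=M and Q'="\<lambda>x. M x * M x"])
    fix x
    show "fps_X * (M' x - N' x) = comm (M x - N x) (B x)"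
      unfolding right_diff_distrib M N by (simp add: comm_def algebra_simps)
    show "N x * N x * (M x - N x) + N x * (M x - N x) * M x + (M x - N x) * (M x * M x) = - (M x - N x)"
      using M(3)[of x] N(3)[of x] by (simp add: algebra_simps)
  qed (use assms in \<open>auto intro: has_coeff_derivative_diff\<close>)
  then show ?thesis by simp
qed

primrec lax_trunc :: "(real \<Rightarrow> 'a::real_normed_algebra_1) \<Rightarrow> nat \<Rightarrow> real \<Rightarrow> 'a fps" where
  "lax_trunc S 0 x = fps_const (S x)"
| "lax_trunc S (Suc i) x = Abs_fps (\<lambda>n. if n = Suc i
     then lax_next (S x) (vector_derivative (\<lambda>x. fps_nth (lax_trunc S i x) i) (at x))
       (fps_nth (lax_trunc S i x * lax_trunc S i x * lax_trunc S i x) (Suc i))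
     else fps_nth (lax_trunc S i x) n)"

text \<open>The coefficient of degree i + 1 needs the x-derivative of its predecessor and products
  of all earlier coefficients. Hence \<open>lax_trunc\<close> carries the whole truncated series as
  a function of x, and the solution is its diagonal. The part of the cubic relation known before the
  new coefficient is the cube of the truncation, which enters \<open>lax_next\<close> as w.\<close>

definition lax_sol :: "(real \<Rightarrow> 'a::real_normed_algebra_1) \<Rightarrow> real \<Rightarrow> 'a fps" where
  "lax_sol S x = Abs_fps (\<lambda>n. fps_nth (lax_trunc S n x) n)"

lemma lax_trunc_eq: "lax_trunc S i x = fps_cutoff (Suc i) (lax_sol S x)"
proof (induction i)
  case 0
  then show ?case by (auto simp: fps_eq_iff lax_sol_def)
next
  case (Suc i)
  have "fps_nth (lax_trunc S (Suc i) x) n = (if n < Suc (Suc i) then fps_nth (lax_sol S x) n else 0)" for n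
  proof (cases "n = Suc i")
    case True
    then show ?thesis by (simp add: lax_sol_def)
  next
    case False
    then have "fps_nth (lax_trunc S (Suc i) x) n = fps_nth (lax_trunc S i x) n" by simp
    then show ?thesis unfolding Suc using False by auto
  qed
  then show ?case by (simp add: fps_eq_iff del: lax_trunc.simps)
qed

lemma lax_sol_0: "fps_nth (lax_sol S x) 0 = S x"
  by (simp add: lax_sol_def)

lemma lax_sol_Suc:
  "fps_nth (lax_sol S x) (Suc i) =
    lax_next (S x) (vector_derivative (\<lambda>x. fps_nth (lax_sol S x) i) (at x))
      (fps_nth (fps_cutoff (Suc i) (lax_sol S x) * fps_cutoff (Suc i) (lax_sol S x) * fps_cutoff (Suc i) (lax_sol S x)) (Suc i))"
proof -
  have "fps_nth (lax_sol S x) (Suc i) = fps_nth (lax_trunc S (Suc i) x) (Suc i)"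
    by (simp add: lax_sol_def)
  then show ?thesis
    unfolding lax_trunc.simps(2) unfolding lax_trunc_eq by simp
qed

lemma smooth_on_comm:
  fixes f :: "'b::real_normed_vector \<Rightarrow> 'a::real_normed_algebra"
  shows "open U \<Longrightarrow> smooth_on f U \<Longrightarrow> smooth_on g U \<Longrightarrow> smooth_on (\<lambda>x. comm (f x) (g x)) U"
  unfolding comm_def by (intro smooth_on_diff smooth_on_mult)

lemma smooth_on_lax_next:
  fixes s :: "'b::real_normed_vector \<Rightarrow> 'a::real_normed_algebra_1"
  assumes "open U" "smooth_on s U" "smooth_on u U" "smooth_on w U"
  shows "smooth_on (\<lambda>x. lax_next (s x) (u x) (w x)) U"
  unfolding lax_next_def comm_inv_def
  by (intro smooth_on_diff smooth_on_mult smooth_on_linear[OF _ bounded_linear_scaleR_right]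
      smooth_on_add smooth_on_comm assms)

lemma smooth_on_fps_mult:
  fixes F :: "'b::real_normed_vector \<Rightarrow> 'a::real_normed_algebra fps"
  assumes "open U" "\<And>n. smooth_on (\<lambda>x. fps_nth (F x) n) U" "\<And>n. smooth_on (\<lambda>x. fps_nth (G x) n) U"
  shows "smooth_on (\<lambda>x. fps_nth (F x * G x) n) U"
  unfolding fps_mult_nth by (intro smooth_on_sum smooth_on_mult assms)

text \<open>No differential equation in x is solved in the recursion: a new coefficient is a
  polynomial in S, the earlier coefficients and one x-derivative. Joint smoothness in parameter and
  position is therefore inherited from degree to degree.\<close>

lemma smooth_on_lax_sol_family:
  fixes S :: "real \<times> real \<Rightarrow> 'a::real_normed_algebra_1"
  assumes I: "open I" and S: "smooth_on S (I \<times> UNIV)"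
  shows "smooth_on (\<lambda>p. fps_nth (lax_sol (\<lambda>x. S (fst p, x)) (snd p)) n) (I \<times> UNIV)"
proof (induction n rule: less_induct)
  case (less n)
  have U: "open (I \<times> (UNIV :: real set))" using I by (simp add: open_Times)
  let ?M = "\<lambda>p. lax_sol (\<lambda>x. S (fst p, x)) (snd p)"
  show ?case
  proof (cases n)
    case 0
    then show ?thesis using S by (simp add: lax_sol_0)
  next
    case (Suc i)
    let ?F = "\<lambda>p. fps_cutoff (Suc i) (?M p)"
    have F: "smooth_on (\<lambda>p. fps_nth (?F p) m) (I \<times> UNIV)" for m
      using less[of m] Suc by (cases "m < Suc i") (simp_all add: smooth_on_const U)
    have Mi: "smooth_on (\<lambda>p. fps_nth (?M p) i) (I \<times> UNIV)"
      using less[of i] Suc by simp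
    have "smooth_on (\<lambda>p. lax_next (S p) (partial_x (\<lambda>p. fps_nth (?M p) i) p)
        (fps_nth (?F p * ?F p * ?F p) (Suc i))) (I \<times> UNIV)"
      by (intro smooth_on_lax_next U S smooth_on_partial_x Mi smooth_on_fps_mult F)
    then show ?thesis
    proof (rule smooth_on_cong[OF U, rotated])
      fix p :: "real \<times> real" assume p: "p \<in> I \<times> UNIV"
      show "lax_next (S p) (partial_x (\<lambda>p. fps_nth (?M p) i) p) (fps_nth (?F p * ?F p * ?F p) (Suc i))
          = fps_nth (?M p) n"
        unfolding Suc lax_sol_Suc
        using vector_derivative_partial_x[OF Mi, of "fst p" "snd p"] p by simp
    qed
  qed
qed

lemma smooth_on_lax_sol:
  fixes S :: "real \<Rightarrow> 'a::real_normed_algebra_1"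
  assumes "smooth_on S UNIV"
  shows "smooth_on (\<lambda>x. fps_nth (lax_sol S x) n) UNIV"
proof -
  have "smooth_on (\<lambda>p::real \<times> real. S (snd p)) (UNIV \<times> UNIV)"
    by (rule smooth_on_constant_family[OF open_UNIV assms])
  from smooth_on_slice[OF open_UNIV smooth_on_lax_sol_family[OF open_UNIV this, of n], of 0]
  show ?thesis by simp
qed

text \<open>The defects E of the Lax equation and G of the cubic equation are shown to vanish
  together, degree by degree. Neither can be treated alone: \<open>lax_next\<close> works only if
  the derivative u is annihilated by \<open>cubic_lin\<close>, and this comes from differentiating
  the cubic relation in the preceding degree.\<close>

lemma lax_sol_correct:
  fixes S :: "real \<Rightarrow> 'a::real_normed_algebra_1"
  assumes smooth: "smooth_on S UNIV" and s: "\<And>x. S x * S x * S x = - S x"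
  shows "((\<lambda>x. fps_nth (lax_sol S x) n) has_vector_derivative comm (fps_nth (lax_sol S x) (Suc n)) (S x)) (at x)"
    and "lax_sol S x * lax_sol S x * lax_sol S x = - lax_sol S x"
proof -
  define M where "M = lax_sol S"
  define dM where "dM x = Abs_fps (\<lambda>n. vector_derivative (\<lambda>x. fps_nth (M x) n) (at x))" for x
  have dM: "has_coeff_derivative M (dM x) x" for x
    unfolding has_coeff_derivative_def dM_def M_def
    using smooth_on_real_has_vector_derivative[OF smooth_on_lax_sol[OF smooth]] by simp
  define E where "E x = fps_X * dM x - comm (M x) (fps_const (S x))" for x
  define G where "G x = M x * M x * M x + M x" for x
  define G' where "G' x = (dM x * M x + M x * dM x) * M x + M x * M x * dM x + dM x" for x
  have dG: "has_coeff_derivative G (G' x) x" for x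
    unfolding G_def G'_def by (intro has_coeff_derivative_add has_coeff_derivative_mult dM)
  \<comment> \<open>The Lax operator acts as a derivation, so the Lax defect of
    \<open>M\<^sup>3 + M\<close> is the linearized cubic map applied to E.\<close>
  have GE: "fps_X * G' x - comm (G x) (fps_const (S x)) =
      E x * (M x * M x) + M x * E x * M x + M x * M x * E x + E x" for x
    unfolding G_def G'_def E_def comm_def
    by (simp add: algebra_simps fps_X_assoc)
  have M0: "fps_nth (M x) 0 = S x" for x by (simp add: M_def lax_sol_0)
  have "\<forall>x. \<forall>n\<le>i. fps_nth (G x) n = 0 \<and> fps_nth (E x) n = 0" for i
  proof (induction i)
    case 0
    show ?case using s by (simp add: G_def E_def M0 comm_def)
  next
    case (Suc i)
    define F where "F x = fps_cutoff (Suc i) (M x)" for x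
    have "fps_nth (G x) (Suc i) = 0 \<and> fps_nth (E x) (Suc i) = 0" for x
    proof -
      let ?u = "fps_nth (dM x) i" and ?m = "fps_nth (M x) (Suc i)" and ?s = "S x"
      let ?w = "fps_nth (F x * F x * F x) (Suc i)"
      have m: "?m = lax_next ?s ?u ?w"
        unfolding M_def F_def dM_def lax_sol_Suc by simp
      have lowE: "\<And>n. n < Suc i \<Longrightarrow> fps_nth (E x) n = 0" using Suc by simp
      have E_Suc: "fps_nth (E x) (Suc i) = ?u - comm ?m ?s"
        by (simp add: E_def comm_def)
      have "fps_nth (G' x) i = 0"
      proof -
        have "((\<lambda>x. fps_nth (G x) i) has_vector_derivative fps_nth (G' x) i) (at x)"
          using dG unfolding has_coeff_derivative_def by blast
        moreover have "(\<lambda>x. fps_nth (G x) i) = (\<lambda>x. 0)" using Suc by auto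
        ultimately show ?thesis
          using vector_derivative_unique_at has_vector_derivative_const by metis
      qed
      \<comment> \<open>This is \<open>GE\<close> in degree i + 1. The unknown coefficient
        \<open>?m\<close> enters E through a commutator with s, which \<open>cubic_lin\<close>
        kills. So \<open>cubic_lin\<close> maps u to a commutator with s, and
        \<open>comm_cubic_lin_split\<close> makes that 0.\<close>
      then have "- comm (fps_nth (G x) (Suc i)) ?s = cubic_lin ?s (fps_nth (E x) (Suc i))"
      proof -
        have "\<And>n. n < Suc i \<Longrightarrow> fps_nth (M x * E x) n = 0"
          using fps_mult_nth_low(4)[OF lowE] by blast
        note low = fps_mult_nth_low(1)[OF this]
        have "fps_nth (fps_X * G' x - comm (G x) (fps_const (S x))) (Suc i) =
            cubic_lin ?s (fps_nth (E x) (Suc i))"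
          unfolding GE using fps_mult_nth_low(1)[OF lowE, of "Suc i" "M x * M x"] low[of "Suc i" "M x"]
            fps_mult_nth_low(2)[OF lowE, of "Suc i" "M x"] fps_mult_nth_low(2)[OF lowE, of "Suc i" "M x * M x"]
          unfolding fps_add_nth by (simp add: cubic_lin_def M0 mult.assoc[of "fps_nth (E x) (Suc i)"] add_ac)
        then show ?thesis using \<open>fps_nth (G' x) i = 0\<close> by (simp add: comm_def)
      qed
      also have "\<dots> = cubic_lin ?s ?u"
        using comm_cubic_lin(2)[OF s, of x ?m] unfolding E_Suc by (simp add: cubic_lin_def algebra_simps)
      finally have Ju: "cubic_lin ?s ?u = comm (- fps_nth (G x) (Suc i)) ?s"
        by (simp add: comm_def)
      then have u: "cubic_lin ?s ?u = 0" by (rule comm_cubic_lin_split[OF s])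
      with Ju have g: "comm (fps_nth (G x) (Suc i)) ?s = 0" by (simp add: comm_def)
      \<comment> \<open>M and its truncation F differ from degree i + 1 on. In the expansion of the
        cube every term carrying H = M - F thus contributes its lowest coefficient times constant
        terms.\<close>
      have Gw: "fps_nth (G x) (Suc i) = ?w + cubic_lin ?s ?m"
      proof -
        define H where "H = M x - F x"
        have lowH: "\<And>n. n < Suc i \<Longrightarrow> fps_nth H n = 0" and H: "fps_nth H (Suc i) = ?m"
          by (simp_all add: H_def F_def)
        have "\<And>n. n < Suc i \<Longrightarrow> fps_nth (F x * H) n = 0"
          using fps_mult_nth_low(4)[OF lowH] by blast
        note low = fps_mult_nth_low(1)[OF this]
        have "G x = F x * F x * F x + (H * (M x * M x) + F x * H * M x + F x * F x * H) + M x"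
          by (simp add: G_def H_def algebra_simps)
        moreover have "fps_nth (F x) 0 = ?s" by (simp add: F_def M0)
        ultimately have "fps_nth (G x) (Suc i) = ?w + (?m * (?s * ?s) + ?s * ?m * ?s + ?s * ?s * ?m) + ?m"
          using fps_mult_nth_low(1)[OF lowH, of "Suc i" "M x * M x"] low[of "Suc i" "M x"]
            fps_mult_nth_low(2)[OF lowH, of "Suc i" "F x"] fps_mult_nth_low(2)[OF lowH, of "Suc i" "F x * F x"]
          unfolding fps_add_nth by (simp add: M0 H)
        then show ?thesis by (simp add: cubic_lin_def mult.assoc add_ac)
      qed
      have w: "comm ?w ?s = 0"
        using g comm_cubic_lin(1)[OF s, of x ?m] unfolding Gw by (simp add: comm_def algebra_simps)
      from lax_next[OF s u w] show ?thesis
        unfolding E_Suc Gw m[symmetric] by simp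
    qed
    then show ?case using Suc le_Suc_eq by auto
  qed
  then have "fps_nth (G x) n = 0" "fps_nth (E x) n = 0" for n x by auto
  then have G: "G x = 0" and E: "E x = 0" for x by (simp_all add: fps_eq_iff)
  show "lax_sol S x * lax_sol S x * lax_sol S x = - lax_sol S x"
    using G[of x] unfolding G_def M_def by (simp add: eq_neg_iff_add_eq_0)
  have "fps_nth (E x) (Suc n) = 0" by (simp add: E)
  then have "fps_nth (dM x) n = comm (fps_nth (M x) (Suc n)) (S x)"
    by (simp add: E_def comm_def)
  then show "((\<lambda>x. fps_nth (lax_sol S x) n) has_vector_derivative comm (fps_nth (lax_sol S x) (Suc n)) (S x)) (at x)"
    using dM[of x] unfolding has_coeff_derivative_def M_def by metis
qed

section \<open>Truncated series and the evolution in time\<close>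

lemma has_coeff_derivative_cutoff:
  "has_coeff_derivative F F' x \<Longrightarrow> has_coeff_derivative (\<lambda>x. fps_cutoff n (F x)) (fps_cutoff n F') x"
  by (auto simp: has_coeff_derivative_def)

definition lax_deriv :: "(real \<Rightarrow> 'a::real_normed_algebra_1) \<Rightarrow> real \<Rightarrow> 'a fps" where
  "lax_deriv S x = Abs_fps (\<lambda>n. comm (fps_nth (lax_sol S x) (Suc n)) (S x))"

lemma lax_deriv:
  fixes S :: "real \<Rightarrow> 'a::real_normed_algebra_1"
  assumes "smooth_on S UNIV" "\<And>x. S x * S x * S x = - S x"
  shows "has_coeff_derivative (lax_sol S) (lax_deriv S x) x"
    and "fps_X * lax_deriv S x = comm (lax_sol S x) (fps_const (S x))"
proof -
  show "has_coeff_derivative (lax_sol S) (lax_deriv S x) x"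
    unfolding has_coeff_derivative_def lax_deriv_def using lax_sol_correct(1)[OF assms] by simp
  show "fps_X * lax_deriv S x = comm (lax_sol S x) (fps_const (S x))"
    by (auto simp: fps_eq_iff lax_deriv_def comm_def lax_sol_0 gr0_conv_Suc)
qed

text \<open>Truncation spoils the Lax equation only in degree p + 1, where the missing commutator is
  \<open>(M\<^sub>p)\<^sub>x\<close>. In the notation of the overview this reads
  \<open>N\<^sub>x = [N, \<lambda>S] + \<lambda>(M\<^sub>p)\<^sub>x\<close>; along the flow the
  remainder is \<open>\<lambda>S\<^sub>t\<close>, so it is the zero-curvature equation.\<close>

lemma lax_deriv_cutoff:
  fixes S :: "real \<Rightarrow> 'a::real_normed_algebra_1"
  shows "fps_X * fps_cutoff (Suc p) (lax_deriv S x) =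
    comm (fps_cutoff (Suc p) (lax_sol S x)) (fps_const (S x)) + fps_X ^ Suc p * fps_const (fps_nth (lax_deriv S x) p)"
proof (rule fps_ext)
  fix n
  show "fps_nth (fps_X * fps_cutoff (Suc p) (lax_deriv S x)) n =
    fps_nth (comm (fps_cutoff (Suc p) (lax_sol S x)) (fps_const (S x)) + fps_X ^ Suc p * fps_const (fps_nth (lax_deriv S x) p)) n"
    by (cases n) (auto simp: lax_deriv_def comm_def lax_sol_0 fps_X_power_mult_nth simp del: power_Suc)
qed

lemma comm_Jacobi: "comm (comm a b) c = comm (comm a c) b + comm a (comm b (c::'a::ring))"
  by (simp add: comm_def algebra_simps)

lemma comm_cube: 
  fixes a :: "'a::ring"
  shows "a * a * a = - a \<Longrightarrow> a * a * comm a b + a * comm a b * a + comm a b * (a * a) = - comm a b"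
proof -
  assume "a * a * a = - a"
  then have "a * (a * a) = - a" "a * (a * (a * b)) = - (a * b)"
    using cube_assoc by blast+
  then show ?thesis by (simp add: comm_def algebra_simps)
qed

text \<open>
  With \<open>X = 1/\<lambda>\<close>, the conclusion is \<open>M\<^sub>t = [M, \<lambda>\<^sup>p\<^sup>+\<^sup>1 \<Sum>\<^sub>i\<^sub>\<le>\<^sub>p M\<^sub>i \<lambda>\<^sup>-\<^sup>i]\<close> multiplied by \<open>X\<^sup>p\<^sup>+\<^sup>1\<close>, which avoids
  positive powers of \<open>\<lambda>\<close>.
\<close>

theorem lax_sol_evolution:
  fixes S :: "real \<times> real \<Rightarrow> 'a::{real_normed_algebra_1, banach}"
  assumes I: "open I" "t \<in> I" and S: "smooth_on S (I \<times> UNIV)"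
    and s: "\<And>q. q \<in> I \<times> UNIV \<Longrightarrow> S q * S q * S q = - S q"
    and St: "\<And>x. partial_t S (t, x) = fps_nth (lax_deriv (\<lambda>x. S (t, x)) x) p"
  shows "fps_X ^ Suc p * Abs_fps (\<lambda>n. partial_t (\<lambda>q. fps_nth (lax_sol (\<lambda>x. S (fst q, x)) (snd q)) n) (t, x))
    = comm (lax_sol (\<lambda>x. S (t, x)) x) (fps_cutoff (Suc p) (lax_sol (\<lambda>x. S (t, x)) x))"
proof -
  define m where "m n q = fps_nth (lax_sol (\<lambda>x. S (fst q, x)) (snd q)) n" for n and q :: "real \<times> real"
  have U: "open (I \<times> (UNIV :: real set))" using I by (simp add: open_Times)
  have m: "smooth_on (m n) (I \<times> UNIV)" for n
    unfolding m_def[abs_def] by (rule smooth_on_lax_sol_family[OF I(1) S])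
  have m0: "m 0 q = S q" for q by (simp add: m_def lax_sol_0)
  have slice: "smooth_on (\<lambda>x. S (r, x)) UNIV" if "r \<in> I" for r
    using smooth_on_slice[OF I(1) S that] .
  define s0 where "s0 x = S (t, x)" for x
  have s0: "smooth_on s0 UNIV" "\<And>x. s0 x * s0 x * s0 x = - s0 x"
    using slice[OF I(2)] s I unfolding s0_def[abs_def] by auto
  define M where "M = lax_sol s0"
  define A where "A x = fps_cutoff (Suc p) (M x)" for x
  define Mt where "Mt x = Abs_fps (\<lambda>n. partial_t (m n) (t, x))" for x
  define Mtx where "Mtx x = Abs_fps (\<lambda>n. partial_x (partial_t (m n)) (t, x))" for x
  define dM where "dM = lax_deriv s0"
  have M: "has_coeff_derivative M (dM x) x" "fps_X * dM x = comm (M x) (fps_const (s0 x))" for x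
    unfolding M_def dM_def by (rule lax_deriv[OF s0])+
  have M3: "M x * M x * M x = - M x" for x
    unfolding M_def by (rule lax_sol_correct[OF s0])
  have m_M: "fps_nth (M x) n = m n (t, x)" for n x
    by (simp add: M_def m_def s0_def[abs_def])
  have A': "has_coeff_derivative A (fps_cutoff (Suc p) (dM x)) x" for x
    unfolding A_def[abs_def] by (rule has_coeff_derivative_cutoff[OF M(1)])
  have Mtx: "has_coeff_derivative Mt (Mtx x) x" for x
    unfolding has_coeff_derivative_def Mt_def Mtx_def
    using has_vector_derivative_partial_x[OF smooth_on_partial_t[OF m], of t x] I by simp
  have t_deriv: "has_coeff_derivative (\<lambda>r. lax_sol (\<lambda>x. S (r, x)) x) (Mt x) t" for x
    unfolding has_coeff_derivative_def Mt_def
    using has_vector_derivative_partial_t[OF m, of t x] I by (simp add: m_def)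
  have dx_m: "partial_x (m n) (r, x) = comm (m (Suc n) (r, x)) (S (r, x))" if "r \<in> I" for n r x
  proof -
    have "((\<lambda>x. m n (r, x)) has_vector_derivative comm (m (Suc n) (r, x)) (S (r, x))) (at x)"
      using lax_sol_correct(1)[OF slice[OF that]] s that by (simp add: m_def)
    then show ?thesis
      using has_vector_derivative_partial_x[OF m] that vector_derivative_unique_at by blast
  qed
  have mtx: "partial_x (partial_t (m n)) (t, x) = comm (partial_t (m (Suc n)) (t, x)) (s0 x) + comm (m (Suc n) (t, x)) (partial_t S (t, x))" for n x
  proof -
    have "((\<lambda>r. comm (m (Suc n) (r, x)) (S (r, x))) has_vector_derivative
        comm (partial_t (m (Suc n)) (t, x)) (s0 x) + comm (m (Suc n) (t, x)) (partial_t S (t, x))) (at t)"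
    proof -
      have 1: "((\<lambda>r. m (Suc n) (r, x)) has_vector_derivative partial_t (m (Suc n)) (t, x)) (at t)"
        "((\<lambda>r. S (r, x)) has_vector_derivative partial_t S (t, x)) (at t)"
        using has_vector_derivative_partial_t[OF m] has_vector_derivative_partial_t[OF S] I by auto
      show ?thesis
        unfolding comm_def s0_def
        using has_vector_derivative_diff[OF has_vector_derivative_mult[OF 1] has_vector_derivative_mult[OF 1(2,1)]]
        by (simp add: algebra_simps)
    qed
    then have "((\<lambda>r. partial_x (m n) (r, x)) has_vector_derivative
        comm (partial_t (m (Suc n)) (t, x)) (s0 x) + comm (m (Suc n) (t, x)) (partial_t S (t, x))) (at t)"
      by (rule has_vector_derivative_transform_within_open[OF _ I]) (simp add: dx_m)
    moreover have "((\<lambda>r. partial_x (m n) (r, x)) has_vector_derivative partial_t (partial_x (m n)) (t, x)) (at t)"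
      using has_vector_derivative_partial_t[OF smooth_on_partial_x[OF m]] I by auto
    ultimately show ?thesis
      using partial_t_partial_x_commute[OF I(1) m I(2)] vector_derivative_unique_at by metis
  qed
  \<comment> \<open>This is the time derivative of the Lax equation. In degree 0 the two commutators
    on the right cancel because \<open>M\<^sub>0 = S\<close>.\<close>
  have XMtx: "fps_X * Mtx x = comm (Mt x) (fps_const (s0 x)) + comm (M x) (fps_const (fps_nth (dM x) p))" for x
  proof (rule fps_ext)
    fix n
    have "partial_t (m 0) (t, x) = partial_t S (t, x)" by (simp add: m0[abs_def])
    then show "fps_nth (fps_X * Mtx x) n =
        fps_nth (comm (Mt x) (fps_const (s0 x)) + comm (M x) (fps_const (fps_nth (dM x) p))) n"
      using St[of x] mtx[of _ x]
      by (cases n) (simp_all add: comm_def Mt_def Mtx_def m_M m0 s0_def[abs_def] dM_def)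
  qed
  have t_cube: "M x * M x * Mt x + M x * Mt x * M x + Mt x * (M x * M x) = - Mt x" for x
  proof -
    let ?L = "\<lambda>r. lax_sol (\<lambda>x. S (r, x)) x"
    have L: "?L t = M x" by (simp add: M_def s0_def[abs_def])
    have "has_coeff_derivative (\<lambda>r. ?L r * ?L r * ?L r + ?L r)
        ((Mt x * M x + M x * Mt x) * M x + M x * M x * Mt x + Mt x) t"
      using has_coeff_derivative_add[OF has_coeff_derivative_mult[OF has_coeff_derivative_mult[OF
              t_deriv[of x] t_deriv[of x]] t_deriv[of x]] t_deriv[of x]]
      unfolding L .
    then have "has_coeff_derivative (\<lambda>r. 0) ((Mt x * M x + M x * Mt x) * M x + M x * M x * Mt x + Mt x) t"
      by (rule has_coeff_derivative_transform[OF _ I])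
        (use lax_sol_correct(2)[OF slice] s in \<open>simp add: eq_neg_iff_add_eq_0[symmetric]\<close>)
    from has_coeff_derivative_unique[OF this has_coeff_derivative_const]
    have "(Mt x * M x + M x * Mt x) * M x + M x * M x * Mt x + Mt x = 0" .
    then have "(Mt x * M x + M x * Mt x) * M x + M x * M x * Mt x = - Mt x"
      by (simp only: eq_neg_iff_add_eq_0)
    then show ?thesis by (simp add: algebra_simps)
  qed
  have "fps_X ^ Suc p * Mt x - comm (M x) (A x) = 0"
  proof (rule lax_linear_zero[where s=s0 and D="\<lambda>x. fps_X ^ Suc p * Mt x - comm (M x) (A x)"
        and D'="\<lambda>x. fps_X ^ Suc p * Mtx x - (comm (dM x) (A x) + comm (M x) (fps_cutoff (Suc p) (dM x)))"
        and B="\<lambda>x. fps_const (s0 x)"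
        and Q="\<lambda>x. M x * M x" and P=M and P'=M and Q'="\<lambda>x. M x * M x"])
    fix x
    show "has_coeff_derivative (\<lambda>x. fps_X ^ Suc p * Mt x - comm (M x) (A x))
       (fps_X ^ Suc p * Mtx x - (comm (dM x) (A x) + comm (M x) (fps_cutoff (Suc p) (dM x)))) x"
      by (intro has_coeff_derivative_diff has_coeff_derivative_cmult has_coeff_derivative_comm Mtx M A')
    let ?X = "fps_X ^ Suc p :: 'a fps" and ?c = "fps_const (s0 x)" and ?u = "fps_const (fps_nth (dM x) p)"
    have XX: "fps_X * (?X * F) = ?X * (fps_X * F)" for F
      by (rule fps_X_assoc(2))
    have c1: "fps_X * comm a b = comm (fps_X * a) b" "fps_X * comm a b = comm a (fps_X * b)" for a b :: "'a fps"
      by (simp_all only: comm_def right_diff_distrib fps_X_assoc(1) mult.assoc)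
    have c2: "?X * comm a b = comm (?X * a) b" "?X * comm a b = comm a (?X * b)" for a b :: "'a fps"
      by (simp_all only: comm_def right_diff_distrib fps_X_assoc(2) mult.assoc)
    have "fps_X * (?X * Mtx x - (comm (dM x) (A x) + comm (M x) (fps_cutoff (Suc p) (dM x)))) =
      ?X * (comm (Mt x) ?c + comm (M x) ?u) - (comm (comm (M x) ?c) (A x) + comm (M x) (comm (A x) ?c + ?X * ?u))"
      unfolding right_diff_distrib XX XMtx
      unfolding distrib_left c1(1)[of "dM x"] c1(2)[of "M x"] M(2)
      unfolding dM_def lax_deriv_cutoff A_def M_def by simp
    \<comment> \<open>The source term \<open>[M, S\<^sub>t]\<close> of \<open>XMtx\<close> cancels
      the boundary term of \<open>lax_deriv_cutoff\<close>. The Jacobi identity combines what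
      remains of the double commutators.\<close>
    also have "\<dots> = comm (?X * Mt x - comm (M x) (A x)) ?c"
    proof -
      have "comm (?X * Mt x - comm (M x) (A x)) ?c = comm (?X * Mt x) ?c - comm (comm (M x) (A x)) ?c"
        by (simp add: comm_def algebra_simps)
      moreover have "comm (M x) (comm (A x) ?c + ?X * ?u) = comm (M x) (comm (A x) ?c) + comm (M x) (?X * ?u)"
        by (simp add: comm_def algebra_simps)
      ultimately show ?thesis
        unfolding distrib_left c2(1)[of "Mt x"] c2(2)[of "M x" ?u] comm_Jacobi[of "M x" "A x" ?c] by simp
    qed
    finally show "fps_X * (?X * Mtx x - (comm (dM x) (A x) + comm (M x) (fps_cutoff (Suc p) (dM x)))) =
        comm (?X * Mt x - comm (M x) (A x)) ?c" .
    have "?X * (M x * M x * Mt x + M x * Mt x * M x + Mt x * (M x * M x)) = - (?X * Mt x)"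
      unfolding t_cube by simp
    then show "M x * M x * (?X * Mt x - comm (M x) (A x)) + M x * (?X * Mt x - comm (M x) (A x)) * M x
        + (?X * Mt x - comm (M x) (A x)) * (M x * M x) = - (?X * Mt x - comm (M x) (A x))"
      using comm_cube[OF M3, of x "A x"]
      by (simp only: right_diff_distrib left_diff_distrib distrib_left fps_X_assoc(2) mult.assoc) (simp add: algebra_simps)
  qed (auto simp: s0 M_def lax_sol_0)
  then show ?thesis
    by (simp add: Mt_def m_def[abs_def] M_def A_def s0_def[abs_def])
qed

section \<open>Symmetry of the brackets and conserved densities\<close>

lemma fps_mult_nth_rev:
  fixes F :: "'a::semiring_0 fps"
  shows "fps_nth (F * G) n = (\<Sum>i=0..n. fps_nth F (n - i) * fps_nth G i)"
  unfolding fps_mult_nth by (subst sum.atLeastAtMost_rev) simp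

text \<open>Both sides are partial sums of the coefficient p + q + 1 of [M, M] = 0. Reflecting the
  index in the sum for q changes the sign of each commutator and turns its range into the complement
  of the range for p, as i \<le> q means p + q + 1 - i > p. Hence the two partial sums
  agree.\<close>

lemma comm_cutoff_symmetric:
  fixes M :: "'a::ring_1 fps"
  shows "fps_nth (comm M (fps_cutoff (Suc p) M)) (p + q + 1) = fps_nth (comm M (fps_cutoff (Suc q) M)) (p + q + 1)"
proof -
  let ?N = "p + q + 1"
  let ?b = "\<lambda>i. comm (fps_nth M i) (fps_nth M (?N - i))"
  have nth: "fps_nth (comm M (Abs_fps (\<lambda>i. if P i then fps_nth M i else 0))) ?N =
      (\<Sum>i=0..?N. if P (?N - i) then ?b i else 0)" for P
  proof -
    let ?A = "Abs_fps (\<lambda>i. if P i then fps_nth M i else 0)"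
    have "fps_nth (comm M ?A) ?N =
        (\<Sum>i=0..?N. fps_nth M i * fps_nth ?A (?N - i)) - (\<Sum>i=0..?N. fps_nth ?A (?N - i) * fps_nth M i)"
      unfolding comm_def fps_sub_nth fps_mult_nth[of M] fps_mult_nth_rev[of ?A] ..
    then show ?thesis
      by (auto simp: comm_def sum_subtractf[symmetric] simp del: sum.atLeast0_atMost_Suc intro!: sum.cong)
  qed
  have cutoff: "fps_cutoff (Suc r) M = Abs_fps (\<lambda>i. if i \<le> r then fps_nth M i else 0)" for r
    by (auto simp: fps_eq_iff)
  have "M = Abs_fps (\<lambda>i. if True then fps_nth M i else 0)"
    by (auto simp: fps_eq_iff)
  with nth[of "\<lambda>_. True"] have 0: "(\<Sum>i=0..?N. ?b i) = 0"
    by (simp add: comm_def)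
  have "fps_nth (comm M (fps_cutoff (Suc q) M)) ?N = (\<Sum>i=0..?N. if ?N - i \<le> q then ?b i else 0)"
    unfolding cutoff nth ..
  also have "\<dots> = (\<Sum>i=0..?N. if i \<le> q then ?b (?N - i) else 0)"
    by (subst sum.atLeastAtMost_rev) (auto intro!: sum.cong)
  also have "\<dots> = (\<Sum>i=0..?N. (if ?N - i \<le> p then ?b i else 0) - ?b i)"
    by (intro sum.cong) (auto simp: comm_def)
  also have "\<dots> = fps_nth (comm M (fps_cutoff (Suc p) M)) ?N"
    unfolding cutoff nth sum_subtractf 0 by simp
  finally show ?thesis ..
qed

text \<open>
  The \<open>\<lambda>\<close>-derivative of \<open>\<lambda>\<^sup>p\<^sup>+\<^sup>1 \<Sum>\<^sub>i\<^sub>\<le>\<^sub>p M\<^sub>i \<lambda>\<^sup>-\<^sup>i\<close> divided by \<open>\<lambda>\<^sup>p\<close>; truncated subtraction cuts the sum off.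
\<close>

definition lax_flux :: "nat \<Rightarrow> 'a::real_normed_algebra_1 fps \<Rightarrow> 'a fps" where
  "lax_flux p M = Abs_fps (\<lambda>i. real (Suc p - i) *\<^sub>R fps_nth M i)"

text \<open>The \<lambda>-derivative of the identity \<open>lax_deriv_cutoff\<close>. The weight
  drops by one from degree m to m + 1 exactly when m \<le> p, and that drop accounts for the
  commutator with the truncation together with the boundary term.\<close>

lemma lax_flux_deriv:
  fixes S :: "real \<Rightarrow> 'a::real_normed_algebra_1"
  shows "fps_X * lax_flux p (lax_deriv S x) =
    comm (lax_flux p (lax_sol S x)) (fps_const (S x)) + comm (fps_cutoff (Suc p) (lax_sol S x)) (fps_const (S x))
     + fps_X ^ Suc p * fps_const (fps_nth (lax_deriv S x) p)"
proof (rule fps_ext)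
  fix n
  have "real (Suc p - m) = real (Suc p - Suc m) + (if m \<le> p then 1 else 0)" for m by auto
  then show "fps_nth (fps_X * lax_flux p (lax_deriv S x)) n = fps_nth (
    comm (lax_flux p (lax_sol S x)) (fps_const (S x)) + comm (fps_cutoff (Suc p) (lax_sol S x)) (fps_const (S x))
     + fps_X ^ Suc p * fps_const (fps_nth (lax_deriv S x) p)) n"
    by (cases n) (auto simp: lax_flux_def lax_deriv_def comm_def lax_sol_0 fps_X_power_mult_nth algebra_simps simp del: power_Suc)
qed

text \<open>Write \<open>S\<^sub>t\<close> for \<open>(M\<^sub>p)\<^sub>x\<close>. Differentiating
  \<open>N\<^sub>x = [N, \<lambda>S] + \<lambda>S\<^sub>t\<close> in \<lambda> gives \<open>(M
  N\<^sub>\<lambda>)\<^sub>x = [M N\<^sub>\<lambda>, \<lambda>S] + M [N, S] + M S\<^sub>t\<close>.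
  Under a trace the first commutator vanishes and \<open>M [N, S]\<close> becomes
  \<open>[M, N] S\<close>, that is \<open>M\<^sub>t S\<close>. Since \<open>lax_flux\<close> is
  \<open>N\<^sub>\<lambda>\<close> divided by \<open>\<lambda>\<^sup>p\<close>, index n + p holds
  the coefficient of \<open>\<lambda>\<close> to the power - n.\<close>

theorem lax_conservation:
  fixes S :: "real \<Rightarrow> 'a::real_normed_algebra_1" and \<tau> :: "'a \<Rightarrow> real"
  assumes S: "smooth_on S UNIV" "\<And>x. S x * S x * S x = - S x"
    and \<tau>: "bounded_linear \<tau>" "\<And>a b. \<tau> (a * b) = \<tau> (b * a)"
    and Mt: "fps_X ^ Suc p * Mt = comm (lax_sol S x) (fps_cutoff (Suc p) (lax_sol S x))"
  shows "((\<lambda>x. \<tau> (fps_nth (lax_sol S x * lax_flux p (lax_sol S x)) (n + p))) has_vector_derivative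
    \<tau> (fps_nth Mt n * S x + fps_nth (lax_sol S x) n * fps_nth (lax_deriv S x) p)) (at x)"
proof -
  define M where "M = lax_sol S x"
  define dM where "dM = lax_deriv S x"
  define A where "A = fps_cutoff (Suc p) M"
  define N where "N = lax_flux p M"
  define K where "K = dM * N + M * lax_flux p dM"
  let ?c = "fps_const (S x)" and ?u = "fps_const (fps_nth dM p)"
  interpret \<tau>: bounded_linear \<tau> by fact
  have "has_coeff_derivative (\<lambda>x. lax_flux p (lax_sol S x)) (lax_flux p dM) x"
    using lax_deriv(1)[OF S, of x] unfolding has_coeff_derivative_def lax_flux_def dM_def
    by (auto intro!: derivative_eq_intros simp: scaleR_conv_of_real)
  from has_coeff_derivative_mult[OF lax_deriv(1)[OF S] this]
  have K: "((\<lambda>x. fps_nth (lax_sol S x * lax_flux p (lax_sol S x)) (n + p)) has_vector_derivative fps_nth K (n + p)) (at x)"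
    unfolding has_coeff_derivative_def K_def dM_def M_def N_def by blast
  have tr: "\<tau> (fps_nth (F * G) k) = \<tau> (fps_nth (G * F) k)" for F G :: "'a fps" and k
    unfolding fps_mult_nth[of F] fps_mult_nth_rev[of G] \<tau>.sum by (intro sum.cong) (auto simp: \<tau>(2))
  have "fps_X * K = comm M ?c * N + M * (comm N ?c + comm A ?c + fps_X ^ Suc p * ?u)"
    using lax_deriv(2)[OF S, of x] lax_flux_deriv[of p S x]
    unfolding K_def distrib_left M_def N_def A_def dM_def
    by (metis (no_types, lifting) distrib_left fps_X_assoc(1) mult.assoc)
  also have "\<dots> = (M * N * ?c - ?c * (M * N)) + (A * (M * ?c) - M * ?c * A) + (comm M A * ?c + fps_X ^ Suc p * (M * ?u))"
    by (simp add: comm_def algebra_simps fps_X_assoc del: power_Suc)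
  also have "\<dots> = (M * N * ?c - ?c * (M * N)) + (A * (M * ?c) - M * ?c * A) + fps_X ^ Suc p * (Mt * ?c + M * ?u)"
    unfolding A_def M_def Mt[symmetric] by (simp add: algebra_simps del: power_Suc)
  finally have "\<tau> (fps_nth (fps_X * K) (Suc (n + p))) = \<tau> (fps_nth (fps_X ^ Suc p * (Mt * ?c + M * ?u)) (Suc (n + p)))"
    using tr[of "M * N" ?c] tr[of A "M * ?c"] by (simp add: \<tau>.add \<tau>.diff del: power_Suc)
  then have "\<tau> (fps_nth K (n + p)) = \<tau> (fps_nth Mt n * S x + fps_nth M n * fps_nth dM p)"
    by (simp add: fps_X_power_mult_nth del: power_Suc)
  then show ?thesis
    using \<tau>.has_vector_derivative[OF K] by (simp add: M_def dM_def)
qed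

section \<open>Square matrices as a Banach algebra\<close>

text \<open>The formal theory above is stated for normed algebras with unit. On this copy of the
  square matrices \<open>*\<close> is the matrix product and the norm is the operator norm, for
  which the unit has norm 1.\<close>

typedef ('n::finite) sqmat = "UNIV :: (real^'n^'n) set"
  morphisms mat_of Mat ..

lemma mat_of_Mat [simp]: "mat_of (Mat A) = A"
  by (simp add: Mat_inverse)

lemma sqmat_eq_iff: "a = b \<longleftrightarrow> mat_of a = mat_of b"
  by (simp add: mat_of_inject)

instantiation sqmat :: (finite) real_normed_algebra_1
begin

definition "0 = Mat 0"
definition "1 = Mat (mat 1)"
definition "a + b = Mat (mat_of a + mat_of b)"
definition "a - b = Mat (mat_of a - mat_of b)"
definition "- a = Mat (- mat_of a)"
definition "a * b = Mat (mat_of a ** mat_of b)"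
definition scaleR_sqmat :: "real \<Rightarrow> 'a sqmat \<Rightarrow> 'a sqmat" where "scaleR_sqmat r a = Mat (r *\<^sub>R mat_of a)"
definition norm_sqmat :: "'a sqmat \<Rightarrow> real" where "norm_sqmat a = onorm ((*v) (mat_of a))"
definition dist_sqmat :: "'a sqmat \<Rightarrow> 'a sqmat \<Rightarrow> real" where "dist_sqmat a b = norm (a - b)"
definition sgn_sqmat :: "'a sqmat \<Rightarrow> 'a sqmat" where "sgn_sqmat a = scaleR (inverse (norm a)) a"
definition uniformity_sqmat :: "('a sqmat \<times> 'a sqmat) filter"
  where "uniformity_sqmat = (INF e\<in>{0 <..}. principal {(x, y). dist x y < e})"
definition open_sqmat :: "'a sqmat set \<Rightarrow> bool"
  where "open_sqmat S = (\<forall>x\<in>S. \<forall>\<^sub>F (x', y) in uniformity. x' = x \<longrightarrow> y \<in> S)"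

lemmas sqmat_defs = zero_sqmat_def one_sqmat_def plus_sqmat_def minus_sqmat_def uminus_sqmat_def
  times_sqmat_def scaleR_sqmat_def

instance
proof
  fix a b c :: "'a sqmat" and r s :: real
  show "a * b * c = a * (b * c)" "1 * a = a" "a * 1 = a"
    by (simp_all add: sqmat_defs sqmat_eq_iff matrix_mul_assoc)
  show "(a + b) * c = a * c + b * c" "a * (b + c) = a * b + a * c"
    by (simp_all add: sqmat_defs sqmat_eq_iff matrix_add_ldistrib)
      (simp add: matrix_matrix_mult_def vec_eq_iff distrib_right sum.distrib)
  show "(0::'a sqmat) \<noteq> 1"
    by (simp add: sqmat_defs sqmat_eq_iff mat_def vec_eq_iff) 
  show "r *\<^sub>R a * b = r *\<^sub>R (a * b)" "a * r *\<^sub>R b = r *\<^sub>R (a * b)"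
    by (simp_all add: sqmat_defs sqmat_eq_iff scalar_matrix_assoc matrix_scalar_ac flip: scalar_mult_eq_scaleR)
  show "norm a = 0 \<longleftrightarrow> a = 0"
  proof -
    have "(\<forall>x. mat_of a *v x = 0) \<longleftrightarrow> mat_of a = 0"
      using matrix_eq[of "mat_of a" 0] by simp
    then show ?thesis
      unfolding norm_sqmat_def by (simp add: onorm_eq_0 sqmat_defs sqmat_eq_iff)
  qed
  have mv: "(*v) (mat_of a + mat_of b) = (\<lambda>x. mat_of a *v x + mat_of b *v x)"
    "(*v) (r *\<^sub>R mat_of a) = (\<lambda>x. r *\<^sub>R (mat_of a *v x))"
    "(*v) (mat_of a ** mat_of b) = (*v) (mat_of a) \<circ> (*v) (mat_of b)"
    by (auto simp: matrix_vector_mult_add_rdistrib scaleR_matrix_vector_assoc matrix_vector_mul_assoc)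
  show "norm (a + b) \<le> norm a + norm b"
    using onorm_triangle[of "(*v) (mat_of a)" "(*v) (mat_of b)"]
    by (simp add: norm_sqmat_def sqmat_defs mv)
  show "norm (r *\<^sub>R a) = \<bar>r\<bar> * norm a"
    using onorm_scaleR[of "(*v) (mat_of a)" r]
    by (simp add: norm_sqmat_def sqmat_defs mv)
  show "norm (a * b) \<le> norm a * norm b"
    using onorm_compose[of "(*v) (mat_of a)" "(*v) (mat_of b)"]
    by (simp add: norm_sqmat_def sqmat_defs mv)
  show "norm (1::'a sqmat) = 1"
  proof -
    have "(*v) (mat 1) = (id :: real^'a \<Rightarrow> real^'a)" by auto
    then show ?thesis
      using onorm_id[where 'a="real^'a"] by (simp add: norm_sqmat_def sqmat_defs id_def)
  qed
qed (simp_all add: sqmat_defs sqmat_eq_iff dist_sqmat_def sgn_sqmat_def uniformity_sqmat_def open_sqmat_def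
    scaleR_add_right scaleR_add_left)

end

lemma mat_of_simps [simp]:
  "mat_of 0 = 0" "mat_of 1 = mat 1" "mat_of (a + b) = mat_of a + mat_of b"
  "mat_of (a - b) = mat_of a - mat_of b" "mat_of (- a) = - mat_of a"
  "mat_of (a * b) = mat_of a ** mat_of b" "mat_of (r *\<^sub>R a) = r *\<^sub>R mat_of a"
  by (simp_all add: sqmat_defs)

lemma bounded_linear_mat_of: "bounded_linear (mat_of :: 'n::finite sqmat \<Rightarrow> _)"
proof
  have entry: "\<bar>mat_of a $ i $ j\<bar> \<le> norm a" for a :: "'n sqmat" and i j
  proof -
    have "\<bar>mat_of a $ i $ j\<bar> = \<bar>(mat_of a *v axis j 1) $ i\<bar>"
      by (simp add: matrix_vector_mult_basis column_def)
    also have "\<dots> \<le> norm (mat_of a *v axis j 1)" by (rule component_le_norm_cart)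
    also have "\<dots> \<le> norm a"
      using onorm[of "(*v) (mat_of a)" "axis j 1"] by (simp add: norm_sqmat_def norm_axis_1)
    finally show ?thesis .
  qed
  have "norm (mat_of a) \<le> norm a * (CARD('n) * CARD('n))" for a :: "'n sqmat"
  proof -
    have "norm (mat_of a) \<le> (\<Sum>i\<in>UNIV. norm (mat_of a $ i))"
      unfolding norm_vec_def[of "mat_of a"] by (rule L2_set_le_sum) simp
    also have "\<dots> \<le> (\<Sum>i::'n\<in>UNIV. \<Sum>j::'n\<in>UNIV. norm a)"
      by (intro sum_mono order.trans[OF norm_le_l1_cart] entry)
    finally show ?thesis by (simp add: mult_ac)
  qed
  then show "\<exists>K. \<forall>a::'n sqmat. norm (mat_of a) \<le> norm a * K" by blast
qed simp_all

lemma bounded_linear_Mat: "bounded_linear (Mat :: real^'n^'n \<Rightarrow> 'n::finite sqmat)"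
proof -
  have "linear (Mat :: real^'n^'n \<Rightarrow> 'n sqmat)"
    by (rule linearI) (simp_all add: sqmat_eq_iff)
  then show ?thesis by (simp add: linear_conv_bounded_linear)
qed

instance sqmat :: (finite) banach
proof
  fix X :: "nat \<Rightarrow> 'a sqmat" assume "Cauchy X"
  then have "Cauchy (\<lambda>n. mat_of (X n))"
    by (rule bounded_linear.Cauchy[OF bounded_linear_mat_of])
  then obtain l where "(\<lambda>n. mat_of (X n)) \<longlonglongrightarrow> l"
    using Cauchy_convergent_iff convergent_def by blast
  then have "(\<lambda>n. Mat (mat_of (X n))) \<longlonglongrightarrow> Mat l"
    by (rule bounded_linear.tendsto[OF bounded_linear_Mat])
  then show "convergent X" by (auto simp: convergent_def mat_of_inverse)
qed

lemma bounded_linear_entry: "bounded_linear (\<lambda>a :: 'n::finite sqmat. mat_of a $ i $ j)"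
  using bounded_linear_compose[OF bounded_linear_vec_nth bounded_linear_compose[OF bounded_linear_vec_nth bounded_linear_mat_of]] .

lemma sqmat_derivative_iff:
  "(f has_vector_derivative f') (at x) \<longleftrightarrow>
   ((\<lambda>x. mat_of (f x)) has_vector_derivative mat_of f') (at (x::real))"
proof
  assume "(f has_vector_derivative f') (at x)"
  then show "((\<lambda>x. mat_of (f x)) has_vector_derivative mat_of f') (at x)"
    by (rule bounded_linear.has_vector_derivative[OF bounded_linear_mat_of])
next
  assume "((\<lambda>x. mat_of (f x)) has_vector_derivative mat_of f') (at x)"
  from bounded_linear.has_vector_derivative[OF bounded_linear_Mat this]
  show "(f has_vector_derivative f') (at x)" by (simp add: mat_of_inverse)
qed

section \<open>Trace, two involutions, and the embedding of vectors\<close>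

definition tr :: "'n::finite sqmat \<Rightarrow> real" where
  "tr a = trace (mat_of a)"

lemma bounded_linear_tr: "bounded_linear tr"
proof -
  have "bounded_linear (\<lambda>a::'a sqmat. \<Sum>i\<in>UNIV. mat_of a $ i $ i)"
    by (intro bounded_linear_sum bounded_linear_entry)
  then show ?thesis by (simp add: tr_def[abs_def] trace_def)
qed

lemma tr_commute: "tr (a * b) = tr (b * a)"
  unfolding tr_def mat_of_simps by (rule trace_mul_sym)

definition tp :: "'n::finite sqmat \<Rightarrow> 'n sqmat" where
  "tp a = Mat (transpose (mat_of a))"

definition sgn_opt :: "'n option \<Rightarrow> real" where
  "sgn_opt r = (case r of None \<Rightarrow> - 1 | Some i \<Rightarrow> 1)"

text \<open>Conjugation by diag(-1, 1, ..., 1), written entrywise.\<close>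

definition conj_sgn :: "('n::finite option) sqmat \<Rightarrow> ('n option) sqmat" where
  "conj_sgn a = Mat (\<chi> r c. sgn_opt r * sgn_opt c * mat_of a $ r $ c)"

lemma sgn_opt_square: "sgn_opt r * sgn_opt r = 1"
  by (simp add: sgn_opt_def split: option.splits)

lemma bounded_linear_tp: "bounded_linear (tp :: 'n::finite sqmat \<Rightarrow> _)"
proof -
  have "linear (\<lambda>A. transpose A :: real^'n^'n)"
    by (rule linearI) (simp_all add: transpose_def vec_eq_iff)
  then have "bounded_linear (\<lambda>A. transpose A :: real^'n^'n)"
    by (simp add: linear_conv_bounded_linear)
  from bounded_linear_compose[OF bounded_linear_Mat bounded_linear_compose[OF this bounded_linear_mat_of]]
  show ?thesis by (simp add: tp_def[abs_def])
qed

lemma bounded_linear_conj_sgn: "bounded_linear (conj_sgn :: ('n::finite option) sqmat \<Rightarrow> _)"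
proof -
  have "linear (\<lambda>A. \<chi> r c. sgn_opt r * sgn_opt c * A $ r $ c :: real^('n option)^('n option))"
    by (rule linearI) (simp_all add: vec_eq_iff algebra_simps)
  then have "bounded_linear (\<lambda>A. \<chi> r c. sgn_opt r * sgn_opt c * A $ r $ c :: real^('n option)^('n option))"
    by (simp add: linear_conv_bounded_linear)
  from bounded_linear_compose[OF bounded_linear_Mat bounded_linear_compose[OF this bounded_linear_mat_of]]
  show ?thesis by (simp add: conj_sgn_def[abs_def])
qed

lemma tp_mult: "tp (a * b) = tp b * tp a"
  by (simp add: tp_def sqmat_eq_iff matrix_transpose_mul)

lemma conj_sgn_mult: "conj_sgn (a * b) = conj_sgn a * conj_sgn b"
proof -
  have "sgn_opt r * sgn_opt c * (A $ r $ k * B $ k $ c) =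
      (sgn_opt r * sgn_opt k * A $ r $ k) * (sgn_opt k * sgn_opt c * B $ k $ c)"
    for r c k and A B :: "real^('n::finite option)^('n option)"
    using sgn_opt_square[of k] by (simp add: mult_ac)
  then show ?thesis
    by (auto simp: conj_sgn_def sqmat_eq_iff vec_eq_iff matrix_matrix_mult_def sum_distrib_left sgn_opt_square intro!: sum.cong)
qed

text \<open>The complement of so(n) in so(n + 1), identified with vectors. The unit tangent embedded
  in this way is the matrix S of the overview, and \<open>Mat_a_mat\<close> shows that a is the
  image of the first basis vector.\<close>

definition pmat :: "real^'n \<Rightarrow> ('n::finite option) sqmat" where
  "pmat v = Mat (\<chi> r c. case (r, c) of (None, Some i) \<Rightarrow> - v $ i | (Some i, None) \<Rightarrow> v $ i | _ \<Rightarrow> 0)"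

lemma sum_UNIV_option: "(\<Sum>k\<in>(UNIV::'n::finite option set). f k) = f None + (\<Sum>i\<in>UNIV. f (Some i))"
  by (simp add: UNIV_option_conv sum.reindex)

lemma pmat_nth [simp]:
  "mat_of (pmat v) $ None $ None = 0" "mat_of (pmat v) $ None $ Some i = - v $ i"
  "mat_of (pmat v) $ Some i $ None = v $ i" "mat_of (pmat v) $ Some i $ Some j = 0"
  by (simp_all add: pmat_def)

lemma sqmat_option_eqI:
  assumes "mat_of a $ None $ None = mat_of b $ None $ None"
    and "\<And>i. mat_of a $ None $ Some i = mat_of b $ None $ Some i"
    and "\<And>i. mat_of a $ Some i $ None = mat_of b $ Some i $ None"
    and "\<And>i j. mat_of a $ Some i $ Some j = mat_of b $ Some i $ Some j"
  shows "a = b"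
  unfolding sqmat_eq_iff vec_eq_iff using assms by (metis option.exhaust)

lemma bounded_linear_pmat: "bounded_linear (pmat :: real^'n \<Rightarrow> ('n::finite option) sqmat)"
proof -
  have "linear (pmat :: real^'n \<Rightarrow> ('n option) sqmat)"
    by (rule linearI; rule sqmat_option_eqI) simp_all
  then show ?thesis by (simp add: linear_conv_bounded_linear)
qed

text \<open>For a unit vector v this is the generator of a rotation in one plane, with eigenvalues
  +-i there and 0 on the orthogonal complement.\<close>

lemma pmat_cube: "norm v = 1 \<Longrightarrow> pmat v * pmat v * pmat v = - pmat v"
proof -
  assume "norm v = 1"
  then have v: "(\<Sum>i\<in>UNIV. v $ i * v $ i) = 1"
    using power2_norm_eq_inner[of v] by (simp add: inner_vec_def)
  have v': "(\<Sum>i\<in>UNIV. v $ i * (v $ i * c)) = c" "(\<Sum>i\<in>UNIV. c * v $ i * v $ i) = c" for c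
    using v by (simp_all add: mult.assoc[symmetric] flip: sum_distrib_right)
      (simp_all add: mult.assoc flip: sum_distrib_left)
  show ?thesis
    by (rule sqmat_option_eqI) (simp_all add: matrix_matrix_mult_def sum_UNIV_option v v' sum_negf)
qed

lemma tp_pmat: "tp (pmat v) = - pmat v"
  by (rule sqmat_option_eqI) (simp_all add: tp_def transpose_def)

lemma conj_sgn_pmat: "conj_sgn (pmat v) = - pmat v"
  by (rule sqmat_option_eqI) (simp_all add: conj_sgn_def sgn_opt_def)

lemma tr_mult_pmat:
  assumes "tp a = - a"
  shows "tr (a * pmat v) = - 2 * (\<Sum>i\<in>UNIV. mat_of a $ Some i $ None * v $ i)"
proof -
  have "mat_of a $ None $ Some i = - mat_of a $ Some i $ None" for i
    using arg_cong[OF assms, of "\<lambda>b. mat_of b $ Some i $ None"] by (simp add: tp_def transpose_def)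
  then show ?thesis
    by (simp add: tr_def trace_def sum_UNIV_option matrix_matrix_mult_def sum_negf)
qed

section \<open>The Laurent series of the definition\<close>

definition to_fls :: "('n::finite) sqmat fps \<Rightarrow> (real fls)^'n^'n" where
  "to_fls F = (\<chi> r c. fps_to_fls (Abs_fps (\<lambda>i. mat_of (fps_nth F i) $ r $ c)))"

lemma to_fls_mult: "to_fls (F * G) = to_fls F ** to_fls G"
proof -
  have "Abs_fps (\<lambda>i. mat_of (fps_nth (F * G) i) $ r $ c) =
      (\<Sum>k\<in>UNIV. Abs_fps (\<lambda>i. mat_of (fps_nth F i) $ r $ k) * Abs_fps (\<lambda>i. mat_of (fps_nth G i) $ k $ c))" for r c
  proof (rule fps_ext)
    fix n
    have "mat_of (fps_nth (F * G) n) $ r $ c =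
        (\<Sum>i=0..n. \<Sum>k\<in>UNIV. mat_of (fps_nth F i) $ r $ k * mat_of (fps_nth G (n - i)) $ k $ c)"
      unfolding fps_mult_nth linear_sum[OF bounded_linear.linear[OF bounded_linear_entry]]
      by (simp add: matrix_matrix_mult_def)
    also have "\<dots> = (\<Sum>k\<in>UNIV. \<Sum>i=0..n. mat_of (fps_nth F i) $ r $ k * mat_of (fps_nth G (n - i)) $ k $ c)"
      by (rule sum.swap)
    finally show "fps_nth (Abs_fps (\<lambda>i. mat_of (fps_nth (F * G) i) $ r $ c)) n =
      fps_nth (\<Sum>k\<in>UNIV. Abs_fps (\<lambda>i. mat_of (fps_nth F i) $ r $ k) * Abs_fps (\<lambda>i. mat_of (fps_nth G i) $ k $ c)) n"
      by (simp add: fps_sum_nth fps_mult_nth)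
  qed
  moreover have "fps_to_fls (\<Sum>k\<in>A. f k) = (\<Sum>k\<in>A. fps_to_fls (f k))" for f :: "'a \<Rightarrow> real fps" and A
    by (induction A rule: infinite_finite_induct) simp_all
  ultimately show ?thesis
    by (simp add: to_fls_def vec_eq_iff matrix_matrix_mult_def fls_times_fps_to_fls)
qed

lemma to_fls_diff: "to_fls (F - G) = to_fls F - to_fls G"
proof -
  have "Abs_fps (\<lambda>i. mat_of (fps_nth (F - G) i) $ r $ c) =
      Abs_fps (\<lambda>i. mat_of (fps_nth F i) $ r $ c) - Abs_fps (\<lambda>i. mat_of (fps_nth G i) $ r $ c)" for r c
    by (simp add: fps_eq_iff)
  then show ?thesis by (simp add: to_fls_def vec_eq_iff)
qed

lemma to_fls_uminus: "to_fls (- F) = - to_fls F"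
  using to_fls_diff[of 0 F] to_fls_diff[of 0 0] by simp

lemma to_fls_1: "to_fls 1 = mat 1"
proof -
  have "Abs_fps (\<lambda>i. mat_of (fps_nth 1 i) $ r $ c) = (if r = c then 1 else 0)" for r c :: 'a
    by (auto simp: fps_eq_iff mat_def)
  then show ?thesis by (auto simp: to_fls_def vec_eq_iff mat_def)
qed

lemma to_fls_inject: "to_fls F = to_fls G \<longleftrightarrow> F = G"
proof
  assume "to_fls F = to_fls G"
  then show "F = G"
    by (simp add: to_fls_def vec_eq_iff fps_eq_iff sqmat_eq_iff)
qed simp

abbreviation fls_smult :: "real fls \<Rightarrow> (real fls)^'n^'m \<Rightarrow> (real fls)^'n^'m" where
  "fls_smult c \<equiv> map_matrix ((*) c)"

lemma fls_smult_mult: "fls_smult c A ** B = fls_smult c (A ** B)" "A ** fls_smult c B = fls_smult c (A ** B)"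
  by (simp_all add: vec_eq_iff matrix_matrix_mult_def sum_distrib_left mult_ac)

lemma fls_smult_diff: "fls_smult c A - fls_smult c B = fls_smult c (A - B)"
  by (simp add: vec_eq_iff right_diff_distrib)

lemma fls_smult_X_inv_eq: "fls_smult fls_X_inv A = fls_smult fls_X_inv B \<longleftrightarrow> A = B"
  by (simp add: vec_eq_iff)

text \<open>The factor \<open>fls_X_inv\<close> is \<lambda>, so \<open>Q\<^sub>i\<close> is
  coefficient i + 1 of F. This reverses parities: the odd blocks of Q are the even coefficients of
  F.\<close>

definition to_Q :: "('n::finite) sqmat fps \<Rightarrow> (real fls)^'n^'n" where
  "to_Q F = fls_smult fls_X_inv (to_fls F)"

lemma coeff_mat_to_Q: "coeff_mat (to_Q F) i = (if i < -1 then 0 else mat_of (fps_nth F (nat (i + 1))))"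
  by (auto simp: coeff_mat_def to_Q_def to_fls_def vec_eq_iff fls_X_inv_times_conv_shift)

lemma coeff_mat_X_inv_X_inv:
  "coeff_mat (fls_smult fls_X_inv (to_Q F)) i = (if i < -2 then 0 else mat_of (fps_nth F (nat (i + 2))))"
  by (auto simp: coeff_mat_def to_Q_def to_fls_def vec_eq_iff fls_X_inv_times_conv_shift)

lemma to_Q_surj:
  assumes "\<And>i. i < -1 \<Longrightarrow> coeff_mat Q i = 0"
  shows "Q = to_Q (Abs_fps (\<lambda>n. Mat (coeff_mat Q (int n - 1))))"
proof -
  have "fls_nth (Q $ r $ c) i = 0" if "i < -1" for r c i
    using arg_cong[OF assms[OF that], of "\<lambda>A. A $ r $ c"] by (simp add: coeff_mat_def)
  then show ?thesis
    by (auto simp: vec_eq_iff fls_eq_iff to_Q_def to_fls_def fls_X_inv_times_conv_shift coeff_mat_def)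
qed

text \<open>The matrix a\<lambda> + u divided by \<lambda>.\<close>

definition lax_pot :: "real^'m \<Rightarrow> ('m::finite option option) sqmat fps" where
  "lax_pot v = fps_const (Mat a_mat) + fps_X * fps_const (Mat (Psi v))"

lemma a_lambda_eq: "a_lambda = to_Q (fps_const (Mat a_mat))"
  by (auto simp: a_lambda_def to_Q_def to_fls_def vec_eq_iff mult.commute fps_const_def fps_to_fls_Abs_fps
      fls_eq_iff fls_X_inv_times_conv_shift)

lemma lax_mat_eq: "lax_mat v = to_Q (lax_pot v)"
proof -
  have "fls_nth (fls_const c * fls_X_inv + fls_const d) i = (if i = -1 then c else if i = 0 then d else 0)" for c d :: real and i
    by (auto simp: mult.commute[of "fls_const c"] fls_X_inv_times_conv_shift)
  moreover have "mat_of (fps_nth (lax_pot v) n) = (if n = 0 then a_mat else if n = 1 then Psi v else 0)" for n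
    by (cases n) (auto simp: lax_pot_def)
  ultimately show ?thesis
    by (auto simp: lax_mat_def a_lambda_def to_Q_def to_fls_def vec_eq_iff fls_eq_iff fls_X_inv_times_conv_shift nat_eq_iff)
qed

lemma coeff_mat_lax_comm:
  "coeff_mat (lax_mat v ** to_Q F - to_Q F ** lax_mat v) i =
    (if i < -2 then 0 else mat_of (fps_nth (comm (lax_pot v) F) (nat (i + 2))))"
proof -
  have "lax_mat v ** to_Q F - to_Q F ** lax_mat v = fls_smult fls_X_inv (to_Q (comm (lax_pot v) F))"
    unfolding lax_mat_eq to_Q_def fls_smult_mult fls_smult_diff comm_def to_fls_diff to_fls_mult ..
  then show ?thesis by (simp add: coeff_mat_X_inv_X_inv)
qed

section \<open>Conjugacy to a constant matrix and the cubic equation\<close>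

lemma matrix_inv_mult:
  assumes "invertible (A :: 'a::semiring_1^'n^'n)"
  shows "A ** matrix_inv A = mat 1" "matrix_inv A ** A = mat 1"
  using someI_ex[OF assms[unfolded invertible_def]] unfolding matrix_inv_def by blast+

lemma matrix_inv_eqI:
  fixes A B :: "'a::semiring_1^'n^'n"
  assumes "A ** B = mat 1" "B ** A = mat 1"
  shows "matrix_inv A = B"
proof -
  have "invertible A" using assms unfolding invertible_def by blast
  then have "matrix_inv A ** A = mat 1" by (rule matrix_inv_mult)
  then show ?thesis
    using assms(1) by (metis matrix_mul_assoc matrix_mul_lid matrix_mul_rid)
qed

lemma conjugate_imp_cube:
  fixes P :: "(real fls)^'n^'n"
  assumes "invertible P" and Q: "to_Q F = P ** to_Q (fps_const a) ** matrix_inv P" and a: "a * a * a = - a"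
  shows "F * F * F = - F"
proof -
  let ?a = "to_fls (fps_const a)" and ?P' = "matrix_inv P"
  have F: "to_fls F = P ** ?a ** ?P'"
    using Q unfolding to_Q_def fls_smult_mult fls_smult_X_inv_eq .
  have "to_fls (F * F * F) = P ** ?a ** (?P' ** P) ** ?a ** (?P' ** P) ** ?a ** ?P'"
    unfolding to_fls_mult F matrix_mul_assoc ..
  also have "\<dots> = P ** (?a ** ?a ** ?a) ** ?P'"
    unfolding matrix_inv_mult[OF assms(1)] by (simp add: matrix_mul_assoc)
  also have "?a ** ?a ** ?a = - ?a"
    using a by (simp flip: to_fls_mult to_fls_uminus)
  also have "P ** (- ?a) ** ?P' = - to_fls F"
    unfolding F by (simp add: matrix_matrix_mult_def vec_eq_iff sum_negf)
  finally show ?thesis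
    unfolding to_fls_uminus[symmetric] to_fls_inject .
qed

text \<open>
  For \<open>h = 1/2\<close>, \<open>p\<close> is the sum of the products of corresponding (complex) spectral projections of
  \<open>f\<close> and \<open>a\<close>.
\<close>

lemma cube_intertwine:
  fixes f a h :: "'a::ring_1"
  assumes f: "f * f * f = - f" and a: "a * a * a = - a" and h: "h * f = f * h"
  defines "p \<equiv> h * (f * f * (a * a) - f * a) + (1 + f * f) * (1 + a * a)"
  shows "f * p = p * a"
proof -
  have h': "f * (h * x) = h * (f * x)" for x using h by (metis mult.assoc)
  show ?thesis
    unfolding p_def using cube_assoc[OF f] cube_assoc[OF a] by (simp add: algebra_simps h')
qed

text \<open>The intertwiner of \<open>cube_intertwine\<close>, formed for F and its own leading
  coefficient a, has constant term 1: for F = a it is the sum of the squares of complementary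
  projections. Hence it is invertible as a power series, and it conjugates a to F.\<close>

lemma cube_imp_conjugate:
  assumes F: "F * F * F = - F" and F0: "fps_nth F 0 = a"
  shows "\<exists>P. invertible P \<and> to_Q F = P ** to_Q (fps_const a) ** matrix_inv P"
proof -
  let ?a = "fps_const a" and ?h = "fps_const ((1/2) *\<^sub>R 1 :: 'a sqmat)"
  have a: "a * a * a = - a"
    using arg_cong[OF F, of "\<lambda>F. fps_nth F 0"] by (simp add: F0)
  have a': "?a * ?a * ?a = - ?a" using a by simp
  have h: "?h * G = G * ?h" for G by (simp add: fps_eq_iff)
  define P where "P = ?h * (F * F * (?a * ?a) - F * ?a) + (1 + F * F) * (1 + ?a * ?a)"
  have FP: "F * P = P * ?a"
    unfolding P_def by (rule cube_intertwine[OF F a' h])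
  have aa: "a * a * (a * a) = - (a * a)"
    using a by (simp add: mult.assoc[symmetric])
  have P0: "fps_nth P 0 = 1"
    using aa by (simp add: P_def F0 algebra_simps scaleR_2[symmetric])
  define P' where "P' = fps_left_inverse P 1"
  have P'P: "P' * P = 1" unfolding P'_def by (rule fps_left_inverse) (simp add: P0)
  have PR: "P * fps_right_inverse P 1 = 1" by (rule fps_right_inverse) (simp add: P0)
  have "P' = P' * (P * fps_right_inverse P 1)" unfolding PR by simp
  also have "\<dots> = fps_right_inverse P 1" unfolding mult.assoc[symmetric] P'P by simp
  finally have "P' = fps_right_inverse P 1" .
  then have PP': "P * P' = 1" using PR by simp
  have inv: "to_fls P ** to_fls P' = mat 1" "to_fls P' ** to_fls P = mat 1"
    using P'P PP' by (simp_all flip: to_fls_mult to_fls_1)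
  have "F = F * P * P'" unfolding mult.assoc PP' by simp
  then have "F = P * ?a * P'" unfolding FP .
  then have "to_Q F = to_fls P ** to_Q ?a ** to_fls P'"
    unfolding to_Q_def fls_smult_mult by (simp add: to_fls_mult)
  moreover have "invertible (to_fls P)" using inv unfolding invertible_def by blast
  ultimately show ?thesis using matrix_inv_eqI[OF inv] by metis
qed

section \<open>Existence and uniqueness of the series of the definition\<close>

lemma Mat_a_mat: "Mat a_mat = pmat (axis None 1 :: real^('m::finite option))"
proof (rule sqmat_option_eqI)
  fix i j :: "'m option"
  show "mat_of (Mat a_mat) $ None $ Some i = mat_of (pmat (axis None 1)) $ None $ Some i"
    "mat_of (Mat a_mat) $ Some i $ None = mat_of (pmat (axis None 1)) $ Some i $ None"
    "mat_of (Mat a_mat) $ Some i $ Some j = mat_of (pmat (axis None 1)) $ Some i $ Some j"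
    by (cases i; simp add: a_mat_def axis_def)+
qed (simp add: a_mat_def)

lemma a_mat_cube: "Mat a_mat * Mat a_mat * Mat a_mat = - Mat a_mat"
  unfolding Mat_a_mat by (rule pmat_cube) simp

text \<open>Dividing by \<lambda> and trading conjugacy for the cubic equation brings the definition
  into the form of \<open>lax_unique\<close>, with leading coefficient constantly a.\<close>

lemma is_Q_seriesD:
  assumes "is_Q_series k Q"
  shows "\<exists>F F'. \<forall>x. Q x = to_Q (F x) \<and> has_coeff_derivative F (F' x) x \<and>
    fps_X * F' x = comm (F x) (lax_pot (k x)) \<and> F x * F x * F x = - F x \<and> fps_nth (F x) 0 = Mat a_mat"
proof -
  define F where "F x = Abs_fps (\<lambda>n. Mat (coeff_mat (Q x) (int n - 1)))" for x
  define F' where "F' x = Abs_fps (\<lambda>n. fps_nth (comm (F x) (lax_pot (k x))) (Suc n))" for x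
  have Q: "Q x = to_Q (F x)" for x
    unfolding F_def using assms by (intro to_Q_surj) (auto simp: is_Q_series_def)
  have der: "((\<lambda>x'. coeff_mat (Q x') i) has_vector_derivative
      - coeff_mat (lax_mat (k x) ** Q x - Q x ** lax_mat (k x)) i) (at x)" for i x
    using assms unfolding is_Q_series_def by blast
  have F0: "fps_nth (F x) 0 = Mat a_mat" for x
    using assms unfolding is_Q_series_def F_def by simp
  have "has_coeff_derivative F (F' x) x" for x
    unfolding has_coeff_derivative_def sqmat_derivative_iff
  proof
    fix n
    have "- mat_of (fps_nth (comm (lax_pot (k x)) (F x)) (Suc n)) = mat_of (fps_nth (F' x) n)"
      unfolding F'_def by (simp add: comm_def)
    then show "((\<lambda>x. mat_of (fps_nth (F x) n)) has_vector_derivative mat_of (fps_nth (F' x) n)) (at x)"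
      using der[of "int n - 1" x] unfolding Q coeff_mat_lax_comm coeff_mat_to_Q
      by (simp add: nat_add_distrib Suc_nat_eq_nat_zadd1 nat_int_add add.commute)
  qed
  moreover have "fps_X * F' x = comm (F x) (lax_pot (k x))" for x
  proof (rule fps_ext)
    fix n show "fps_nth (fps_X * F' x) n = fps_nth (comm (F x) (lax_pot (k x))) n"
      by (cases n) (simp_all add: F'_def comm_def F0 lax_pot_def)
  qed
  moreover have "F x * F x * F x = - F x" for x
  proof -
    obtain P :: "(real fls)^('a option option)^('a option option)"
      where "invertible P" "Q x = P ** a_lambda ** matrix_inv P"
      using assms unfolding is_Q_series_def by blast
    then show ?thesis
      unfolding Q a_lambda_eq using conjugate_imp_cube a_mat_cube by blast
  qed
  ultimately show ?thesis using Q F0 by blast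
qed

lemma is_Q_series_unique:
  assumes "is_Q_series k Q" "is_Q_series k R"
  shows "Q = R"
proof
  fix x
  obtain F F' where F: "\<And>x. Q x = to_Q (F x) \<and> has_coeff_derivative F (F' x) x \<and>
    fps_X * F' x = comm (F x) (lax_pot (k x)) \<and> F x * F x * F x = - F x \<and> fps_nth (F x) 0 = Mat a_mat"
    using is_Q_seriesD[OF assms(1)] by metis
  obtain G G' where G: "\<And>x. R x = to_Q (G x) \<and> has_coeff_derivative G (G' x) x \<and>
    fps_X * G' x = comm (G x) (lax_pot (k x)) \<and> G x * G x * G x = - G x \<and> fps_nth (G x) 0 = Mat a_mat"
    using is_Q_seriesD[OF assms(2)] by metis
  have "F x = G x"
    by (rule lax_unique[where s="\<lambda>x. Mat a_mat" and M=F and N=G and M'=F' and N'=G' and B="\<lambda>x. lax_pot (k x)"])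
      (use F G a_mat_cube in \<open>auto simp: lax_pot_def\<close>)
  then show "Q x = R x" using F G by simp
qed

lemma Q_series_eqI:
  fixes k :: "real \<Rightarrow> real^'m::finite"
  assumes "\<And>x. has_coeff_derivative F (F' x) x"
    and "\<And>x. fps_X * F' x = comm (F x) (lax_pot (k x))"
    and "\<And>x. F x * F x * F x = - F x"
    and F0: "\<And>x. fps_nth (F x) 0 = Mat a_mat"
    and "\<And>x n. even n \<Longrightarrow> \<exists>y \<eta>. mat_of (fps_nth (F x) n) = odd_block y \<eta>"
    and "\<And>x n. odd n \<Longrightarrow> \<exists>z \<xi>. transpose \<xi> = - \<xi> \<and> mat_of (fps_nth (F x) n) = even_block z \<xi>"
  shows "Q_series k x = to_Q (F x)"
proof -
  have "is_Q_series k (\<lambda>x. to_Q (F x))"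
    unfolding is_Q_series_def
  proof (intro allI conjI impI)
    fix x and i :: int
    show "i < - 1 \<Longrightarrow> coeff_mat (to_Q (F x)) i = 0" by (simp add: coeff_mat_to_Q)
    show "coeff_mat (to_Q (F x)) (- 1) = a_mat" by (simp add: coeff_mat_to_Q F0)
    show "0 \<le> i \<Longrightarrow> odd i \<Longrightarrow> \<exists>y \<eta>. coeff_mat (to_Q (F x)) i = odd_block y \<eta>"
      using assms(5)[of "nat (i + 1)" x] by (simp add: coeff_mat_to_Q even_nat_iff)
    show "0 \<le> i \<Longrightarrow> even i \<Longrightarrow> \<exists>z \<xi>. transpose \<xi> = - \<xi> \<and> coeff_mat (to_Q (F x)) i = even_block z \<xi>"
      using assms(6)[of "nat (i + 1)" x] by (simp add: coeff_mat_to_Q even_nat_iff)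
    show "((\<lambda>x'. coeff_mat (to_Q (F x')) i) has_vector_derivative
        - coeff_mat (lax_mat (k x) ** to_Q (F x) - to_Q (F x) ** lax_mat (k x)) i) (at x)"
    proof (cases "i < -1")
      case True
      \<comment> \<open>For i = - 2 the commutator could have a coefficient, namely at
        \<open>\<lambda>\<^sup>2\<close>; it is the commutator of a with itself.\<close>
      have "fps_nth (comm (lax_pot (k x)) (F x)) 0 = 0" by (simp add: comm_def lax_pot_def F0)
      then show ?thesis
        using True unfolding coeff_mat_lax_comm coeff_mat_to_Q by (cases "i = -2") auto
    next
      case False
      define n where "n = nat (i + 1)"
      have n: "nat (i + 2) = Suc n" using False by (simp add: n_def)
      have "fps_nth (F' x) n = fps_nth (comm (F x) (lax_pot (k x))) (Suc n)"
        by (simp flip: assms(2))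
      then have "mat_of (fps_nth (F' x) n) = - mat_of (fps_nth (comm (lax_pot (k x)) (F x)) (Suc n))"
        by (simp add: comm_def)
      moreover have "((\<lambda>x. mat_of (fps_nth (F x) n)) has_vector_derivative mat_of (fps_nth (F' x) n)) (at x)"
        using assms(1)[of x] unfolding has_coeff_derivative_def sqmat_derivative_iff by blast
      ultimately show ?thesis
        using False by (simp add: coeff_mat_lax_comm coeff_mat_to_Q n n_def[symmetric])
    qed
    show "\<exists>P :: (real fls)^('m option option)^('m option option). invertible P \<and> to_Q (F x) = P ** a_lambda ** matrix_inv P"
      unfolding a_lambda_eq using cube_imp_conjugate[OF assms(3) F0] .
  qed
  then have "Q_series k = (\<lambda>x. to_Q (F x))"
    unfolding Q_series_def using is_Q_series_unique by (intro the_equality) auto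
  then show ?thesis by simp
qed

section \<open>The series of a unit speed curve and parallel frames\<close>

definition fps_map :: "('a::zero \<Rightarrow> 'b::zero) \<Rightarrow> 'a fps \<Rightarrow> 'b fps" where
  "fps_map \<phi> F = Abs_fps (\<lambda>n. \<phi> (fps_nth F n))"

lemma has_coeff_derivative_map:
  "bounded_linear \<phi> \<Longrightarrow> has_coeff_derivative F F' x \<Longrightarrow> has_coeff_derivative (\<lambda>x. fps_map \<phi> (F x)) (fps_map \<phi> F') x"
  by (auto simp: has_coeff_derivative_def fps_map_def intro: bounded_linear.has_vector_derivative)

text \<open>The substitution \<lambda> \<mapsto> - \<lambda>.\<close>

definition fps_alt :: "'a::real_vector fps \<Rightarrow> 'a fps" where
  "fps_alt F = Abs_fps (\<lambda>n. (- 1) ^ n *\<^sub>R fps_nth F n)"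

lemma has_coeff_derivative_alt:
  "has_coeff_derivative F F' x \<Longrightarrow> has_coeff_derivative (\<lambda>x. fps_alt (F x)) (fps_alt F') x"
  by (simp add: has_coeff_derivative_def fps_alt_def bounded_linear.has_vector_derivative[OF bounded_linear_scaleR_right])

lemma fps_alt_mult:
  fixes F :: "'a::real_algebra fps"
  shows "fps_alt (F * G) = fps_alt F * fps_alt G"
proof (rule fps_ext)
  fix n
  have "(- 1) ^ n = (- 1) ^ i * (- 1 :: real) ^ (n - i)" if "i \<le> n" for i
    using that by (simp flip: power_add)
  then show "fps_nth (fps_alt (F * G)) n = fps_nth (fps_alt F * fps_alt G) n"
    by (auto simp: fps_alt_def fps_mult_nth scaleR_sum_right intro!: sum.cong)
qed

lemma fps_map_mult:
  fixes \<phi> :: "'a::real_normed_algebra \<Rightarrow> 'b::real_normed_algebra"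
  assumes "bounded_linear \<phi>" "\<And>a b. \<phi> (a * b) = \<phi> a * \<phi> b"
  shows "fps_map \<phi> (F * G) = fps_map \<phi> F * fps_map \<phi> G"
  by (simp add: fps_map_def fps_eq_iff fps_mult_nth linear_sum[OF bounded_linear.linear[OF assms(1)]] assms(2))

lemma fps_map_anti_mult:
  fixes \<phi> :: "'a::real_normed_algebra \<Rightarrow> 'b::real_normed_algebra"
  assumes "bounded_linear \<phi>" "\<And>a b. \<phi> (a * b) = \<phi> b * \<phi> a"
  shows "fps_map \<phi> (F * G) = fps_map \<phi> G * fps_map \<phi> F"
proof (rule fps_ext)
  fix n
  show "fps_nth (fps_map \<phi> (F * G)) n = fps_nth (fps_map \<phi> G * fps_map \<phi> F) n"
    unfolding fps_mult_nth_rev[of "fps_map \<phi> G"]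
    by (simp add: fps_map_def fps_mult_nth[of F] linear_sum[OF bounded_linear.linear[OF assms(1)]] assms(2))
qed

section \<open>Symmetries of the series of a curve\<close>

definition unit_tangent :: "(real \<Rightarrow> real^'n::finite) \<Rightarrow> bool" where
  "unit_tangent T \<longleftrightarrow> smooth_on T UNIV \<and> (\<forall>x. norm (T x) = 1)"

abbreviation curve_ser :: "(real \<Rightarrow> real^'n::finite) \<Rightarrow> real \<Rightarrow> ('n option) sqmat fps" where
  "curve_ser T \<equiv> lax_sol (\<lambda>x. pmat (T x))"

lemma unit_tangent_pmat:
  assumes "unit_tangent T"
  shows "smooth_on (\<lambda>x. pmat (T x)) UNIV" "pmat (T x) * pmat (T x) * pmat (T x) = - pmat (T x)"
  using assms unfolding unit_tangent_def
  by (auto intro: smooth_on_linear[OF open_UNIV bounded_linear_pmat] pmat_cube)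

text \<open>Since S is skew, the negative transpose of M satisfies the same Lax equation, cubic
  equation and initial condition, so it equals M by \<open>lax_unique\<close>.\<close>

lemma curve_ser_skew:
  assumes "unit_tangent T"
  shows "tp (fps_nth (curve_ser T x) n) = - fps_nth (curve_ser T x) n"
proof -
  note T = unit_tangent_pmat[OF assms]
  interpret tp: bounded_linear "tp :: 'a option sqmat \<Rightarrow> _" by (rule bounded_linear_tp)
  let ?M = "curve_ser T" and ?S = "\<lambda>x. fps_const (pmat (T x))" and ?dM = "lax_deriv (\<lambda>x. pmat (T x))"
  let ?N = "\<lambda>x. 0 - fps_map tp (?M x)"
  note mult = fps_map_anti_mult[OF bounded_linear_tp tp_mult]
  have "?N x = ?M x"
  proof (rule lax_unique[where s="\<lambda>x. pmat (T x)" and B="?S" and M'="\<lambda>x. 0 - fps_map tp (?dM x)" and N'="?dM"])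
    fix x
    show "has_coeff_derivative ?N (0 - fps_map tp (?dM x)) x"
      by (intro has_coeff_derivative_diff has_coeff_derivative_const has_coeff_derivative_map bounded_linear_tp lax_deriv T)
    show "?N x * ?N x * ?N x = - ?N x"
    proof -
      have "fps_map tp (?M x * ?M x * ?M x) = fps_map tp (- ?M x)"
        unfolding lax_sol_correct(2)[OF T] ..
      then have "fps_map tp (?M x) * (fps_map tp (?M x) * fps_map tp (?M x)) = - fps_map tp (?M x)"
        unfolding mult by (simp add: fps_map_def fps_eq_iff tp.neg)
      then show ?thesis by (simp add: mult.assoc)
    qed
    show "fps_X * (0 - fps_map tp (?dM x)) = comm (?N x) (?S x)"
    proof (rule fps_ext)
      fix n
      show "fps_nth (fps_X * (0 - fps_map tp (?dM x))) n = fps_nth (comm (?N x) (?S x)) n"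
        by (cases n) (simp_all add: fps_map_def comm_def lax_deriv_def lax_sol_0 tp_pmat tp_mult tp.diff)
    qed
  qed (use T in \<open>auto simp: lax_deriv lax_sol_correct lax_sol_0 fps_map_def tp_pmat\<close>)
  then have "fps_nth (?N x) n = fps_nth (?M x) n" by simp
  then show ?thesis by (simp add: fps_map_def minus_equation_iff)
qed

text \<open>Both \<open>conj_sgn\<close> and \<lambda> \<mapsto> - \<lambda> change the sign of
  \<lambda>S, so applying both to M and negating gives another solution with leading coefficient S,
  which is M by \<open>lax_unique\<close>. Thus even coefficients are off-diagonal for the splitting
  into blocks 1 and n, and odd ones are block diagonal.\<close>

lemma curve_ser_parity:
  assumes "unit_tangent T"
  shows "conj_sgn (fps_nth (curve_ser T x) n) = (- 1) ^ Suc n *\<^sub>R fps_nth (curve_ser T x) n"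
proof -
  note T = unit_tangent_pmat[OF assms]
  interpret cs: bounded_linear "conj_sgn :: 'a option sqmat \<Rightarrow> _" by (rule bounded_linear_conj_sgn)
  let ?M = "curve_ser T" and ?S = "\<lambda>x. fps_const (pmat (T x))" and ?dM = "lax_deriv (\<lambda>x. pmat (T x))"
  let ?\<Phi> = "\<lambda>F. fps_alt (fps_map conj_sgn F)"
  let ?N = "\<lambda>x. 0 - ?\<Phi> (?M x)"
  note mult = fps_map_mult[OF bounded_linear_conj_sgn conj_sgn_mult]
  have "?N x = ?M x"
  proof (rule lax_unique[where s="\<lambda>x. pmat (T x)" and B="?S" and M'="\<lambda>x. 0 - ?\<Phi> (?dM x)" and N'="?dM"])
    fix x
    show "has_coeff_derivative ?N (0 - ?\<Phi> (?dM x)) x"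
      by (intro has_coeff_derivative_diff has_coeff_derivative_const has_coeff_derivative_map has_coeff_derivative_alt
          bounded_linear_conj_sgn lax_deriv T)
    show "?N x * ?N x * ?N x = - ?N x"
    proof -
      have "?\<Phi> (?M x * ?M x * ?M x) = ?\<Phi> (- ?M x)"
        unfolding lax_sol_correct(2)[OF T] ..
      then have "?\<Phi> (?M x) * ?\<Phi> (?M x) * ?\<Phi> (?M x) = - ?\<Phi> (?M x)"
        unfolding mult fps_alt_mult by (simp add: fps_map_def fps_alt_def fps_eq_iff cs.neg)
      then show ?thesis by simp
    qed
    show "fps_X * (0 - ?\<Phi> (?dM x)) = comm (?N x) (?S x)"
    proof (rule fps_ext)
      fix n
      show "fps_nth (fps_X * (0 - ?\<Phi> (?dM x))) n = fps_nth (comm (?N x) (?S x)) n"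
        by (cases n) (simp_all add: fps_map_def fps_alt_def comm_def lax_deriv_def lax_sol_0 conj_sgn_pmat conj_sgn_mult
            cs.diff algebra_simps)
    qed
  qed (use T in \<open>auto simp: lax_deriv lax_sol_correct lax_sol_0 fps_map_def fps_alt_def conj_sgn_pmat\<close>)
  then have eq: "fps_nth (?N x) n = fps_nth (?M x) n" by simp
  then have "- ((- 1) ^ n *\<^sub>R conj_sgn (fps_nth (?M x) n)) = fps_nth (?M x) n"
    by (simp add: fps_map_def fps_alt_def)
  from arg_cong[OF this, of uminus] show ?thesis
    by (cases "even n") simp_all
qed

text \<open>For even n the coefficient of degree n is \<open>pmat\<close> of this vector, by
  \<open>curve_ser_even\<close>. With n = 2m - 2 it is the velocity of the m-th field, see
  \<open>airy_field_eq_vel\<close>.\<close>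

definition vel :: "nat \<Rightarrow> (real \<Rightarrow> real^'n::finite) \<Rightarrow> real \<Rightarrow> real^'n" where
  "vel n T x = (\<chi> i. mat_of (fps_nth (curve_ser T x) n) $ Some i $ None)"

lemma curve_ser_skew_nth:
  assumes "unit_tangent T"
  shows "mat_of (fps_nth (curve_ser T x) n) $ c $ r = - mat_of (fps_nth (curve_ser T x) n) $ r $ c"
  using arg_cong[OF curve_ser_skew[OF assms, of x n], of "\<lambda>a. mat_of a $ r $ c"]
  by (simp add: tp_def transpose_def)

lemma curve_ser_parity_nth:
  assumes "unit_tangent T"
  shows "sgn_opt r * sgn_opt c * mat_of (fps_nth (curve_ser T x) n) $ r $ c
    = (- 1) ^ Suc n * mat_of (fps_nth (curve_ser T x) n) $ r $ c"
  using arg_cong[OF curve_ser_parity[OF assms, of x n], of "\<lambda>a. mat_of a $ r $ c"]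
  by (simp add: conj_sgn_def)

lemma curve_ser_even:
  assumes "unit_tangent T" "even n"
  shows "fps_nth (curve_ser T x) n = pmat (vel n T x)"
proof -
  let ?m = "mat_of (fps_nth (curve_ser T x) n)"
  have "sgn_opt r * sgn_opt c * ?m $ r $ c = - ?m $ r $ c" for r c
    using curve_ser_parity_nth[OF assms(1), of r c x n] assms(2) by simp
  from this[of None None] this[of "Some i" "Some j" for i j]
  have diag: "?m $ None $ None = 0" "?m $ Some i $ Some j = 0" for i j
    by (simp_all add: sgn_opt_def)
  have off: "?m $ None $ Some i = - ?m $ Some i $ None" for i
    using curve_ser_skew_nth[OF assms(1)] .
  show ?thesis
    by (rule sqmat_option_eqI) (simp_all add: vel_def diag off)
qed

section \<open>The gauge transformation by diag(1, g)\<close>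

definition emb :: "real^'n^'n \<Rightarrow> ('n::finite option) sqmat" where
  "emb A = Mat (\<chi> r c. case (r, c) of (Some i, Some j) \<Rightarrow> A $ i $ j | _ \<Rightarrow> 0)"

definition block_diag :: "real^'n^'n \<Rightarrow> ('n::finite option) sqmat" where
  "block_diag A = Mat (\<chi> r c. case (r, c) of (None, None) \<Rightarrow> 1 | (Some i, Some j) \<Rightarrow> A $ i $ j | _ \<Rightarrow> 0)"

lemma emb_nth [simp]:
  "mat_of (emb A) $ None $ c = 0" "mat_of (emb A) $ r $ None = 0" "mat_of (emb A) $ Some i $ Some j = A $ i $ j"
  by (simp_all add: emb_def split: option.splits)

lemma block_diag_nth [simp]:
  "mat_of (block_diag A) $ None $ None = 1" "mat_of (block_diag A) $ None $ Some j = 0"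
  "mat_of (block_diag A) $ Some i $ None = 0" "mat_of (block_diag A) $ Some i $ Some j = A $ i $ j"
  by (simp_all add: block_diag_def)

lemma mat_of_mult_nth:
  fixes a b :: "('n::finite option) sqmat"
  shows "mat_of (a * b) $ r $ c = mat_of a $ r $ None * mat_of b $ None $ c
    + (\<Sum>k\<in>UNIV. mat_of a $ r $ Some k * mat_of b $ Some k $ c)"
  by (simp add: matrix_matrix_mult_def sum_UNIV_option)

lemma block_diag_mult: "block_diag A * block_diag B = block_diag (A ** B)" "block_diag A * emb B = emb (A ** B)"
  by (rule sqmat_option_eqI; simp only: mat_of_mult_nth; simp add: matrix_matrix_mult_def)+

lemma block_diag_mat_1: "block_diag (mat 1) = 1"
  by (rule sqmat_option_eqI) (simp_all add: mat_def)

lemma tp_block_diag: "tp (block_diag A) = block_diag (transpose A)"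
  by (rule sqmat_option_eqI) (simp_all add: tp_def transpose_def)

lemma block_diag_pmat: "block_diag A * pmat v * block_diag (transpose A) = pmat (A *v v)"
  by (rule sqmat_option_eqI; simp only: mat_of_mult_nth)
    (simp_all add: matrix_vector_mult_def transpose_def sum_negf mult.commute)

lemma emb_curvature_mat: "emb (curvature_mat v) = Mat (Psi v)"
proof (rule sqmat_option_eqI)
  fix i j :: "'a option"
  show "mat_of (emb (curvature_mat v)) $ None $ Some i = mat_of (Mat (Psi v)) $ None $ Some i"
    "mat_of (emb (curvature_mat v)) $ Some i $ None = mat_of (Mat (Psi v)) $ Some i $ None"
    "mat_of (emb (curvature_mat v)) $ Some i $ Some j = mat_of (Mat (Psi v)) $ Some i $ Some j"
    by (cases i; cases j; simp add: Psi_def even_block_def curvature_mat_def)+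
qed (simp add: Psi_def even_block_def)

lemma tp_Psi: "tp (Mat (Psi v)) = - Mat (Psi v)"
proof -
  have "tp (emb (curvature_mat v)) = - emb (curvature_mat v)"
  proof (rule sqmat_option_eqI)
    fix i j :: "'a option"
    show "mat_of (tp (emb (curvature_mat v))) $ Some i $ Some j = mat_of (- emb (curvature_mat v)) $ Some i $ Some j"
      by (cases i; cases j) (simp_all add: tp_def transpose_def curvature_mat_def)
  qed (simp_all add: tp_def transpose_def)
  then show ?thesis by (simp add: emb_curvature_mat)
qed

lemma has_vector_derivative_block_diag:
  assumes "(g has_vector_derivative g') (at x)"
  shows "((\<lambda>x. block_diag (g x)) has_vector_derivative emb g') (at (x::real))"
proof -
  have "linear (emb :: real^'n^'n \<Rightarrow> _)"
    by (rule linearI; rule sqmat_option_eqI) simp_all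
  then have "bounded_linear (emb :: real^'n^'n \<Rightarrow> _)" by (simp add: linear_conv_bounded_linear)
  from bounded_linear.has_vector_derivative[OF this assms]
  have "((\<lambda>x. emb (g x) + block_diag 0) has_vector_derivative emb g' + 0) (at x)"
    by (intro has_vector_derivative_add has_vector_derivative_const)
  moreover have "emb (g x) + block_diag 0 = block_diag (g x)" for x
    by (rule sqmat_option_eqI) simp_all
  ultimately show ?thesis by simp
qed

lemma has_vector_derivative_imp_const:
  "(f has_vector_derivative f') (at x) \<Longrightarrow> has_coeff_derivative (\<lambda>x. fps_const (f x)) (fps_const f') x"
  by (simp add: has_coeff_derivative_def)

lemma odd_block_eqI:
  fixes w :: "real^('m::finite option)"
  shows "mat_of (pmat w) = odd_block (w $ None) (\<chi> p. w $ Some p)"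
proof -
  have "pmat w = Mat (odd_block (w $ None) (\<chi> p. w $ Some p))"
  proof (rule sqmat_option_eqI)
    fix i j :: "'m option"
    show "mat_of (pmat w) $ None $ Some i = mat_of (Mat (odd_block (w $ None) (\<chi> p. w $ Some p))) $ None $ Some i"
      "mat_of (pmat w) $ Some i $ None = mat_of (Mat (odd_block (w $ None) (\<chi> p. w $ Some p))) $ Some i $ None"
      "mat_of (pmat w) $ Some i $ Some j = mat_of (Mat (odd_block (w $ None) (\<chi> p. w $ Some p))) $ Some i $ Some j"
      by (cases i; simp add: odd_block_def)+
  qed (simp add: odd_block_def)
  then show ?thesis by (simp add: sqmat_eq_iff)
qed

lemma even_block_eqI:
  fixes a :: "('m::finite option option) sqmat"
  assumes skew: "tp a = - a" and "conj_sgn a = a"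
  shows "\<exists>z \<xi>. transpose \<xi> = - \<xi> \<and> mat_of a = even_block z \<xi>"
proof (intro exI conjI)
  define z :: "real^'m" where "z = (\<chi> i. mat_of a $ Some (Some i) $ Some None)"
  define \<xi> :: "real^'m^'m" where "\<xi> = (\<chi> i j. mat_of a $ Some (Some i) $ Some (Some j))"
  have sk: "mat_of a $ c $ r = - mat_of a $ r $ c" for r c
    using arg_cong[OF skew, of "\<lambda>a. mat_of a $ r $ c"] by (simp add: tp_def transpose_def)
  have par: "sgn_opt r * sgn_opt c * mat_of a $ r $ c = mat_of a $ r $ c" for r c
    using arg_cong[OF assms(2), of "\<lambda>a. mat_of a $ r $ c"] by (simp add: conj_sgn_def)
  have diag: "mat_of a $ r $ r = 0" for r using sk[of r r] by simp
  have off: "mat_of a $ None $ Some i = 0" "mat_of a $ Some i $ None = 0" for i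
    using par[of None "Some i"] par[of "Some i" None] by (simp_all add: sgn_opt_def)
  show "transpose \<xi> = - \<xi>"
    unfolding vec_eq_iff
  proof (intro allI)
    fix i j
    show "transpose \<xi> $ i $ j = (- \<xi>) $ i $ j"
      using sk[of "Some (Some i)" "Some (Some j)"] by (simp add: \<xi>_def transpose_def)
  qed
  have "a = Mat (even_block z \<xi>)"
  proof (rule sqmat_option_eqI)
    fix i j :: "'m option"
    show "mat_of a $ None $ Some i = mat_of (Mat (even_block z \<xi>)) $ None $ Some i"
      "mat_of a $ Some i $ None = mat_of (Mat (even_block z \<xi>)) $ Some i $ None"
      by (simp_all add: even_block_def off split: option.splits)
    have "mat_of a $ Some None $ Some (Some i) = - mat_of a $ Some (Some i) $ Some None" for i
      by (rule sk)
    then show "mat_of a $ Some i $ Some j = mat_of (Mat (even_block z \<xi>)) $ Some i $ Some j"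
      by (cases i; cases j) (simp_all add: even_block_def z_def \<xi>_def diag)
  qed (simp add: even_block_def diag)
  then show "mat_of a = even_block z \<xi>" by (metis mat_of_Mat)
qed

lemma parallel_frameD:
  assumes "parallel_frame \<gamma> g k"
  shows "(g has_vector_derivative g x ** curvature_mat (k x)) (at x)"
    and "transpose (g x) ** g x = mat 1" "g x ** transpose (g x) = mat 1"
    and "vector_derivative \<gamma> (at x) = g x *v axis None 1"
proof -
  have "orthogonal_matrix (g x)" using assms by (simp add: parallel_frame_def rotation_matrix_def)
  then show o: "transpose (g x) ** g x = mat 1" "g x ** transpose (g x) = mat 1"
    by (simp_all add: orthogonal_matrix_def)
  then have "invertible (g x)" unfolding invertible_def by blast
  then have "vector_derivative g (at x) = g x ** (matrix_inv (g x) ** vector_derivative g (at x))"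
    by (simp add: matrix_mul_assoc matrix_inv_mult)
  also have "\<dots> = g x ** curvature_mat (k x)" using assms by (simp add: parallel_frame_def)
  finally show "(g has_vector_derivative g x ** curvature_mat (k x)) (at x)"
    using smooth_on_real_has_vector_derivative[of g UNIV x] assms by (simp add: parallel_frame_def)
  show "vector_derivative \<gamma> (at x) = g x *v axis None 1"
    using assms by (simp add: parallel_frame_def matrix_vector_mult_basis)
qed

text \<open>The gauge transformation by \<open>diag(1, g)\<close> removes the curvature from the Lax operator.\<close>

lemma Q_series_frame:
  fixes \<gamma> :: "real \<Rightarrow> real^('m::finite option)"
  assumes pf: "parallel_frame \<gamma> g k" and T: "unit_tangent T" and T_eq: "\<And>x. T x = vector_derivative \<gamma> (at x)"
  shows "Q_series k x = to_Q (fps_const (tp (block_diag (g x))) * curve_ser T x * fps_const (block_diag (g x)))"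
proof (rule Q_series_eqI)
  define u where "u x = Mat (Psi (k x))" for x
  define G where "G x = block_diag (g x)" for x
  let ?M = "curve_ser T" and ?dM = "lax_deriv (\<lambda>x. pmat (T x))"
  let ?c = "fps_const :: 'm option option sqmat \<Rightarrow> _"
  define F where "F x = ?c (tp (G x)) * ?M x * ?c (G x)" for x
  \<comment> \<open>Since \<open>G\<^sub>x = G u\<close> with u skew, differentiating the two outer
    factors of F gives [F, u], and the middle factor gives the conjugate of
    \<open>M\<^sub>x\<close>.\<close>
  define F' where "F' x = comm (F x) (?c (u x)) + ?c (tp (G x)) * ?dM x * ?c (G x)" for x
  note S = unit_tangent_pmat[OF T]
  have G': "(G has_vector_derivative G x * u x) (at x)" for x
    using has_vector_derivative_block_diag[OF parallel_frameD(1)[OF pf, of x]]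
    by (simp add: G_def[abs_def] u_def block_diag_mult emb_curvature_mat flip: block_diag_mult(2))
  have "((\<lambda>x. tp (G x)) has_vector_derivative tp (G x * u x)) (at x)" for x
    by (rule bounded_linear.has_vector_derivative[OF bounded_linear_tp G'])
  then have tpG': "((\<lambda>x. tp (G x)) has_vector_derivative - u x * tp (G x)) (at x)" for x
    by (simp add: tp_mult u_def tp_Psi)
  have GG: "tp (G x) * G x = 1" "G x * tp (G x) = 1" for x
    using parallel_frameD(2,3)[OF pf, of x] by (simp_all add: G_def tp_block_diag block_diag_mult block_diag_mat_1)
  have cGG: "?c (G x) * (?c (tp (G x)) * H) = H" for x H
    unfolding mult.assoc[symmetric] fps_const_mult GG by simp
  \<comment> \<open>The frame maps the first basis vector to the tangent, so undoing it takes S back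
    to a.\<close>
  have S_eq: "tp (G x) * pmat (T x) * G x = Mat a_mat" for x
  proof -
    have "G x * Mat a_mat * tp (G x) = pmat (T x)"
      unfolding G_def tp_block_diag Mat_a_mat block_diag_pmat T_eq parallel_frameD(4)[OF pf] ..
    from this[symmetric] have "tp (G x) * pmat (T x) * G x = (tp (G x) * G x) * Mat a_mat * (tp (G x) * G x)"
      by (simp only: mult.assoc)
    then show ?thesis by (simp add: GG)
  qed
  fix x
  show "has_coeff_derivative (\<lambda>x. ?c (tp (block_diag (g x))) * ?M x * ?c (block_diag (g x))) (F' x) x"
  proof -
    have "has_coeff_derivative F
        ((?c (- u x * tp (G x)) * ?M x + ?c (tp (G x)) * ?dM x) * ?c (G x) + ?c (tp (G x)) * ?M x * ?c (G x * u x)) x"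
      unfolding F_def[abs_def]
      by (intro has_coeff_derivative_mult has_vector_derivative_imp_const G' tpG' lax_deriv(1)[OF S])
    moreover have "(?c (- u x * tp (G x)) * ?M x + ?c (tp (G x)) * ?dM x) * ?c (G x) + ?c (tp (G x)) * ?M x * ?c (G x * u x) = F' x"
      unfolding F'_def F_def comm_def by (simp add: algebra_simps flip: fps_const_mult fps_const_neg)
    ultimately show ?thesis by (simp add: F_def[abs_def] G_def)
  qed
  show "fps_X * F' x = comm (?c (tp (block_diag (g x))) * ?M x * ?c (block_diag (g x))) (lax_pot (k x))"
  proof -
    have "fps_X * (?c (tp (G x)) * ?dM x * ?c (G x)) = ?c (tp (G x)) * comm (?M x) (?c (pmat (T x))) * ?c (G x)"
      unfolding lax_deriv(2)[OF S, symmetric] by (simp add: mult.assoc fps_X_assoc)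
    also have "\<dots> = ?c (tp (G x)) * ?M x * ?c (G x) * ?c (tp (G x) * pmat (T x) * G x)
        - ?c (tp (G x) * pmat (T x) * G x) * (?c (tp (G x)) * ?M x * ?c (G x))"
      by (simp add: comm_def right_diff_distrib left_diff_distrib mult.assoc cGG flip: fps_const_mult)
    finally have "fps_X * (?c (tp (G x)) * ?dM x * ?c (G x)) = comm (F x) (?c (Mat a_mat))"
      unfolding S_eq F_def comm_def .
    then have "fps_X * F' x = fps_X * comm (F x) (?c (u x)) + comm (F x) (?c (Mat a_mat))"
      by (simp add: F'_def distrib_left)
    also have "\<dots> = comm (F x) (lax_pot (k x))"
      unfolding comm_def lax_pot_def u_def[symmetric]
      by (simp add: distrib_left distrib_right right_diff_distrib fps_X_assoc mult.assoc)
    finally show ?thesis by (simp add: F_def G_def)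
  qed
  have F: "?c (tp (block_diag (g x))) * ?M x * ?c (block_diag (g x)) = F x" for x by (simp add: F_def G_def)
  have nth: "fps_nth (F x) n = tp (G x) * fps_nth (?M x) n * G x" for n
    by (simp add: F_def)
  show "?c (tp (block_diag (g x))) * ?M x * ?c (block_diag (g x)) * (?c (tp (block_diag (g x))) * ?M x * ?c (block_diag (g x)))
     * (?c (tp (block_diag (g x))) * ?M x * ?c (block_diag (g x))) = - (?c (tp (block_diag (g x))) * ?M x * ?c (block_diag (g x)))"
  proof -
    have "F x * F x * F x = ?c (tp (G x)) * (?M x * ?M x * ?M x) * ?c (G x)"
      by (simp add: F_def mult.assoc cGG)
    then show ?thesis unfolding F lax_sol_correct(2)[OF S] by (simp add: F_def)
  qed
  show "fps_nth (?c (tp (block_diag (g x))) * ?M x * ?c (block_diag (g x))) 0 = Mat a_mat"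
    unfolding F nth lax_sol_0 S_eq ..
  fix n
  show "\<exists>y \<eta>. mat_of (fps_nth (?c (tp (block_diag (g x))) * ?M x * ?c (block_diag (g x))) n) = odd_block y \<eta>" if "even n"
  proof -
    have "fps_nth (F x) n = pmat (transpose (g x) *v vel n T x)"
      unfolding nth curve_ser_even[OF T that] G_def tp_block_diag
      using block_diag_pmat[of "transpose (g x)"] by (simp add: transpose_transpose)
    then show ?thesis unfolding F using odd_block_eqI by metis
  qed
  show "\<exists>z \<xi>. transpose \<xi> = - \<xi> \<and> mat_of (fps_nth (?c (tp (block_diag (g x))) * ?M x * ?c (block_diag (g x))) n) = even_block z \<xi>"
    if "odd n"
    unfolding F
  proof (rule even_block_eqI)
    have "tp (tp a) = a" for a :: "'m option option sqmat" by (simp add: tp_def transpose_transpose mat_of_inverse)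
    then show "tp (fps_nth (F x) n) = - fps_nth (F x) n"
      unfolding nth tp_mult curve_ser_skew[OF T] by (simp add: mult.assoc)
    have "conj_sgn (block_diag A) = block_diag A" for A :: "real^'m option^'m option"
      by (rule sqmat_option_eqI) (simp_all add: conj_sgn_def sgn_opt_def)
    then show "conj_sgn (fps_nth (F x) n) = fps_nth (F x) n"
      unfolding nth conj_sgn_mult curve_ser_parity[OF T] G_def tp_block_diag using that by simp
  qed
qed

text \<open>Conjugation by diag(1, g) acts on embedded vectors as the transpose of g. So y and
  \<eta> are the coordinates, with respect to the frame, of a vector that depends on the curve
  alone; this is the independence of the frame. The index n - 1 reflects the factor \<lambda> of
  \<open>to_Q\<close>.\<close>

lemma frame_coeffs:
  fixes \<gamma> :: "real \<Rightarrow> real^('m::finite option)"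
  assumes pf: "parallel_frame \<gamma> g k" and T: "unit_tangent T" and T_eq: "\<And>x. T x = vector_derivative \<gamma> (at x)"
    and n: "even n"
  shows "y_coeff (int n - 1) k x = (transpose (g x) *v vel n T x) $ None"
    and "eta_coeff (int n - 1) k x $ p = (transpose (g x) *v vel n T x) $ Some p"
proof -
  have "coeff_mat (Q_series k x) (int n - 1) = mat_of (pmat (transpose (g x) *v vel n T x))"
    unfolding Q_series_frame[OF assms(1-3)] coeff_mat_to_Q
    using block_diag_pmat[of "transpose (g x)"] by (simp add: curve_ser_even[OF T n] tp_block_diag transpose_transpose del: mat_of_simps)
  then show "y_coeff (int n - 1) k x = (transpose (g x) *v vel n T x) $ None"
    "eta_coeff (int n - 1) k x $ p = (transpose (g x) *v vel n T x) $ Some p"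
    by (simp_all add: y_coeff_def eta_coeff_def)
qed

lemma airy_rhs_eq_vel:
  fixes \<gamma> :: "real \<Rightarrow> real^('m::finite option)"
  assumes pf: "parallel_frame \<gamma> g k" and T: "unit_tangent T" and T_eq: "\<And>x. T x = vector_derivative \<gamma> (at x)"
    and m: "1 \<le> m"
  shows "airy_rhs m g k x = vel (2 * m - 2) T x"
proof -
  let ?w = "transpose (g x) *v vel (2 * m - 2) T x"
  have idx: "2 * int m - 3 = int (2 * m - 2) - 1" using m by simp
  have "even (2 * m - 2)" by simp
  note co = frame_coeffs[OF pf T T_eq this, of x]
  have "airy_rhs m g k x = (\<Sum>c\<in>UNIV. ?w $ c *\<^sub>R column c (g x))"
    unfolding airy_rhs_def idx sum_UNIV_option using co by simp
  also have "\<dots> = g x *v ?w"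
    unfolding matrix_mult_sum[of "g x" ?w] by (simp add: scalar_mult_eq_scaleR)
  finally show ?thesis
    unfolding matrix_vector_mul_assoc parallel_frameD(3)[OF pf] matrix_vector_mul_lid .
qed

lemma y_coeff_eq_inner_vel:
  fixes \<gamma> :: "real \<Rightarrow> real^('m::finite option)"
  assumes pf: "parallel_frame \<gamma> g k" and T: "unit_tangent T" and T_eq: "\<And>x. T x = vector_derivative \<gamma> (at x)"
  shows "y_coeff (2 * int l - 1) k x = vel (2 * l) T x \<bullet> T x"
proof -
  have "y_coeff (2 * int l - 1) k x = (transpose (g x) *v vel (2 * l) T x) $ None"
    using frame_coeffs(1)[OF assms, of "2 * l" x] by simp
  also have "\<dots> = (transpose (g x) *v vel (2 * l) T x) \<bullet> axis None 1"
    by (simp add: inner_axis)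
  also have "\<dots> = vel (2 * l) T x \<bullet> (g x *v axis None 1)"
    by (simp add: dot_lmul_matrix)
  finally show ?thesis using T_eq parallel_frameD(4)[OF pf] by simp
qed

section \<open>Antiderivatives and linear differential equations\<close>

text \<open>The oriented integral from 0 to x for both signs of x: one of the two intervals is empty
  or a point.\<close>

definition antideriv :: "(real \<Rightarrow> 'a::banach) \<Rightarrow> real \<Rightarrow> 'a" where
  "antideriv f x = integral {0..x} f - integral {x..0} f"

lemma antideriv_0: "antideriv f 0 = 0"
  by (simp add: antideriv_def)

lemma antideriv_has_vector_derivative:
  assumes "continuous_on UNIV f"
  shows "(antideriv f has_vector_derivative f x) (at x)"
proof -
  define c where "c = min 0 x - 1"
  have c0: "c \<le> 0" "c < x" by (auto simp: c_def)
  have cont: "continuous_on S f" for S using assms continuous_on_subset by blast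
  have int: "f integrable_on {a..b}" for a b
    using integrable_continuous_interval[OF cont] .
  have eq: "integral {c..y} f - integral {c..0} f = antideriv f y" if "c < y" for y
  proof (cases "0 \<le> y")
    case True
    then show ?thesis
      using Henstock_Kurzweil_Integration.integral_combine[OF _ True int, of c] by (cases "y = 0") (auto simp: antideriv_def c0 algebra_simps)
  next
    case False
    then show ?thesis
      using Henstock_Kurzweil_Integration.integral_combine[OF _ _ int, of c y 0] that by (auto simp: antideriv_def algebra_simps)
  qed
  have "((\<lambda>y. integral {c..y} f) has_vector_derivative f x) (at x within {c..x+1})"
    by (rule integral_has_vector_derivative[OF cont]) (auto simp: c_def)
  then have "((\<lambda>y. integral {c..y} f) has_vector_derivative f x) (at x)"
    by (subst (asm) at_within_interior) (auto simp: interior_atLeastAtMost_real c_def)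
  then have "((\<lambda>y. integral {c..y} f - integral {c..0} f) has_vector_derivative f x) (at x)"
    using has_vector_derivative_diff[OF _ has_vector_derivative_const] by fastforce
  then show ?thesis
    by (rule has_vector_derivative_transform_within_open[where S="{c<..}"]) (auto simp: eq c0)
qed

lemma has_vector_derivative_zero_imp_eq:
  fixes f :: "real \<Rightarrow> 'a::real_normed_vector"
  assumes "\<And>x. (f has_vector_derivative 0) (at x)"
  shows "f x = f y"
  by (rule has_derivative_zero_unique[of UNIV f x y]) (use assms in \<open>auto simp: has_vector_derivative_def\<close>)

lemma antideriv_eqI:
  assumes "\<And>x. (F has_vector_derivative f x) (at x)" "continuous_on UNIV f"
  shows "antideriv f x = F x - F 0"
proof -
  have "((\<lambda>x. antideriv f x - F x) has_vector_derivative f x - f x) (at x)" for x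
    by (intro has_vector_derivative_diff antideriv_has_vector_derivative assms)
  then have "antideriv f x - F x = antideriv f 0 - F 0"
    by (intro has_vector_derivative_zero_imp_eq) simp
  then show ?thesis by (simp add: antideriv_0 algebra_simps)
qed

text \<open>The majorant is taken at the absolute value of the argument, so a single antiderivative
  serves both half-lines.\<close>

lemma norm_antideriv_le:
  assumes f: "continuous_on UNIV f" and \<phi>: "\<And>y. (\<phi> has_vector_derivative g y) (at y)"
    and bound: "\<And>y. \<bar>y\<bar> \<le> \<bar>x\<bar> \<Longrightarrow> norm (f y) \<le> g \<bar>y\<bar>"
  shows "norm (antideriv f x) \<le> \<phi> \<bar>x\<bar> - \<phi> (0::real)"
proof -
  have int: "f integrable_on {a..b}" for a b
    by (rule integrable_continuous_interval[OF continuous_on_subset[OF f]]) simp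
  show ?thesis
  proof (cases "0 \<le> x")
    case True
    have "(g has_integral (\<phi> x - \<phi> 0)) {0..x}"
      by (intro fundamental_theorem_of_calculus has_vector_derivative_at_within[OF \<phi>] True)
    moreover have "norm (integral {0..x} f) \<le> integral {0..x} g"
    proof (intro integral_norm_bound_integral int)
      show "norm (f y) \<le> g y" if "y \<in> {0..x}" for y using bound[of y] that by auto
    qed (use calculation in blast)
    moreover have "antideriv f x = integral {0..x} f"
      using True by (cases "x = 0") (simp_all add: antideriv_def)
    ultimately show ?thesis using True by (simp add: integral_unique)
  next
    case False
    have "((\<lambda>y. - \<phi> (- y)) has_vector_derivative g (- y)) (at y)" for y
    proof -
      have "((\<lambda>y. - y) has_vector_derivative (- 1 :: real)) (at y)"
        by (auto intro!: derivative_eq_intros)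
      from has_vector_derivative_minus[OF vector_diff_chain_at[OF this \<phi>]] show ?thesis by (simp add: o_def)
    qed
    from has_vector_derivative_at_within[OF this]
    have "((\<lambda>y. g (- y)) has_integral (- \<phi> (- 0) - - \<phi> (- x))) {x..0}"
      using False by (intro fundamental_theorem_of_calculus) auto
    moreover have "norm (integral {x..0} f) \<le> integral {x..0} (\<lambda>y. g (- y))"
    proof (intro integral_norm_bound_integral int)
      show "norm (f y) \<le> g (- y)" if "y \<in> {x..0}" for y using bound[of y] that by auto
    qed (use calculation in blast)
    moreover have "antideriv f x = - integral {x..0} f"
      using False by (simp add: antideriv_def)
    ultimately show ?thesis using False by (simp add: integral_unique)
  qed
qed

lemma antideriv_has_vector_derivative_param:
  fixes f :: "real \<times> real \<Rightarrow> 'a::banach"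
  assumes I: "open I" and f: "smooth_on f (I \<times> UNIV)" and t: "t \<in> I"
  shows "((\<lambda>s. antideriv (\<lambda>x. f (s, x)) x) has_vector_derivative antideriv (\<lambda>x. partial_t f (t, x)) x) (at t)"
proof -
  obtain e where e: "e > 0" "ball t e \<subseteq> I" using I t openE by blast
  have "((\<lambda>s. integral {a..b} (\<lambda>x. f (s, x))) has_vector_derivative integral {a..b} (\<lambda>x. partial_t f (t, x))) (at t)" for a b
  proof -
    have "((\<lambda>s. integral (cbox a b) (\<lambda>x. f (s, x))) has_vector_derivative
        integral (cbox a b) (\<lambda>x. partial_t f (t, x))) (at t within ball t e)"
    proof (rule leibniz_rule_vector_derivative[where fx="\<lambda>s x. partial_t f (s, x)"])
      fix s x assume "s \<in> ball t e"
      then have s: "s \<in> I" using e by blast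
      then show "((\<lambda>s. f (s, x)) has_vector_derivative partial_t f (s, x)) (at s within ball t e)"
        by (intro has_vector_derivative_at_within[OF has_vector_derivative_partial_t[OF f]]) auto
      have "continuous_on UNIV (\<lambda>x. f (s, x))"
        by (rule smooth_on_imp_continuous_on[OF smooth_on_slice[OF I f s]])
      then show "(\<lambda>x. f (s, x)) integrable_on cbox a b"
        by (intro integrable_continuous) (rule continuous_on_subset, auto)
    next
      show "continuous_on (ball t e \<times> cbox a b) (\<lambda>(s, x). partial_t f (s, x))"
        unfolding case_prod_unfold prod.collapse
        by (rule continuous_on_subset[OF smooth_on_imp_continuous_on[OF smooth_on_partial_t[OF f]]]) (use e in auto)
    qed (use e in auto)
    then show ?thesis
      using e by (subst (asm) at_within_open) (auto simp: cbox_interval)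
  qed
  then show ?thesis unfolding antideriv_def by (intro has_vector_derivative_diff)
qed

text \<open>In direction (h, k) the derivative is h times the antiderivative of the time derivative
  of f plus k times f. The first term has the original form with another smooth integrand, so
  induction on the order applies.\<close>

lemma smooth_on_antideriv:
  fixes f :: "real \<times> real \<Rightarrow> 'a::banach"
  assumes I: "open I" and f: "smooth_on f (I \<times> UNIV)"
  shows "smooth_on (\<lambda>p. antideriv (\<lambda>x. f (fst p, x)) (snd p)) (I \<times> UNIV)"
proof -
  have U: "open (I \<times> (UNIV :: real set))" using I by (simp add: open_Times)
  have der: "((\<lambda>p. antideriv (\<lambda>x. f (fst p, x)) (snd p)) has_derivative
      (\<lambda>v. fst v *\<^sub>R antideriv (\<lambda>x. partial_t f (fst p, x)) (snd p) + snd v *\<^sub>R f p)) (at p)"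
    if f: "smooth_on f (I \<times> UNIV)" and p: "p \<in> I \<times> UNIV" for f :: "real \<times> real \<Rightarrow> 'a" and p
  proof -
    obtain t x where tx: "p = (t, x)" "t \<in> I" using p by auto
    obtain e where e: "e > 0" "ball t e \<subseteq> I" using I tx openE by blast
    have B: "blinfun_apply (blinfun_scaleR_left v) = (\<lambda>h. h *\<^sub>R v)" for v :: 'a by auto
    have "((\<lambda>(s, x). antideriv (\<lambda>x. f (s, x)) x) has_derivative
      (\<lambda>(h, k). h *\<^sub>R antideriv (\<lambda>x. partial_t f (t, x)) x + blinfun_scaleR_left (f (t, x)) k)) (at (t, x) within ball t e \<times> UNIV)"
    proof (rule has_derivative_partialsI[where fy="\<lambda>s x. blinfun_scaleR_left (f (s, x))"])
      show "((\<lambda>s. antideriv (\<lambda>x. f (s, x)) x) has_derivative (\<lambda>h. h *\<^sub>R antideriv (\<lambda>x. partial_t f (t, x)) x)) (at t within ball t e)"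
        using antideriv_has_vector_derivative_param[OF I f tx(2)]
        unfolding has_vector_derivative_def by (rule has_derivative_at_withinI)
      fix s y assume "s \<in> ball t e"
      then have "s \<in> I" using e by blast
      from antideriv_has_vector_derivative[OF smooth_on_imp_continuous_on[OF smooth_on_slice[OF I f this]], of y]
      show "(antideriv (\<lambda>x. f (s, x)) has_derivative blinfun_apply (blinfun_scaleR_left (f (s, y)))) (at y within UNIV)"
        unfolding has_vector_derivative_def B by simp
    next
      have "continuous_on (I \<times> UNIV) (\<lambda>q. blinfun_scaleR_left (f q))"
        by (intro continuous_intros smooth_on_imp_continuous_on f)
      then have "isCont (\<lambda>q. blinfun_scaleR_left (f q)) (t, x)"
        using U tx by (simp add: continuous_on_eq_continuous_at)
      then show "continuous (at (t, x) within ball t e \<times> UNIV) (\<lambda>(s, x). blinfun_scaleR_left (f (s, x)))"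
        unfolding case_prod_unfold prod.collapse by (rule continuous_at_imp_continuous_at_within)
    qed auto
    then have "((\<lambda>(s, x). antideriv (\<lambda>x. f (s, x)) x) has_derivative
      (\<lambda>(h, k). h *\<^sub>R antideriv (\<lambda>x. partial_t f (t, x)) x + blinfun_scaleR_left (f (t, x)) k)) (at (t, x))"
      using e by (subst (asm) at_within_open) (auto intro: open_Times)
    then show ?thesis
      by (simp add: tx case_prod_unfold)
  qed
  have "Ck_on k (\<lambda>p. antideriv (\<lambda>x. f (fst p, x)) (snd p)) (I \<times> UNIV)"
    if f: "smooth_on f (I \<times> UNIV)" for k and f :: "real \<times> real \<Rightarrow> 'a"
    using f
  proof (induction k arbitrary: f)
    case 0
    then show ?case
      using der[OF 0] by (auto intro!: continuous_at_imp_continuous_on has_derivative_continuous)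
  next
    case (Suc k)
    show ?case
    proof (rule Ck_onI[OF der[OF Suc.prems] _ U])
      fix v :: "real \<times> real"
      have "Ck_on k f (I \<times> UNIV)" using Suc.prems by (simp add: smooth_on_def)
      then show "Ck_on k (\<lambda>p. fst v *\<^sub>R antideriv (\<lambda>x. partial_t f (fst p, x)) (snd p) + snd v *\<^sub>R f p) (I \<times> UNIV)"
        using Suc.IH[OF smooth_on_partial_t[OF Suc.prems]]
        by (intro Ck_on_add[OF U] Ck_on_linear[OF U bounded_linear_scaleR_right])
    qed
  qed
  then show ?thesis using f unfolding smooth_on_def by blast
qed

section \<open>Linear differential equations by iterated integrals\<close>

primrec picard :: "(real \<Rightarrow> 'a::{real_normed_algebra_1, banach}) \<Rightarrow> nat \<Rightarrow> real \<Rightarrow> 'a" where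
  "picard K 0 = (\<lambda>x. 1)"
| "picard K (Suc n) = antideriv (\<lambda>x. K x * picard K n x)"

lemma picard_continuous:
  assumes "continuous_on UNIV K"
  shows "continuous_on UNIV (picard K n)"
proof (induction n)
  case (Suc n)
  then have "continuous_on UNIV (\<lambda>x. K x * picard K n x)"
    by (intro continuous_on_mult assms)
  from antideriv_has_vector_derivative[OF this] show ?case
    by (auto intro!: continuous_at_imp_continuous_on has_vector_derivative_continuous)
qed simp

lemma picard_deriv:
  assumes "continuous_on UNIV K"
  shows "(picard K (Suc n) has_vector_derivative K x * picard K n x) (at x)"
  using antideriv_has_vector_derivative[OF continuous_on_mult[OF assms picard_continuous[OF assms]]] by simp

lemma picard_bound:
  fixes K :: "real \<Rightarrow> 'a::{real_normed_algebra_1, banach}"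
  assumes K: "continuous_on UNIV K" and C: "\<And>x. \<bar>x\<bar> \<le> R \<Longrightarrow> norm (K x) \<le> C"
  shows "\<bar>x\<bar> \<le> R \<Longrightarrow> norm (picard K n x) \<le> (C * \<bar>x\<bar>) ^ n / fact n"
proof (induction n arbitrary: x)
  case (Suc n)
  have "0 \<le> C" using C[of 0] Suc.prems norm_ge_zero[of "K 0"] by linarith
  define \<phi> where "\<phi> y = (C * y) ^ Suc n / fact (Suc n)" for y
  have \<phi>': "(\<phi> has_vector_derivative C * ((C * y) ^ n / fact n)) (at y)" for y
  proof -
    have "((\<lambda>y. C * y) has_real_derivative C) (at y)"
      by (auto intro!: derivative_eq_intros)
    from DERIV_cdivide[OF DERIV_power_Suc[OF this, of n], of "fact (Suc n)"]
    have "(\<phi> has_real_derivative (1 + real n) * (C * (C * y) ^ n) / fact (Suc n)) (at y)"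
      by (simp only: \<phi>_def[abs_def])
    moreover have "(1 + real n) * (C * (C * y) ^ n) / fact (Suc n) = C * ((C * y) ^ n / fact n)"
      unfolding fact_Suc of_nat_Suc by (subst mult_divide_mult_cancel_left) auto
    ultimately show ?thesis by (simp add: has_real_derivative_iff_has_vector_derivative)
  qed
  have bound: "norm (K y * picard K n y) \<le> C * ((C * \<bar>y\<bar>) ^ n / fact n)" if "\<bar>y\<bar> \<le> R" for y
    using norm_mult_ineq[of "K y" "picard K n y"] mult_mono[OF C[OF that] Suc.IH[OF that] \<open>0 \<le> C\<close> norm_ge_zero]
    by linarith
  have "norm (antideriv (\<lambda>x. K x * picard K n x) x) \<le> \<phi> \<bar>x\<bar> - \<phi> 0"
    by (rule norm_antideriv_le[OF continuous_on_mult[OF K picard_continuous[OF K]] \<phi>'])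
      (use bound Suc.prems in auto)
  then show ?case by (simp add: \<phi>_def)
qed simp

text \<open>The series of iterated integrals is differentiated term by term. As K need not be
  bounded on the line, this is done around each x on [-R, R] with R = |x| + 1, where the exponential
  series is a majorant for terms and derivatives. The result takes the value 1 at 0, and right
  multiplication by \<open>g0\<close> adjusts it.\<close>

lemma linear_ode_exists:
  fixes K :: "real \<Rightarrow> 'a::{real_normed_algebra_1, banach}"
  assumes K: "continuous_on UNIV K"
  shows "\<exists>g. g 0 = g0 \<and> (\<forall>x. (g has_vector_derivative K x * g x) (at x))"
proof -
  define u where "u x = (\<Sum>n. picard K n x)" for x
  have summ: "summable (\<lambda>n. picard K n x)" and u': "(u has_vector_derivative K x * u x) (at x)" for x
  proof -
    define R where "R = \<bar>x\<bar> + 1"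
    let ?S = "{- R..R}"
    have "bounded (K ` ?S)"
      by (intro compact_imp_bounded compact_continuous_image continuous_on_subset[OF K]) auto
    then obtain C where "\<forall>y\<in>?S. norm (K y) \<le> C" unfolding bounded_iff by blast
    then have C: "norm (K y) \<le> C" if "\<bar>y\<bar> \<le> R" for y using that by (simp add: abs_le_iff)
    have "0 \<le> C" by (rule order.trans[OF norm_ge_zero C[of 0]]) (simp add: R_def)
    define b where "b n = (C * R) ^ n / fact n" for n
    have "summable (\<lambda>n. inverse (fact n) * (C * R) ^ n)" by (rule summable_exp)
    then have b: "summable b" unfolding b_def by (simp add: field_simps)
    have bound: "norm (picard K n y) \<le> b n" if "\<bar>y\<bar> \<le> R" for n y
    proof -
      have "(C * \<bar>y\<bar>) ^ n / fact n \<le> b n"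
        unfolding b_def using that \<open>0 \<le> C\<close> by (intro divide_right_mono power_mono mult_left_mono) auto
      then show ?thesis using picard_bound[OF K C that, of n] by linarith
    qed
    have summ: "summable (\<lambda>n. picard K n y)" if "\<bar>y\<bar> \<le> R" for y
      using summable_comparison_test'[OF b bound[OF that]] .
    define f' where "f' n y = (case n of 0 \<Rightarrow> 0 | Suc m \<Rightarrow> K y * picard K m y)" for n y
    have d: "(picard K n has_vector_derivative f' n y) (at y)" for n y
      by (cases n) (simp_all add: f'_def picard_deriv[OF K] del: picard.simps(2))
    \<comment> \<open>The truncated index n - 1 is harmless at n = 0, because the term
      \<open>f' 0\<close> is 0.\<close>
    have "summable (\<lambda>n. C * b (n - 1))"
      using b by (intro summable_mult) (subst summable_Suc_iff[symmetric], simp)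
    moreover have "norm (f' n y) \<le> C * b (n - 1)" if "y \<in> ?S" for n y
    proof (cases n)
      case 0
      then show ?thesis using \<open>0 \<le> C\<close> by (simp add: f'_def b_def)
    next
      case (Suc m)
      have y: "\<bar>y\<bar> \<le> R" using that by auto
      show ?thesis
        using Suc norm_mult_ineq[of "K y" "picard K m y"] mult_mono[OF C[OF y] bound[OF y] \<open>0 \<le> C\<close> norm_ge_zero, of m]
        by (simp add: f'_def)
    qed
    ultimately have unif: "uniform_limit ?S (\<lambda>n y. \<Sum>i<n. f' i y) (\<lambda>y. \<Sum>i. f' i y) sequentially"
      by (intro Weierstrass_m_test)
    have "\<exists>g. \<forall>y\<in>?S. (\<lambda>n. picard K n y) sums g y \<and> (g has_derivative (\<lambda>h. h *\<^sub>R (\<Sum>i. f' i y))) (at y within ?S)"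
    proof (rule has_derivative_series[where f'="\<lambda>n y h. h *\<^sub>R f' n y"])
      show "(picard K n has_derivative (\<lambda>h. h *\<^sub>R f' n y)) (at y within ?S)" for n y
        using d[of n y] unfolding has_vector_derivative_def by (rule has_derivative_at_withinI)
      fix e :: real assume "e > 0"
      then have "\<forall>\<^sub>F n in sequentially. \<forall>y\<in>?S. dist (\<Sum>i<n. f' i y) (\<Sum>i. f' i y) < e"
        using unif by (simp add: uniform_limit_iff)
      then show "\<forall>\<^sub>F n in sequentially. \<forall>y\<in>?S. \<forall>h. norm ((\<Sum>i<n. h *\<^sub>R f' i y) - h *\<^sub>R (\<Sum>i. f' i y)) \<le> e * norm h"
      proof eventually_elim
        case (elim n)
        show ?case
        proof (intro ballI allI)
          fix y h assume "y \<in> ?S"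
          then have "norm ((\<Sum>i<n. f' i y) - (\<Sum>i. f' i y)) \<le> e" using elim by (force simp: dist_norm)
          then have "norm (h *\<^sub>R ((\<Sum>i<n. f' i y) - (\<Sum>i. f' i y))) \<le> e * norm h"
            by (simp add: mult.commute[of e] mult_left_mono)
          then show "norm ((\<Sum>i<n. h *\<^sub>R f' i y) - h *\<^sub>R (\<Sum>i. f' i y)) \<le> e * norm h"
            by (simp add: scaleR_sum_right scaleR_diff_right)
        qed
      qed
    next
      show "0 \<in> ?S" by (simp add: R_def)
      show "(\<lambda>n. picard K n 0) sums (\<Sum>n. picard K n 0)"
        using summ[of 0] by (simp add: summable_sums R_def)
    qed auto
    then obtain g where g: "\<And>y. y \<in> ?S \<Longrightarrow> (\<lambda>n. picard K n y) sums g y"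
      "\<And>y. y \<in> ?S \<Longrightarrow> (g has_derivative (\<lambda>h. h *\<^sub>R (\<Sum>i. f' i y))) (at y within ?S)" by blast
    have gu: "g y = u y" if "y \<in> ?S" for y using g(1)[OF that] by (simp add: u_def sums_iff)
    have xR: "\<bar>x\<bar> \<le> R" "x \<in> interior ?S" "x \<in> ?S" by (auto simp: R_def interior_atLeastAtMost_real)
    show "summable (\<lambda>n. picard K n x)" using summ[OF xR(1)] .
    have "(\<Sum>i. f' i x) = K x * u x"
    proof -
      have "(\<lambda>n. K x * picard K n x) sums (K x * u x)"
        unfolding u_def by (intro sums_mult summable_sums summ xR)
      then have "(\<lambda>n. f' (Suc n) x) sums (K x * u x)" by (simp add: f'_def)
      then have "(\<lambda>n. f' n x) sums (K x * u x + f' 0 x)" by (rule sums_Suc)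
      then show ?thesis by (simp add: sums_iff f'_def)
    qed
    moreover have "(g has_derivative (\<lambda>h. h *\<^sub>R (\<Sum>i. f' i x))) (at x)"
      using g(2)[OF xR(3)] unfolding at_within_interior[OF xR(2)] .
    ultimately have "(g has_vector_derivative K x * u x) (at x)"
      unfolding has_vector_derivative_def by simp
    then show "(u has_vector_derivative K x * u x) (at x)"
      by (rule has_vector_derivative_transform_within_open[OF _ open_interior xR(2)])
        (rule gu[OF subsetD[OF interior_subset]])
  qed
  have "(\<lambda>n. picard K n 0) = (\<lambda>n. if n = 0 then 1 else 0)"
  proof
    show "picard K n 0 = (if n = 0 then 1 else 0)" for n by (cases n) (simp_all add: antideriv_0)
  qed
  then have "u 0 = 1"
    unfolding u_def using sums_unique[OF sums_single[of 0 "\<lambda>_. 1 :: 'a"]] by simp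
  moreover have "((\<lambda>x. u x * g0) has_vector_derivative K x * (u x * g0)) (at x)" for x
    using has_vector_derivative_mult[OF u'[of x] has_vector_derivative_const[of g0]] by (simp add: mult.assoc)
  ultimately show ?thesis by (intro exI[of _ "\<lambda>x. u x * g0"]) simp
qed

lemma linear_ode_smooth:
  fixes K :: "real \<Rightarrow> 'a::real_normed_algebra_1"
  assumes K: "smooth_on K UNIV" and g: "\<And>x. (g has_vector_derivative K x * g x) (at x)"
  shows "smooth_on g UNIV"
  unfolding smooth_on_def
proof
  fix k show "Ck_on k g UNIV"
  proof (induction k)
    case 0
    show ?case
      using g by (auto intro!: continuous_at_imp_continuous_on has_vector_derivative_continuous)
  next
    case (Suc k)
    show ?case
    proof (rule Ck_onI[where f'="\<lambda>x v. v *\<^sub>R (K x * g x)"])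
      have "Ck_on k K UNIV" using K by (simp add: smooth_on_def)
      then show "Ck_on k (\<lambda>x. v *\<^sub>R (K x * g x)) UNIV" for v
        by (intro Ck_on_linear[OF open_UNIV bounded_linear_scaleR_right] Ck_on_bilinear[OF open_UNIV bounded_bilinear_mult] Suc)
    qed (use g in \<open>auto simp: has_vector_derivative_def\<close>)
  qed
qed

section \<open>Existence of parallel frames\<close>

lemma inner_derivative_eq_0:
  fixes f h :: "real \<Rightarrow> 'a::real_inner"
  assumes "(f has_vector_derivative f') (at x)" "\<And>x. f x \<bullet> f x = c"
  shows "f x \<bullet> f' = 0"
proof -
  have "((\<lambda>x. f x \<bullet> f x) has_vector_derivative f x \<bullet> f' + f' \<bullet> f x) (at x)"
    using bounded_bilinear.has_vector_derivative[OF bounded_bilinear_inner assms(1) assms(1)] .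
  then have "((\<lambda>x. c) has_vector_derivative 2 * (f x \<bullet> f')) (at x)"
    using assms(2) by (simp add: inner_commute)
  then show ?thesis
    using vector_derivative_unique_at has_vector_derivative_const by fastforce
qed

lemma unit_speed_curve_tangent:
  "unit_speed_curve \<gamma> \<Longrightarrow> unit_tangent (\<lambda>x. vector_derivative \<gamma> (at x))"
  by (simp add: unit_speed_curve_def unit_tangent_def smooth_on_vector_derivative)

definition outer :: "real^'n \<Rightarrow> real^'n \<Rightarrow> real^'n^'n" where
  "outer u v = (\<chi> i j. u $ i * v $ j)"

lemma bounded_bilinear_outer: "bounded_bilinear (outer :: real^'n::finite \<Rightarrow> _)"
proof -
  have "bilinear (outer :: real^'n \<Rightarrow> _)"
    unfolding bilinear_def
    by (intro conjI allI linearI) (simp_all add: outer_def vec_eq_iff algebra_simps)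
  then show ?thesis by (simp add: bilinear_conv_bounded_bilinear)
qed

lemma outer_mult: "transpose g ** outer u v ** g = outer (transpose g *v u) (transpose g *v v)"
  by (simp add: outer_def vec_eq_iff matrix_matrix_mult_def matrix_vector_mult_def transpose_def
      sum_distrib_left sum_distrib_right mult_ac)

lemma outer_vector: "outer u v *v w = (v \<bullet> w) *\<^sub>R u"
  by (simp add: outer_def vec_eq_iff matrix_vector_mult_def inner_vec_def sum_distrib_left mult_ac)

lemma transpose_outer: "transpose (outer u v) = outer v u"
  by (simp add: outer_def transpose_def vec_eq_iff mult.commute)

lemma bounded_bilinear_transpose_vector: 
  "bounded_bilinear (\<lambda>(A::real^'n::finite^'m::finite) v. transpose A *v v)"
proof -
  have "bilinear (\<lambda>(A::real^'n^'m) v. transpose A *v v)"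
    unfolding bilinear_def
    by (intro conjI allI linearI)
      (simp_all add: transpose_def matrix_vector_mult_def vec_eq_iff algebra_simps sum.distrib sum_distrib_left)
  then show ?thesis by (simp add: bilinear_conv_bounded_bilinear)
qed

text \<open>The equation \<open>g\<^sub>x = K g\<close> is solved with the infinitesimal rotation K
  in the plane of T and T'. K is skew, so g stays orthogonal, and K T = T', so the tangent has
  constant coordinates in g and remains its first column. A vector normal to T is mapped by K to a
  multiple of T, which is parallelism of the other columns.\<close>

lemma parallel_frame_exists:
  fixes \<gamma> :: "real \<Rightarrow> real^('m::finite option)"
  assumes "unit_speed_curve \<gamma>"
  shows "\<exists>g k. parallel_frame \<gamma> g k"
proof -
  define T where "T x = vector_derivative \<gamma> (at x)" for x
  define T' where "T' x = vector_derivative T (at x)" for x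
  have "unit_tangent T" using unit_speed_curve_tangent[OF assms] by (simp add: T_def[abs_def])
  then have T: "smooth_on T UNIV" "T x \<bullet> T x = 1" for x
    by (auto simp: unit_tangent_def norm_eq_1)
  have T': "(T has_vector_derivative T' x) (at x)" for x
    unfolding T'_def using smooth_on_real_has_vector_derivative[OF T(1)] by simp
  have TT': "T x \<bullet> T' x = 0" for x by (rule inner_derivative_eq_0[OF T' T(2)])
  define K where "K x = Mat (outer (T' x) (T x) - outer (T x) (T' x))" for x
  have T's: "smooth_on T' UNIV"
    unfolding T'_def[abs_def] by (intro smooth_on_vector_derivative T open_UNIV)
  have K: "smooth_on K UNIV"
    unfolding K_def
    by (intro smooth_on_linear[OF _ bounded_linear_Mat] smooth_on_diff smooth_on_bilinear[OF bounded_bilinear_outer]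
        open_UNIV T T's)
  have tpK: "tp (K x) = - K x" for x
  proof -
    have "transpose (A - B) = transpose A - transpose B" for A B :: "real^'m option^'m option"
      by (simp add: transpose_def vec_eq_iff)
    then show ?thesis by (simp add: tp_def K_def sqmat_eq_iff transpose_outer)
  qed
  \<comment> \<open>In dimension at least 2 a rotation can have any unit vector as its first column;
    in dimension 1 it could not.\<close>
  have "2 \<le> CARD('m option)" by (simp add: Suc_leI)
  moreover have "norm (T 0) = 1" using T(2) by (simp add: norm_eq_1)
  ultimately obtain A where A: "rotation_matrix A" "A *v axis None 1 = T 0"
    using rotation_matrix_exists_basis by blast
  obtain h where h0: "h 0 = Mat A" and h: "\<And>x. (h has_vector_derivative K x * h x) (at x)"
    using linear_ode_exists[OF smooth_on_imp_continuous_on[OF K]] by blast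
  have hs: "smooth_on h UNIV" by (rule linear_ode_smooth[OF K h])
  define g where "g x = mat_of (h x)" for x
  have gs: "smooth_on g UNIV"
    unfolding g_def by (rule smooth_on_linear[OF open_UNIV bounded_linear_mat_of hs])
  have g': "(g has_vector_derivative mat_of (K x) ** g x) (at x)" for x
    using bounded_linear.has_vector_derivative[OF bounded_linear_mat_of h] by (simp add: g_def[abs_def])
  have "((\<lambda>x. tp (h x) * h x) has_vector_derivative 0) (at x)" for x
    using has_vector_derivative_mult[OF bounded_linear.has_vector_derivative[OF bounded_linear_tp h] h, of x]
    by (simp add: tp_mult tpK mult.assoc)
  then have "tp (h x) * h x = tp (h 0) * h 0" for x
    by (rule has_vector_derivative_zero_imp_eq)
  moreover have "tp (h 0) * h 0 = 1"
    using A(1) by (simp add: h0 tp_def sqmat_eq_iff rotation_matrix_def orthogonal_matrix_def)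
  ultimately have "mat_of (tp (h x) * h x) = mat_of 1" for x by simp
  then have gg: "transpose (g x) ** g x = mat 1" for x by (simp add: g_def tp_def)
  then have gg': "g x ** transpose (g x) = mat 1" for x using matrix_left_right_inverse by blast
  have orth: "orthogonal_matrix (g x)" for x using gg gg' by (simp add: orthogonal_matrix_def)
  have det: "det (g x) = 1" for x
  proof -
    have "continuous_on UNIV (\<lambda>x. g x $ i $ j)" for i j
      by (intro continuous_intros smooth_on_imp_continuous_on gs)
    then have "continuous_on UNIV (\<lambda>x. det (g x))"
      unfolding det_def
      by (intro continuous_on_sum continuous_on_mult continuous_on_prod continuous_on_const)
    moreover have "(\<lambda>x. det (g x)) ` UNIV \<subseteq> {1, -1}"
      using det_orthogonal_matrix[OF orth] by auto
    then have "finite ((\<lambda>x. det (g x)) ` UNIV)" using finite_subset by blast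
    ultimately have "(\<lambda>x. det (g x)) constant_on UNIV"
      by (intro continuous_finite_range_constant) auto
    then have "det (g x) = det (g 0)" unfolding constant_on_def by (metis UNIV_I)
    then show ?thesis using A(1) by (simp add: g_def h0 rotation_matrix_def)
  qed
  have "((\<lambda>x. transpose (g x) *v T x) has_vector_derivative 0) (at x)" for x
  proof -
    have "transpose (mat_of (K x)) *v T x = - T' x"
      using arg_cong[OF tpK[of x], of mat_of] T(2)[of x] TT'[of x]
      by (simp add: tp_def) (simp add: K_def matrix_vector_mult_diff_rdistrib outer_vector inner_commute)
    then have "transpose (g x) *v T' x + transpose (mat_of (K x) ** g x) *v T x = 0"
      by (simp add: matrix_transpose_mul matrix_vector_mul_assoc[symmetric] del: transpose_matrix_vector
          flip: matrix_vector_right_distrib)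
    then show ?thesis
      using bounded_bilinear.has_vector_derivative[OF bounded_bilinear_transpose_vector g' T', of x] by simp
  qed
  then have "transpose (g x) *v T x = transpose (g 0) *v T 0" for x
    by (rule has_vector_derivative_zero_imp_eq)
  moreover have "transpose (g 0) *v T 0 = axis None 1"
    unfolding A(2)[symmetric] using gg[of 0]
    by (simp add: g_def h0 matrix_vector_mul_assoc del: transpose_matrix_vector)
  ultimately have gT: "transpose (g x) *v T x = axis None 1" for x by simp
  have gTc: "column None (g x) = T x" for x
  proof -
    have "g x *v (transpose (g x) *v T x) = T x"
      unfolding matrix_vector_mul_assoc gg' by simp
    then show ?thesis unfolding gT by (simp add: matrix_vector_mult_basis)
  qed
  define b where "b x = transpose (g x) *v T' x" for x
  have b0: "b x $ None = 0" for x
  proof -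
    have "b x $ None = b x \<bullet> axis None 1" by (simp add: inner_axis)
    also have "\<dots> = T' x \<bullet> (g x *v axis None 1)" by (simp add: b_def dot_lmul_matrix)
    also have "g x *v axis None 1 = T x" using gTc by (simp add: matrix_vector_mult_basis)
    finally show ?thesis using TT' by (simp add: inner_commute)
  qed
  define k where "k x = (\<chi> p. b x $ Some p)" for x
  have "matrix_inv (g x) ** vector_derivative g (at x) = curvature_mat (k x)" for x
  proof -
    have "matrix_inv (g x) ** vector_derivative g (at x) = transpose (g x) ** mat_of (K x) ** g x"
      unfolding matrix_inv_eqI[OF gg' gg] vector_derivative_at[OF g'] by (simp add: matrix_mul_assoc)
    also have "\<dots> = outer (b x) (axis None 1) - outer (axis None 1) (b x)"
    proof -
      have "transpose (g x) ** (B - C) ** g x = transpose (g x) ** B ** g x - transpose (g x) ** C ** g x" for B C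
        by (simp add: matrix_matrix_mult_def vec_eq_iff right_diff_distrib left_diff_distrib sum_subtractf)
      note diff = this
      show ?thesis unfolding K_def mat_of_Mat diff outer_mult b_def gT ..
    qed
    also have "\<dots> = curvature_mat (k x)"
    proof -
      have "(outer (b x) (axis None 1) - outer (axis None 1) (b x)) $ r $ c = curvature_mat (k x) $ r $ c" for r c
        by (cases r; cases c) (simp_all add: outer_def curvature_mat_def k_def b0 axis_def)
      then show ?thesis by (simp add: vec_eq_iff)
    qed
    finally show ?thesis .
  qed
  then have "parallel_frame \<gamma> g k"
    unfolding parallel_frame_def rotation_matrix_def using gs orth det gTc by (simp add: T_def)
  then show ?thesis by blast
qed

section \<open>Fields and functionals in terms of the series of the curve\<close>

lemma airy_field_eq_vel:
  fixes \<gamma> :: "real \<Rightarrow> real^('m::finite option)"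
  assumes "unit_speed_curve \<gamma>" "1 \<le> m"
  shows "airy_field m \<gamma> = vel (2 * m - 2) (\<lambda>x. vector_derivative \<gamma> (at x))"
  unfolding airy_field_def
proof (rule the_equality)
  note rhs = airy_rhs_eq_vel[OF _ unit_speed_curve_tangent[OF assms(1)] refl assms(2)]
  obtain g k where "parallel_frame \<gamma> g k" using parallel_frame_exists[OF assms(1)] by blast
  then show "\<exists>g k. parallel_frame \<gamma> g k \<and> vel (2 * m - 2) (\<lambda>x. vector_derivative \<gamma> (at x)) = airy_rhs m g k"
    using rhs by (intro exI[of _ g] exI[of _ k]) auto
  fix v assume "\<exists>g k. parallel_frame \<gamma> g k \<and> v = airy_rhs m g k"
  then show "v = vel (2 * m - 2) (\<lambda>x. vector_derivative \<gamma> (at x))" using rhs by auto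
qed

lemma F_hat_eq:
  fixes \<gamma> :: "real \<Rightarrow> real^('m::finite option)"
  assumes "unit_speed_curve \<gamma>"
  shows "F_hat L l \<gamma> = - (1 / (2 * real l - 1)) * integral {0..L}
    (\<lambda>x. vel (2 * l) (\<lambda>x. vector_derivative \<gamma> (at x)) x \<bullet> vector_derivative \<gamma> (at x))" (is "_ = ?c")
  unfolding F_hat_def
proof (rule the_equality)
  note y = y_coeff_eq_inner_vel[OF _ unit_speed_curve_tangent[OF assms] refl]
  obtain g k where "parallel_frame \<gamma> g k" using parallel_frame_exists[OF assms] by blast
  then show "\<exists>g k. parallel_frame \<gamma> g k \<and> ?c = - (1 / (2 * real l - 1)) * integral {0..L} (y_coeff (2 * int l - 1) k)"
    using y by (intro exI[of _ g] exI[of _ k] conjI) (simp_all cong: integral_cong)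
  fix c assume "\<exists>g k. parallel_frame \<gamma> g k \<and> c = - (1 / (2 * real l - 1)) * integral {0..L} (y_coeff (2 * int l - 1) k)"
  then show "c = ?c" using y by (auto cong: integral_cong)
qed

section \<open>Evolution along the Airy flows\<close>

definition vcol :: "('n::finite option) sqmat \<Rightarrow> real^'n" where
  "vcol a = (\<chi> i. mat_of a $ Some i $ None)"

lemma vcol_pmat [simp]: "vcol (pmat v) = v"
  by (simp add: vcol_def)

lemma bounded_linear_vcol: "bounded_linear (vcol :: ('n::finite option) sqmat \<Rightarrow> _)"
proof -
  have "linear (\<lambda>A :: real^('n option)^('n option). \<chi> i. A $ Some i $ None)"
    by (rule linearI) (simp_all add: vec_eq_iff)
  then have "bounded_linear (\<lambda>A :: real^('n option)^('n option). \<chi> i. A $ Some i $ None)"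
    by (simp add: linear_conv_bounded_linear)
  from bounded_linear_compose[OF this bounded_linear_mat_of]
  show ?thesis by (simp add: vcol_def[abs_def])
qed

lemma vel_eq_vcol: "vel n T x = vcol (fps_nth (curve_ser T x) n)"
  by (simp add: vel_def vcol_def)

lemma tr_curve_ser:
  assumes "unit_tangent T"
  shows "tr (fps_nth (curve_ser T x) n * pmat v) = - 2 * (vel n T x \<bullet> v)"
  using tr_mult_pmat[OF curve_ser_skew[OF assms]] by (simp add: vel_def inner_vec_def)

lemma smooth_on_vel: "unit_tangent T \<Longrightarrow> smooth_on (vel n T) UNIV"
  unfolding vel_eq_vcol[abs_def]
  by (intro smooth_on_linear[OF open_UNIV bounded_linear_vcol] smooth_on_lax_sol unit_tangent_pmat)

definition vel_deriv :: "nat \<Rightarrow> (real \<Rightarrow> real^'n::finite) \<Rightarrow> real \<Rightarrow> real^'n" where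
  "vel_deriv n T x = vcol (fps_nth (lax_deriv (\<lambda>x. pmat (T x)) x) n)"

text \<open>The orthogonality says that the flow preserves arc length. The derivative of coefficient
  n is the commutator of coefficient n + 1 with S, and the trace of its product with S
  vanishes.\<close>

lemma vel_deriv:
  assumes T: "unit_tangent T" and n: "even n"
  shows "(vel n T has_vector_derivative vel_deriv n T x) (at x)"
    and "fps_nth (lax_deriv (\<lambda>x. pmat (T x)) x) n = pmat (vel_deriv n T x)"
    and "vel_deriv n T x \<bullet> T x = 0"
proof -
  let ?D = "fps_nth (lax_deriv (\<lambda>x. pmat (T x)) x) n"
  have D: "((\<lambda>x. fps_nth (curve_ser T x) n) has_vector_derivative ?D) (at x)"
    using lax_deriv(1)[OF unit_tangent_pmat[OF T], of x] unfolding has_coeff_derivative_def by blast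
  show v: "(vel n T has_vector_derivative vel_deriv n T x) (at x)"
    unfolding vel_eq_vcol[abs_def] vel_deriv_def
    by (rule bounded_linear.has_vector_derivative[OF bounded_linear_vcol D])
  from bounded_linear.has_vector_derivative[OF bounded_linear_pmat v]
  have "((\<lambda>x. fps_nth (curve_ser T x) n) has_vector_derivative pmat (vel_deriv n T x)) (at x)"
    by (simp add: curve_ser_even[OF T n])
  with D show eq: "?D = pmat (vel_deriv n T x)" by (rule vector_derivative_unique_at)
  let ?M = "fps_nth (curve_ser T x) (Suc n)" and ?S = "pmat (T x)"
  have "tr (?D * ?S) = tr (?M * ?S * ?S - ?S * (?M * ?S))"
    by (simp add: lax_deriv_def comm_def left_diff_distrib mult.assoc)
  also have "\<dots> = 0"
    using tr_commute[of "?M * ?S" ?S] by (simp add: linear_diff[OF bounded_linear.linear[OF bounded_linear_tr]])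
  finally have "tr (pmat (vel_deriv n T x) * ?S) = 0" unfolding eq .
  then show "vel_deriv n T x \<bullet> T x = 0"
    by (subst (asm) tr_mult_pmat) (simp_all add: tp_pmat inner_vec_def)
qed

lemma smooth_on_vel_deriv:
  assumes "unit_tangent T" "even n"
  shows "smooth_on (vel_deriv n T) UNIV"
  by (rule smooth_on_cong[OF open_UNIV _ smooth_on_vector_derivative[OF open_UNIV smooth_on_vel[OF assms(1), of n]]])
    (rule vector_derivative_at[OF vel_deriv(1)[OF assms]])

text \<open>
  A variation with prescribed velocity \<open>V\<close>: since \<open>V'\<close> is orthogonal to the tangent \<open>T\<close>, the vector
  \<open>T + s V'\<close> has length \<open>sqrt (1 + s\<^sup>2 \<parallel>V'\<parallel>\<^sup>2)\<close>, and normalizing it does not change its first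
  derivative at \<open>s = 0\<close>.
\<close>

lemma variation_exists:
  fixes \<gamma> :: "real \<Rightarrow> real^('m::finite option)"
  assumes \<gamma>: "unit_speed_curve \<gamma>" and V: "\<And>x. (V has_vector_derivative V' x) (at x)"
    and V': "smooth_on V' UNIV" and orth: "\<And>x. V' x \<bullet> vector_derivative \<gamma> (at x) = 0"
  shows "\<exists>\<alpha>. variation \<gamma> V \<alpha>"
proof -
  define T where "T x = vector_derivative \<gamma> (at x)" for x
  have T: "smooth_on T UNIV" "\<And>x. norm (T x) = 1"
    using unit_speed_curve_tangent[OF \<gamma>] by (simp_all add: unit_tangent_def T_def[abs_def])
  have \<gamma>': "(\<gamma> has_vector_derivative T x) (at x)" for x
    unfolding T_def using \<gamma> smooth_on_real_has_vector_derivative[of \<gamma> UNIV] by (simp add: unit_speed_curve_def)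
  define I where "I = {- 1<..<1::real}"
  have I: "open I" "0 \<in> I" by (auto simp: I_def)
  have U: "open (I \<times> (UNIV :: real set))" using I by (simp add: open_Times)
  define c where "c q = 1 + (fst q * fst q) * (V' (snd q) \<bullet> V' (snd q))" for q :: "real \<times> real"
  define W where "W q = (c q powr (- 1/2)) *\<^sub>R (T (snd q) + fst q *\<^sub>R V' (snd q))" for q
  have c: "1 \<le> c q" for q by (simp add: c_def)
  have fst: "smooth_on (fst :: real \<times> real \<Rightarrow> real) (I \<times> UNIV)"
    by (rule smooth_on_bounded_linear[OF U bounded_linear_fst])
  note Ts = smooth_on_constant_family[OF I(1) T(1)] and V's = smooth_on_constant_family[OF I(1) V']
  have cs: "smooth_on c (I \<times> UNIV)"
    unfolding c_def[abs_def] by (intro smooth_on_add smooth_on_const smooth_on_mult smooth_on_inner U fst V's)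
  have W: "smooth_on W (I \<times> UNIV)"
    unfolding W_def[abs_def]
    by (intro smooth_on_scaleR smooth_on_add smooth_on_powr U fst Ts V's cs less_le_trans[OF zero_less_one c])
  have normW: "norm (W q) = 1" for q
  proof -
    have "(T (snd q) + fst q *\<^sub>R V' (snd q)) \<bullet> (T (snd q) + fst q *\<^sub>R V' (snd q)) = c q"
      using T(2)[of "snd q"] orth[of "snd q"]
      by (simp add: c_def inner_add_left inner_add_right inner_commute norm_eq_1 T_def[symmetric])
    then have "norm (T (snd q) + fst q *\<^sub>R V' (snd q)) = sqrt (c q)" by (simp add: norm_eq_sqrt_inner)
    then have "norm (W q) = \<bar>c q powr (- 1/2)\<bar> * sqrt (c q)"
      unfolding W_def norm_scaleR real_norm_def by simp
    then show ?thesis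
      using c[of q] by (simp add: powr_minus powr_half_sqrt)
  qed
  \<comment> \<open>W is a unit field, so integrating it yields unit speed curves. The starting
    point moves with velocity V 0, which fixes the constant of integration in the variation
    field.\<close>
  define \<alpha> where "\<alpha> s x = (\<gamma> 0 + s *\<^sub>R V 0) + antideriv (\<lambda>x. W (s, x)) x" for s x
  have \<alpha>s: "smooth_on (\<lambda>(s, x). \<alpha> s x) (I \<times> UNIV)"
    unfolding \<alpha>_def case_prod_unfold
    by (intro smooth_on_add smooth_on_const smooth_on_scaleR fst U smooth_on_antideriv I W)
  have Wc: "continuous_on UNIV (\<lambda>x. W (s, x))" if "s \<in> I" for s
    by (rule smooth_on_imp_continuous_on[OF smooth_on_slice[OF I(1) W that]])
  have \<alpha>': "(\<alpha> s has_vector_derivative W (s, x)) (at x)" if "s \<in> I" for s x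
    unfolding \<alpha>_def[abs_def]
    using has_vector_derivative_add[OF has_vector_derivative_const antideriv_has_vector_derivative[OF Wc[OF that]]] by simp
  have W0: "W (0, x) = T x" for x by (simp add: W_def c_def)
  have dtW: "partial_t W (0, x) = V' x" for x
  proof -
    let ?b = "V' x \<bullet> V' x"
    have "((\<lambda>s. (1 + (s * s) * ?b) powr (- 1/2)) has_real_derivative 0) (at 0)"
    proof -
      have "((\<lambda>s. 1 + (s * s) * ?b) has_real_derivative 0) (at 0)"
        by (auto intro!: derivative_eq_intros)
      from DERIV_fun_powr[OF this, of "- 1/2"] show ?thesis by simp
    qed
    then have 1: "((\<lambda>s. (1 + (s * s) * ?b) powr (- 1/2)) has_vector_derivative 0) (at 0)"
      by (simp add: has_real_derivative_iff_has_vector_derivative)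
    have 2: "((\<lambda>s. T x + s *\<^sub>R V' x) has_vector_derivative V' x) (at 0)"
      by (auto intro!: derivative_eq_intros)
    have "((\<lambda>s. W (s, x)) has_vector_derivative V' x) (at 0)"
      using bounded_bilinear.has_vector_derivative[OF bounded_bilinear_scaleR 1 2] by (simp add: W_def c_def)
    then show ?thesis
      using has_vector_derivative_partial_t[OF W, of 0 x] I(2) vector_derivative_unique_at by blast
  qed
  have "variation \<gamma> V \<alpha>"
    unfolding variation_def
  proof (intro conjI exI[of _ "1::real"] ballI allI)
    show "\<alpha> 0 = \<gamma>"
    proof
      fix x
      have "antideriv T x = \<gamma> x - \<gamma> 0"
        by (rule antideriv_eqI[OF \<gamma>' smooth_on_imp_continuous_on[OF T(1)]])
      then show "\<alpha> 0 x = \<gamma> x" by (simp add: \<alpha>_def W0)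
    qed
    show "smooth_on (\<lambda>(s, x). \<alpha> s x) ({- 1<..<1} \<times> UNIV)" using \<alpha>s by (simp add: I_def)
    fix s :: real assume "s \<in> {- 1<..<1}"
    then have s: "s \<in> I" by (simp add: I_def)
    show "unit_speed_curve (\<alpha> s)"
      using smooth_on_slice[OF I(1) \<alpha>s s] vector_derivative_at[OF \<alpha>'[OF s]] normW
      by (simp add: unit_speed_curve_def)
  next
    fix x
    have "((\<lambda>s. (\<gamma> 0 + s *\<^sub>R V 0) + antideriv (\<lambda>x. W (s, x)) x) has_vector_derivative V 0 + antideriv (\<lambda>x. partial_t W (0, x)) x) (at 0)"
      by (intro has_vector_derivative_add antideriv_has_vector_derivative_param[OF I(1) W I(2)])
        (auto intro!: derivative_eq_intros)
    moreover have "antideriv (\<lambda>x. partial_t W (0, x)) x = V x - V 0"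
      unfolding dtW by (rule antideriv_eqI[OF V smooth_on_imp_continuous_on[OF V']])
    ultimately show "((\<lambda>s. \<alpha> s x) has_vector_derivative V x) (at 0)"
      by (simp add: \<alpha>_def)
  qed simp
  then show ?thesis by blast
qed

text \<open>The velocity is prescribed only at the single time t. The result therefore applies to an
  arbitrary variation at time 0 as well as to a solution at any time. Interchanging the derivatives
  in t and x turns the velocity of the curve into that of its tangent.\<close>

lemma curve_ser_evolution:
  fixes \<alpha> :: "real \<Rightarrow> real \<Rightarrow> real^'n::finite"
  defines "\<tau> \<equiv> \<lambda>s x. vector_derivative (\<alpha> s) (at x)"
  assumes I: "open I" "t \<in> I" and \<alpha>: "smooth_on (\<lambda>(s, x). \<alpha> s x) (I \<times> UNIV)"
    and \<tau>: "\<And>s. s \<in> I \<Longrightarrow> unit_tangent (\<tau> s)"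
    and p: "even p"
    and t: "\<And>x. ((\<lambda>s. \<alpha> s x) has_vector_derivative vel p (\<tau> t) x) (at t)"
  shows "\<exists>Mt. (\<forall>x. fps_X ^ Suc p * Mt x = comm (curve_ser (\<tau> t) x) (fps_cutoff (Suc p) (curve_ser (\<tau> t) x))) \<and>
    (\<forall>x. has_coeff_derivative (\<lambda>s. curve_ser (\<tau> s) x) (Mt x) t) \<and>
    (\<forall>x. ((\<lambda>s. pmat (\<tau> s x)) has_vector_derivative fps_nth (lax_deriv (\<lambda>x. pmat (\<tau> t x)) x) p) (at t))"
    and "smooth_on (\<lambda>q. fps_nth (curve_ser (\<tau> (fst q)) (snd q)) n) (I \<times> UNIV)"
    and "smooth_on (\<lambda>q. \<tau> (fst q) (snd q)) (I \<times> UNIV)"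
proof -
  define a where "a = (\<lambda>q. \<alpha> (fst q) (snd q))"
  have a: "smooth_on a (I \<times> UNIV)" using \<alpha> by (simp add: a_def case_prod_unfold)
  have U: "open (I \<times> (UNIV :: real set))" using I by (simp add: open_Times)
  have \<tau>_eq: "\<tau> s x = partial_x a (s, x)" if "s \<in> I" for s x
    using vector_derivative_partial_x[OF a, of s x] that by (simp add: \<tau>_def a_def)
  show \<tau>s: "smooth_on (\<lambda>q. \<tau> (fst q) (snd q)) (I \<times> UNIV)"
    by (rule smooth_on_cong[OF U _ smooth_on_partial_x[OF a]]) (auto simp: \<tau>_eq)
  define S where "S q = pmat (\<tau> (fst q) (snd q))" for q
  have S: "smooth_on S (I \<times> UNIV)"
    unfolding S_def[abs_def] by (rule smooth_on_linear[OF U bounded_linear_pmat \<tau>s])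
  have S3: "S q * S q * S q = - S q" if "q \<in> I \<times> UNIV" for q
    using \<tau>[of "fst q"] that unfolding S_def by (auto simp: unit_tangent_def intro: pmat_cube)
  have S_eq: "(\<lambda>x. S (s, x)) = (\<lambda>x. pmat (\<tau> s x))" for s by (simp add: S_def)
  have m: "smooth_on (\<lambda>q. fps_nth (curve_ser (\<tau> (fst q)) (snd q)) n) (I \<times> UNIV)" for n
    using smooth_on_lax_sol_family[OF I(1) S] unfolding S_eq .
  then show "smooth_on (\<lambda>q. fps_nth (curve_ser (\<tau> (fst q)) (snd q)) n) (I \<times> UNIV)" .
  have dta: "partial_t a (t, x) = vel p (\<tau> t) x" for x
    using has_vector_derivative_partial_t[OF a, of t x] t[of x] I(2) vector_derivative_unique_at
    by (fastforce simp: a_def)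
  have "partial_t (partial_x a) (t, x) = vel_deriv p (\<tau> t) x" for x
  proof -
    have "((\<lambda>x. partial_t a (t, x)) has_vector_derivative partial_x (partial_t a) (t, x)) (at x)"
      using has_vector_derivative_partial_x[OF smooth_on_partial_t[OF a], of t x] I(2) by simp
    then have "partial_x (partial_t a) (t, x) = vel_deriv p (\<tau> t) x"
      unfolding dta using vel_deriv(1)[OF \<tau>[OF I(2)] p] vector_derivative_unique_at by blast
    then show ?thesis using partial_t_partial_x_commute[OF I(1) a I(2)] by simp
  qed
  then have "((\<lambda>s. partial_x a (s, x)) has_vector_derivative vel_deriv p (\<tau> t) x) (at t)" for x
    using has_vector_derivative_partial_t[OF smooth_on_partial_x[OF a], of t x] I(2) by simp
  then have "((\<lambda>s. \<tau> s x) has_vector_derivative vel_deriv p (\<tau> t) x) (at t)" for x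
    by (rule has_vector_derivative_transform_within_open[OF _ I]) (simp add: \<tau>_eq)
  from bounded_linear.has_vector_derivative[OF bounded_linear_pmat this]
  have St: "((\<lambda>s. S (s, x)) has_vector_derivative fps_nth (lax_deriv (\<lambda>x. S (t, x)) x) p) (at t)" for x
    unfolding S_eq vel_deriv(2)[OF \<tau>[OF I(2)] p] by (simp add: S_def)
  then have "partial_t S (t, x) = fps_nth (lax_deriv (\<lambda>x. S (t, x)) x) p" for x
    using has_vector_derivative_partial_t[OF S, of t x] I(2) vector_derivative_unique_at by blast
  note evo = lax_sol_evolution[OF I S S3 this]
  define Mt where "Mt x = Abs_fps (\<lambda>n. partial_t (\<lambda>q. fps_nth (curve_ser (\<tau> (fst q)) (snd q)) n) (t, x))" for x
  have "fps_X ^ Suc p * Mt x = comm (curve_ser (\<tau> t) x) (fps_cutoff (Suc p) (curve_ser (\<tau> t) x))" for x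
    using evo[of x] unfolding S_eq Mt_def .
  moreover have "has_coeff_derivative (\<lambda>s. curve_ser (\<tau> s) x) (Mt x) t" for x
    unfolding has_coeff_derivative_def Mt_def using has_vector_derivative_partial_t[OF m, of t x] I(2) by simp
  moreover have "((\<lambda>s. pmat (\<tau> s x)) has_vector_derivative fps_nth (lax_deriv (\<lambda>x. pmat (\<tau> t x)) x) p) (at t)" for x
    using St[of x] unfolding S_eq by (simp add: S_def)
  ultimately show "\<exists>Mt. (\<forall>x. fps_X ^ Suc p * Mt x = comm (curve_ser (\<tau> t) x) (fps_cutoff (Suc p) (curve_ser (\<tau> t) x))) \<and>
    (\<forall>x. has_coeff_derivative (\<lambda>s. curve_ser (\<tau> s) x) (Mt x) t) \<and>
    (\<forall>x. ((\<lambda>s. pmat (\<tau> s x)) has_vector_derivative fps_nth (lax_deriv (\<lambda>x. pmat (\<tau> t x)) x) p) (at t))"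
    by blast
qed

text \<open>Along the flow with index p the series satisfies
  \<open>\<lambda>\<^sup>-\<^sup>p\<^sup>-\<^sup>1 M\<^sub>t = [M, A]\<close>, where A is the
  truncation of M. Degree p + q + 1 therefore gives the time derivative of coefficient q, hence that
  of the velocity \<open>vel q\<close>.\<close>

definition airy_bracket :: "nat \<Rightarrow> nat \<Rightarrow> (real \<Rightarrow> real^'n::finite) \<Rightarrow> real \<Rightarrow> real^'n" where
  "airy_bracket p q T x = vcol (fps_nth (comm (curve_ser T x) (fps_cutoff (Suc p) (curve_ser T x))) (p + q + 1))"

lemma airy_field_derivative:
  fixes \<gamma> :: "real \<Rightarrow> real^('m::finite option)"
  assumes \<gamma>: "unit_speed_curve \<gamma>" and j: "1 \<le> j" and l: "1 \<le> l"
  shows "has_field_derivative_along (airy_field l) \<gamma> (airy_field j \<gamma>)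
    (airy_bracket (2 * j - 2) (2 * l - 2) (\<lambda>x. vector_derivative \<gamma> (at x)))"
  unfolding has_field_derivative_along_def
proof (intro conjI allI impI)
  let ?T = "\<lambda>x. vector_derivative \<gamma> (at x)" and ?p = "2 * j - 2" and ?q = "2 * l - 2"
  have p: "even ?p" by simp
  note T = unit_speed_curve_tangent[OF \<gamma>]
  show "\<exists>\<alpha>. variation \<gamma> (airy_field j \<gamma>) \<alpha>"
    unfolding airy_field_eq_vel[OF \<gamma> j]
    by (rule variation_exists[OF \<gamma> vel_deriv(1)[OF T p] smooth_on_vel_deriv[OF T p] vel_deriv(3)[OF T p]])
  fix \<alpha> x assume \<alpha>: "variation \<gamma> (airy_field j \<gamma>) \<alpha>"
  then obtain \<epsilon> where \<epsilon>: "\<epsilon> > 0" "smooth_on (\<lambda>(s, x). \<alpha> s x) ({-\<epsilon><..<\<epsilon>} \<times> UNIV)"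
    "\<And>s. s \<in> {-\<epsilon><..<\<epsilon>} \<Longrightarrow> unit_speed_curve (\<alpha> s)" and \<alpha>0: "\<alpha> 0 = \<gamma>"
    and V: "\<And>x. ((\<lambda>s. \<alpha> s x) has_vector_derivative vel ?p ?T x) (at 0)"
    unfolding variation_def airy_field_eq_vel[OF \<gamma> j] by blast
  let ?I = "{-\<epsilon><..<\<epsilon>}"
  have I: "open ?I" "0 \<in> ?I" using \<epsilon>(1) by auto
  obtain Mt where Mt: "\<And>x. fps_X ^ Suc ?p * Mt x = comm (curve_ser ?T x) (fps_cutoff (Suc ?p) (curve_ser ?T x))"
    and der: "\<And>x. has_coeff_derivative (\<lambda>s. curve_ser (\<lambda>x. vector_derivative (\<alpha> s) (at x)) x) (Mt x) 0"
    using curve_ser_evolution(1)[OF I \<epsilon>(2) unit_speed_curve_tangent[OF \<epsilon>(3)] p] V unfolding \<alpha>0 by blast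
  have "fps_nth (fps_X ^ Suc ?p * Mt x) (?p + ?q + 1) = fps_nth (Mt x) ?q"
    by (simp add: fps_X_power_mult_nth del: power_Suc)
  then have W: "airy_bracket ?p ?q ?T x = vcol (fps_nth (Mt x) ?q)"
    unfolding airy_bracket_def Mt by simp
  have "((\<lambda>s. vel ?q (\<lambda>x. vector_derivative (\<alpha> s) (at x)) x) has_vector_derivative airy_bracket ?p ?q ?T x) (at 0)"
    unfolding vel_eq_vcol W
    using der[of x] unfolding has_coeff_derivative_def
    by (intro bounded_linear.has_vector_derivative[OF bounded_linear_vcol]) blast
  then show "((\<lambda>s. airy_field l (\<alpha> s) x) has_vector_derivative airy_bracket ?p ?q ?T x) (at 0)"
    by (rule has_vector_derivative_transform_within_open[OF _ I]) (simp add: airy_field_eq_vel[OF \<epsilon>(3) l])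
qed

lemma airy_flows_commute:
  assumes "1 \<le> j" "1 \<le> l"
  shows "flows_commute (curve_space L) (airy_field j) (airy_field l)"
  unfolding flows_commute_def
proof
  fix \<gamma> :: "real \<Rightarrow> real^('a option)" assume "\<gamma> \<in> curve_space L"
  then have \<gamma>: "unit_speed_curve \<gamma>" by (simp add: curve_space_def)
  let ?T = "\<lambda>x. vector_derivative \<gamma> (at x)"
  \<comment> \<open>The derivative of each field along the other sits in the same degree p + q + 1,
    only with different truncations.\<close>
  have "airy_bracket p q ?T x = airy_bracket q p ?T x" for p q x
    unfolding airy_bracket_def comm_cutoff_symmetric[where p=p and q=q] by (simp add: add.commute)
  then show "\<exists>W W'. has_field_derivative_along (airy_field l) \<gamma> (airy_field j \<gamma>) W \<and>
      has_field_derivative_along (airy_field j) \<gamma> (airy_field l \<gamma>) W' \<and> (\<forall>x. W x - W' x = 0)"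
    using airy_field_derivative[OF \<gamma> assms] airy_field_derivative[OF \<gamma> assms(2,1)] by force
qed

section \<open>Conservation of the functionals\<close>

lemma has_vector_derivative_shift_arg:
  fixes f :: "real \<Rightarrow> 'a::real_normed_vector"
  assumes "(f has_vector_derivative f') (at (x + c))"
  shows "((\<lambda>x. f (x + c)) has_vector_derivative f') (at x)"
proof -
  have "((\<lambda>x. x + c) has_vector_derivative 1) (at x)" by (auto intro!: derivative_eq_intros)
  from vector_diff_chain_at[OF this assms] show ?thesis by (simp add: o_def)
qed

text \<open>The shifted series solves the same equations over the same tangent, so uniqueness
  identifies it with the original one.\<close>

lemma curve_ser_periodic:
  assumes T: "unit_tangent T" and per: "\<And>x. T (x + L) = T x"
  shows "curve_ser T (x + L) = curve_ser T x"
proof -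
  note S = unit_tangent_pmat[OF T]
  let ?dM = "lax_deriv (\<lambda>x. pmat (T x))"
  have S_shift: "pmat (T (x + L)) = pmat (T x)" for x by (simp add: per)
  show ?thesis
  proof (rule lax_unique[where s="\<lambda>x. pmat (T x)" and M="\<lambda>x. curve_ser T (x + L)" and N="curve_ser T"
        and M'="\<lambda>x. ?dM (x + L)" and N'="?dM" and B="\<lambda>x. fps_const (pmat (T x))"])
    fix x
    show "has_coeff_derivative (\<lambda>x. curve_ser T (x + L)) (?dM (x + L)) x"
      using lax_deriv(1)[OF S, of "x + L"] unfolding has_coeff_derivative_def
      by (intro allI has_vector_derivative_shift_arg) blast
    show "fps_X * ?dM (x + L) = comm (curve_ser T (x + L)) (fps_const (pmat (T x)))"
      using lax_deriv(2)[OF S, of "x + L"] unfolding S_shift .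
    show "fps_nth (curve_ser T (x + L)) 0 = pmat (T x)"
      unfolding lax_sol_0 S_shift ..
  qed (use S in \<open>auto simp: lax_deriv lax_sol_correct lax_sol_0\<close>)
qed

text \<open>The density is proportional to the trace of coefficient 2l times S, and
  \<open>lax_conservation\<close> writes its time derivative as the x-derivative of a flux. The flux
  is built from the series of the curve, so it is periodic without reference to a frame and its
  increment over one period is 0.\<close>

lemma F_hat_derivative:
  fixes \<gamma> :: "real \<Rightarrow> real \<Rightarrow> real^('m::finite option)"
  assumes L: "0 < L" and j: "1 \<le> j" and I: "open I" and sol: "airy_solution L j I \<gamma>" and t: "t \<in> I"
  shows "((\<lambda>t. F_hat L l (\<gamma> t)) has_vector_derivative 0) (at t)"
proof -
  let ?p = "2 * j - 2" and ?n = "2 * l"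
  let ?T = "\<lambda>s x. vector_derivative (\<gamma> s) (at x)"
  have p: "even ?p" by simp
  have \<gamma>s: "smooth_on (\<lambda>(s, x). \<gamma> s x) (I \<times> UNIV)"
    using sol by (simp add: airy_solution_def)
  have curve: "unit_speed_curve (\<gamma> s)" "\<gamma> s (x + L) = \<gamma> s x" if "s \<in> I" for s x
    using sol that by (auto simp: airy_solution_def curve_space_def)
  note T = unit_speed_curve_tangent[OF curve(1)]
  have V: "((\<lambda>s. \<gamma> s x) has_vector_derivative vel ?p (?T t) x) (at t)" for x
    using sol t unfolding airy_solution_def airy_field_eq_vel[OF curve(1)[OF t] j, symmetric] by blast
  note ev = curve_ser_evolution[OF I t \<gamma>s T p V]
  obtain Mt where Mt: "\<And>x. fps_X ^ Suc ?p * Mt x = comm (curve_ser (?T t) x) (fps_cutoff (Suc ?p) (curve_ser (?T t) x))"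
    and Mt': "\<And>x. has_coeff_derivative (\<lambda>s. curve_ser (?T s) x) (Mt x) t"
    and St: "\<And>x. ((\<lambda>s. pmat (?T s x)) has_vector_derivative fps_nth (lax_deriv (\<lambda>x. pmat (?T t x)) x) ?p) (at t)"
    using ev(1) by blast
  have U: "open (I \<times> (UNIV :: real set))" using I by (simp add: open_Times)
  define f where "f q = tr (fps_nth (curve_ser (?T (fst q)) (snd q)) ?n * pmat (?T (fst q) (snd q)))" for q
  have f: "smooth_on f (I \<times> UNIV)"
    unfolding f_def[abs_def]
    by (intro smooth_on_linear[OF U bounded_linear_tr] smooth_on_mult U ev(2,3) smooth_on_linear[OF U bounded_linear_pmat])
  define flux where "flux x = tr (fps_nth (curve_ser (?T t) x * lax_flux ?p (curve_ser (?T t) x)) (?n + ?p))" for x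
  have flux': "(flux has_vector_derivative partial_t f (t, x)) (at x)" for x
  proof -
    have "((\<lambda>s. fps_nth (curve_ser (?T s) x) ?n) has_vector_derivative fps_nth (Mt x) ?n) (at t)"
      using Mt' unfolding has_coeff_derivative_def by blast
    from bounded_linear.has_vector_derivative[OF bounded_linear_tr has_vector_derivative_mult[OF this St]]
    have "((\<lambda>s. f (s, x)) has_vector_derivative tr (fps_nth (curve_ser (?T t) x) ?n * fps_nth (lax_deriv (\<lambda>x. pmat (?T t x)) x) ?p
        + fps_nth (Mt x) ?n * pmat (?T t x))) (at t)"
      by (simp add: f_def)
    then have "partial_t f (t, x) = tr (fps_nth (Mt x) ?n * pmat (?T t x)
        + fps_nth (curve_ser (?T t) x) ?n * fps_nth (lax_deriv (\<lambda>x. pmat (?T t x)) x) ?p)"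
      using has_vector_derivative_partial_t[OF f, of t x] t vector_derivative_unique_at by (fastforce simp: add.commute)
    then show ?thesis
      using lax_conservation[OF unit_tangent_pmat[OF T[OF t]] bounded_linear_tr tr_commute Mt[of x], of ?n]
      unfolding flux_def[abs_def] by simp
  qed
  have "?T t (x + L) = ?T t x" for x
  proof -
    have "(\<gamma> t has_vector_derivative ?T t (x + L)) (at (x + L))"
      using smooth_on_real_has_vector_derivative[of "\<gamma> t" UNIV] curve(1)[OF t] by (simp add: unit_speed_curve_def)
    from has_vector_derivative_shift_arg[OF this] have "(\<gamma> t has_vector_derivative ?T t (x + L)) (at x)"
      by (simp add: curve(2)[OF t])
    then show ?thesis by (simp add: vector_derivative_at)
  qed
  from curve_ser_periodic[OF T[OF t] this, of 0] have "flux L = flux 0" by (simp add: flux_def)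
  moreover have "((\<lambda>x. partial_t f (t, x)) has_integral (flux L - flux 0)) {0..L}"
    using L by (intro fundamental_theorem_of_calculus has_vector_derivative_at_within[OF flux']) auto
  ultimately have int0: "integral {0..L} (\<lambda>x. partial_t f (t, x)) = 0" by (simp add: integral_unique)
  have "((\<lambda>s. antideriv (\<lambda>x. f (s, x)) L) has_vector_derivative antideriv (\<lambda>x. partial_t f (t, x)) L) (at t)"
    by (rule antideriv_has_vector_derivative_param[OF I f t])
  moreover have "antideriv h L = integral {0..L} h" for h :: "real \<Rightarrow> real" using L by (simp add: antideriv_def)
  ultimately have "((\<lambda>s. integral {0..L} (\<lambda>x. f (s, x))) has_vector_derivative 0) (at t)"
    using int0 by simp
  \<comment> \<open>By \<open>tr_curve_ser\<close> the trace f is - 2 times the density y, so this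
    factor turns its integral into \<open>F_hat\<close>.\<close>
  from bounded_linear.has_vector_derivative[OF bounded_linear_mult_right[of "1 / (2 * (2 * real l - 1))"] this]
  have "((\<lambda>s. 1 / (2 * (2 * real l - 1)) * integral {0..L} (\<lambda>x. f (s, x))) has_vector_derivative 0) (at t)"
    by simp
  then show ?thesis
  proof (rule has_vector_derivative_transform_within_open[OF _ I t])
    fix s assume s: "s \<in> I"
    have "f (s, x) = - 2 * (vel ?n (?T s) x \<bullet> ?T s x)" for x
      by (simp only: f_def fst_conv snd_conv tr_curve_ser[OF T[OF s]])
    moreover have "1 / (2 * r) * (- 2 * i) = - (1 / r) * i" for r i :: real by simp
    ultimately show "1 / (2 * (2 * real l - 1)) * integral {0..L} (\<lambda>x. f (s, x)) = F_hat L l (\<gamma> s)"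
      unfolding F_hat_eq[OF curve(1)[OF s]] by (simp only: integral_mult_right)
  qed
qed

theorem corollary4p12:
  fixes L :: real and j l :: nat
  assumes "0 < L" and "1 \<le> j" and "1 \<le> l"
  shows "flows_commute (curve_space L :: (real \<Rightarrow> real^('m::finite option)) set) (airy_field j) (airy_field l)
    \<and> (\<forall>T (\<gamma> :: real \<Rightarrow> real \<Rightarrow> real^('m option)).
          open T \<and> is_interval T \<and> airy_solution L j T \<gamma>
          \<longrightarrow> (\<exists>c. \<forall>t\<in>T. F_hat L l (\<gamma> t) = c))"
proof (intro conjI allI impI)
  show "flows_commute (curve_space L :: (real \<Rightarrow> real^('m option)) set) (airy_field j) (airy_field l)"
    by (rule airy_flows_commute) (use assms in auto)
  fix T and \<gamma> :: "real \<Rightarrow> real \<Rightarrow> real^('m option)"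
  assume T: "open T \<and> is_interval T \<and> airy_solution L j T \<gamma>"
  then have "((\<lambda>t. F_hat L l (\<gamma> t)) has_derivative (\<lambda>h. 0)) (at t within T)" if "t \<in> T" for t
    using F_hat_derivative[OF assms(1,2), of T \<gamma> t l] that
    by (auto simp: has_vector_derivative_def intro: has_derivative_at_withinI)
  then show "\<exists>c. \<forall>t\<in>T. F_hat L l (\<gamma> t) = c"
    using T by (intro has_derivative_zero_constant) (auto simp: is_interval_convex)
qed

end
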